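(* Let $\mathcal{A}$ be a unital C*-algebra and suppose that $\mathcal{A}$ has an uncountable positive semibiorthogonal system of pure states. Then: (1) Assuming Martin's Axiom, the state space $S(\mathcal{A})$ has an uncountable discrete set. (2) If $\mathcal{A}$ is commutative, then, assuming Martin's Axiom, $\mathcal{A}$ has a UBABS+ (and therefore an uncountable almost irredundant set). (3) Assuming the Proper Forcing Axiom, the space of pure states $P(\mathcal{A})$ has an uncountable discrete set.
   Context: $S(\mathcal{A})$ (states) and $P(\mathcal{A})$ (pure states) carry the weak*-topology; a subset is discrete if it is discrete in the relative topology. Positive semibiorthogonal system: a family $(a_\alpha,\tau_\alpha)_{\alpha<\kappa}$ in $\mathcal{A}\times\mathcal{A}^*$ such that each $\tau_\alpha$ is a positive linear functional, $\tau_\alpha(a_\alpha)=1$, $\tau_\alpha(a_\beta)=0$ for $\beta<\alpha$, and $\tau_\alpha(a_\beta)\geq 0$ for all $\alpha\neq\beta$. It is a positive semibiorthogonal system of pure states if each $\tau_\alpha$ is a pure state; it is uncountable if $\kappa$ is uncountable. UBABS+ (uncountable positive bounded almost biorthogonal system) of type $\eta$: a bounded family $(a_\alpha,\tau_\alpha)_{\alpha<\omega_1}$ in $\mathcal{A}\times\mathcal{A}^*$ such that for every $\alpha<\omega_1$, $\tau_\alpha$ is a state, $a_\alpha$ is a positive element with $0<a_\alpha\leq 1$, $\tau_\alpha(a_\alpha)=1$, and $|\tau_\alpha(a_\beta)|\leq\eta$ for all $\beta\neq\alpha$. "$\mathcal{A}$ has a UBABS+" means it has a UBABS+ of type $\eta$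 for some $0\leq\eta<1$. Almost irredundant: a subset $\mathcal{X}\subseteq\mathcal{A}$ is almost irredundant if for every $a\in\mathcal{X}$, the element $a$ does not belong to the norm-closure of $$\Big\{\sum_{i=1}^n \lambda_i \prod_{j=1}^{n_i}a_{i,j}:\ a_{i,j}\in\mathcal{X}\setminus\{a\},\ \sum_{i=1}^n|\lambda_i|\leq 1\Big\},$$ where $n,n_i\geq 1$ and the $\lambda_i$ are complex scalars. Martin's Axiom is understood as $\mathrm{MA}_{\omega_1}$: for every nonempty c.c.c. partial order and every family of $\omega_1$ dense subsets there is a filter meeting all of them. *)

theory Defs
  imports "HOL-Analysis.Analysis"
begin

section \<open>Unital C*-algebras\<close>

text \<open>The real scalar multiplication of the underlying Banach algebra is the restriction of the
  complex one. The superclass \<^class>\<open>real_normed_algebra_1\<close> provides a unit of norm one, which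
  excludes only the zero algebra.\<close>

class unital_cstar_algebra = real_normed_algebra_1 + banach +
  fixes scaleC :: "complex \<Rightarrow> 'a \<Rightarrow> 'a"  (infixr \<open>*\<^sub>C\<close> 75)
    and star :: "'a \<Rightarrow> 'a"
  assumes scaleC_of_real: "complex_of_real t *\<^sub>C x = t *\<^sub>R x"
    and scaleC_add_right: "c *\<^sub>C (x + y) = c *\<^sub>C x + c *\<^sub>C y"
    and scaleC_add_left: "(c + d) *\<^sub>C x = c *\<^sub>C x + d *\<^sub>C x"
    and scaleC_scaleC: "c *\<^sub>C (d *\<^sub>C x) = (c * d) *\<^sub>C x"
    and mult_scaleC_left: "(c *\<^sub>C x) * y = c *\<^sub>C (x * y)"
    and mult_scaleC_right: "x * (c *\<^sub>C y) = c *\<^sub>C (x * y)"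
    and norm_scaleC: "norm (c *\<^sub>C x) = cmod c * norm x"
    and star_star: "star (star x) = x"
    and star_add: "star (x + y) = star x + star y"
    and star_scaleC: "star (c *\<^sub>C x) = cnj c *\<^sub>C star x"
    and star_mult: "star (x * y) = star y * star x"
    and cstar_identity: "norm (star x * x) = (norm x)\<^sup>2"

definition positive_element :: "'a::unital_cstar_algebra \<Rightarrow> bool" where
  "positive_element a \<longleftrightarrow> (\<exists>b. a = star b * b)"

text \<open>The dual space consists of the complex-linear functionals among the bounded real-linear
  maps to the complex numbers; the norm of \<open>'a \<Rightarrow>\<^sub>L complex\<close> is the operator norm.\<close>

definition cdual :: "('a::unital_cstar_algebra \<Rightarrow>\<^sub>L complex) set" where
  "cdual = {\<tau>. \<forall>c x. blinfun_apply \<tau> (c *\<^sub>C x) = c * blinfun_apply \<tau> x}"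

definition positive_functionals :: "('a::unital_cstar_algebra \<Rightarrow>\<^sub>L complex) set" where
  "positive_functionals =
     {\<tau> \<in> cdual. \<forall>a. positive_element a \<longrightarrow> blinfun_apply \<tau> a \<in> \<real>\<^sub>\<ge>\<^sub>0}"

definition states :: "('a::unital_cstar_algebra \<Rightarrow>\<^sub>L complex) set" where
  "states = {\<tau> \<in> positive_functionals. norm \<tau> = 1}"

definition pure_states :: "('a::unital_cstar_algebra \<Rightarrow>\<^sub>L complex) set" where
  "pure_states = {\<tau>. \<tau> extreme_point_of states}"

definition weak_star_topology :: "('a::unital_cstar_algebra \<Rightarrow>\<^sub>L complex) topology" where
  "weak_star_topology =
     pullback_topology cdual blinfun_apply (product_topology (\<lambda>_. euclidean) UNIV)"

definition weak_star_discrete :: "('a::unital_cstar_algebra \<Rightarrow>\<^sub>L complex) set \<Rightarrow> bool" where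
  "weak_star_discrete D \<longleftrightarrow> subtopology weak_star_topology D = discrete_topology D"


section \<open>Systems in \<open>A \<times> A*\<close> and almost irredundant sets\<close>

text \<open>The well-order \<open>r\<close> plays the role of the ordinal \<open>\<kappa>\<close>, and \<open>Field r\<close> is the index set.\<close>

definition positive_semibiorthogonal_system ::
    "'i rel \<Rightarrow> ('i \<Rightarrow> 'a::unital_cstar_algebra) \<Rightarrow> ('i \<Rightarrow> 'a \<Rightarrow>\<^sub>L complex) \<Rightarrow> bool" where
  "positive_semibiorthogonal_system r a \<tau> \<longleftrightarrow>
     Well_order r \<and>
     (\<forall>\<alpha>\<in>Field r. \<tau> \<alpha> \<in> positive_functionals \<and> blinfun_apply (\<tau> \<alpha>) (a \<alpha>) = 1) \<and>
     (\<forall>\<alpha> \<beta>. (\<beta>, \<alpha>) \<in> r \<and> \<beta> \<noteq> \<alpha> \<longrightarrow> blinfun_apply (\<tau> \<alpha>) (a \<beta>) = 0) \<and>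
     (\<forall>\<alpha>\<in>Field r. \<forall>\<beta>\<in>Field r. \<alpha> \<noteq> \<beta> \<longrightarrow> blinfun_apply (\<tau> \<alpha>) (a \<beta>) \<in> \<real>\<^sub>\<ge>\<^sub>0)"

definition positive_semibiorthogonal_system_of_pure_states ::
    "'i rel \<Rightarrow> ('i \<Rightarrow> 'a::unital_cstar_algebra) \<Rightarrow> ('i \<Rightarrow> 'a \<Rightarrow>\<^sub>L complex) \<Rightarrow> bool" where
  "positive_semibiorthogonal_system_of_pure_states r a \<tau> \<longleftrightarrow>
     positive_semibiorthogonal_system r a \<tau> \<and> (\<forall>\<alpha>\<in>Field r. \<tau> \<alpha> \<in> pure_states)"

text \<open>The first uncountable ordinal, as a well-order on a set of sets of natural numbers.\<close>

definition omega1 :: "nat set rel" where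
  "omega1 = cardSuc natLeq"

definition UBABS_plus ::
    "real \<Rightarrow> (nat set \<Rightarrow> 'a::unital_cstar_algebra) \<Rightarrow> (nat set \<Rightarrow> 'a \<Rightarrow>\<^sub>L complex) \<Rightarrow> bool" where
  "UBABS_plus \<eta> a \<tau> \<longleftrightarrow>
     bounded (a ` Field omega1) \<and> bounded (\<tau> ` Field omega1) \<and>
     (\<forall>\<alpha>\<in>Field omega1.
        \<tau> \<alpha> \<in> states \<and>
        positive_element (a \<alpha>) \<and> a \<alpha> \<noteq> 0 \<and> positive_element (1 - a \<alpha>) \<and>
        blinfun_apply (\<tau> \<alpha>) (a \<alpha>) = 1 \<and>
        (\<forall>\<beta>\<in>Field omega1. \<beta> \<noteq> \<alpha> \<longrightarrow> cmod (blinfun_apply (\<tau> \<alpha>) (a \<beta>)) \<le> \<eta>))"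

text \<open>The product \<open>a\<^sub>i\<^sub>,\<^sub>1 \<dots> a\<^sub>i\<^sub>,\<^sub>n\<^sub>i\<close> is the product of the list \<open>w i\<close>, in that order.\<close>

definition almost_irredundant :: "'a::unital_cstar_algebra set \<Rightarrow> bool" where
  "almost_irredundant X \<longleftrightarrow>
     (\<forall>a\<in>X. a \<notin> closure
        {\<Sum>i<n. c i *\<^sub>C prod_list (w i) | (n::nat) c w.
           n \<ge> 1 \<and> (\<forall>i<n. w i \<noteq> [] \<and> set (w i) \<subseteq> X - {a}) \<and> (\<Sum>i<n. cmod (c i)) \<le> 1})"


section \<open>Forcing axioms\<close>

text \<open>A forcing notion is a partial order \<open>r\<close> on a set \<open>P\<close>; \<open>(p, q) \<in> r\<close> means \<open>p \<le> q\<close>, that is,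
  \<open>p\<close> is the stronger condition.\<close>

definition compatible :: "'p set \<Rightarrow> 'p rel \<Rightarrow> 'p \<Rightarrow> 'p \<Rightarrow> bool" where
  "compatible P r p q \<longleftrightarrow> (\<exists>s\<in>P. (s, p) \<in> r \<and> (s, q) \<in> r)"

definition ccc :: "'p set \<Rightarrow> 'p rel \<Rightarrow> bool" where
  "ccc P r \<longleftrightarrow>
     (\<forall>A\<subseteq>P. (\<forall>p\<in>A. \<forall>q\<in>A. p \<noteq> q \<longrightarrow> \<not> compatible P r p q) \<longrightarrow> countable A)"

definition dense_in_poset :: "'p set \<Rightarrow> 'p rel \<Rightarrow> 'p set \<Rightarrow> bool" where
  "dense_in_poset P r D \<longleftrightarrow> D \<subseteq> P \<and> (\<forall>p\<in>P. \<exists>d\<in>D. (d, p) \<in> r)"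

definition filter_in_poset :: "'p set \<Rightarrow> 'p rel \<Rightarrow> 'p set \<Rightarrow> bool" where
  "filter_in_poset P r G \<longleftrightarrow>
     G \<subseteq> P \<and> G \<noteq> {} \<and>
     (\<forall>p\<in>G. \<forall>q\<in>P. (p, q) \<in> r \<longrightarrow> q \<in> G) \<and>
     (\<forall>p\<in>G. \<forall>q\<in>G. \<exists>s\<in>G. (s, p) \<in> r \<and> (s, q) \<in> r)"

definition meets_omega1_dense_sets :: "'p set \<Rightarrow> 'p rel \<Rightarrow> bool" where
  "meets_omega1_dense_sets P r \<longleftrightarrow>
     (\<forall>D :: nat set \<Rightarrow> 'p set. (\<forall>\<xi>\<in>Field omega1. dense_in_poset P r (D \<xi>)) \<longrightarrow>
        (\<exists>G. filter_in_poset P r G \<and> (\<forall>\<xi>\<in>Field omega1. G \<inter> D \<xi> \<noteq> {})))"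

text \<open>Closed unbounded families of countable subsets of \<open>X\<close>.\<close>

definition club_countable :: "'x set \<Rightarrow> 'x set set \<Rightarrow> bool" where
  "club_countable X C \<longleftrightarrow>
     (\<forall>M\<in>C. M \<subseteq> X \<and> countable M) \<and>
     (\<forall>N. N \<subseteq> X \<and> countable N \<longrightarrow> (\<exists>M\<in>C. N \<subseteq> M)) \<and>
     (\<forall>M :: nat \<Rightarrow> 'x set. (\<forall>n. M n \<in> C \<and> M n \<subseteq> M (Suc n)) \<longrightarrow> (\<Union>n. M n) \<in> C)"

text \<open>Whether a condition is \<open>(M,P)\<close>-generic for a countable elementary submodel \<open>M\<close> of \<open>H(\<theta>)\<close>
  depends only on the conditions and the dense sets that belong to \<open>M\<close>. A model is therefore
  represented by its trace on the disjoint union of \<open>P\<close> and the power set of \<open>P\<close>.\<close>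

definition generic_condition :: "'p set \<Rightarrow> 'p rel \<Rightarrow> ('p + 'p set) set \<Rightarrow> 'p \<Rightarrow> bool" where
  "generic_condition P r M q \<longleftrightarrow>
     q \<in> P \<and>
     (\<forall>D. Inr D \<in> M \<and> dense_in_poset P r D \<longrightarrow>
        (\<forall>s\<in>P. (s, q) \<in> r \<longrightarrow> (\<exists>d\<in>D. Inl d \<in> M \<and> compatible P r s d)))"

text \<open>Properness: for a club of countable \<open>M\<close>, every condition in \<open>M\<close> has an \<open>(M,P)\<close>-generic
  extension. Clubs of countable subsets project to and lift from larger sets, so this is the usual
  requirement for countable elementary submodels of \<open>H(\<theta>)\<close>, \<open>\<theta>\<close> large.\<close>

definition proper_forcing :: "'p set \<Rightarrow> 'p rel \<Rightarrow> bool" where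
  "proper_forcing P r \<longleftrightarrow>
     (\<exists>C. club_countable (P <+> Pow P) C \<and>
        (\<forall>M\<in>C. \<forall>p. Inl p \<in> M \<longrightarrow> (\<exists>q. (q, p) \<in> r \<and> generic_condition P r M q)))"

text \<open>A formula of HOL cannot quantify over all types, so the forcing axioms range over the partial
  orders carried by subsets of one fixed large type. For Martin's Axiom this is no restriction, as
  the axiom reduces to partial orders of size at most \<open>\<omega>\<^sub>1\<close>. The Proper Forcing Axiom below is
  implied by the full one: it is the full axiom for partial orders of size at most that of the type.\<close>

type_synonym forcing_universe = "nat set set set set"

definition Martins_Axiom :: bool where
  "Martins_Axiom \<longleftrightarrow>
     (\<forall>(P :: forcing_universe set) r.
        P \<noteq> {} \<and> partial_order_on P r \<and> ccc P r \<longrightarrow> meets_omega1_dense_sets P r)"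

definition Proper_Forcing_Axiom :: bool where
  "Proper_Forcing_Axiom \<longleftrightarrow>
     (\<forall>(P :: forcing_universe set) r.
        P \<noteq> {} \<and> partial_order_on P r \<and> proper_forcing P r \<longrightarrow> meets_omega1_dense_sets P r)"

end

theory Submission
  imports Defs
begin

text \<open>A well-order with an uncountable field contains a copy of \<open>\<omega>\<^sub>1\<close>, so let the system be
  \<open>(a\<^sub>\<alpha>, \<tau>\<^sub>\<alpha>)\<close> with \<open>\<alpha> < \<omega>\<^sub>1\<close>. For \<open>\<beta> < \<alpha>\<close> the value \<open>\<tau>\<^sub>\<alpha>(a\<^sub>\<beta>)\<close> is zero, whereas \<open>\<tau>\<^sub>\<beta>(a\<^sub>\<alpha>)\<close> can be any
  nonnegative number; call the pair bad if \<open>\<tau>\<^sub>\<beta>(a\<^sub>\<alpha>) \<ge> 1/2\<close>. On an uncountable set of indices without bad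
  pairs, a free set, the inequality \<open>\<sigma>(a\<^sub>\<alpha>) > 1/2\<close> isolates \<open>\<tau>\<^sub>\<alpha>\<close>, and the states form a discrete set. The
  theorem is about how to get a free set, or what to do without one.

  Under Martin's Axiom, force with finite free sets. If this order is ccc, an uncountable free set
  exists. If not, the \<open>\<Delta>\<close>-system argument turns an uncountable antichain into increasing blocks
  \<open>E\<^sub>\<xi>\<close> of \<open>n\<close> indices such that any two blocks are joined by a bad pair
  (\<open>Martins_Axiom_dichotomy\<close>). Because all values are nonnegative, averaging does not destroy this
  information: the average \<open>\<sigma>\<^sub>\<xi>\<close> of the states of \<open>E\<^sub>\<xi>\<close> and the sum \<open>g\<^sub>\<eta>\<close> of the elements of \<open>E\<^sub>\<eta>\<close> satisfy
  \<open>\<sigma>\<^sub>\<xi>(g\<^sub>\<eta>) \<ge> 1/(2n)\<close> for \<open>\<xi> \<le> \<eta>\<close> and \<open>\<sigma>\<^sub>\<xi>(g\<^sub>\<eta>) = 0\<close> for \<open>\<xi> > \<eta>\<close>. Hence the averages with successor index are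
  discrete (\<open>block_averages_discrete\<close>). They are no longer pure, which is why this part speaks of all
  states.

  In a commutative algebra pure states are multiplicative (\<open>pure_state_mult\<close>), so an element that is
  zero at all states of one block, and bounded away from zero on part of each other block, can be
  written down as a polynomial \<open>w\<close> in the \<open>a\<^sub>\<alpha>\<close>; the elements \<open>1 - w* w\<close> and the averages form a UBABS+
  (\<open>blocks_UBABS_plus\<close>, \<open>free_set_UBABS_plus\<close>). Its elements are almost irredundant, since in a product of
  positive elements below \<open>1\<close> each state is bounded by its value at the first factor
  (\<open>UBABS_plus_almost_irredundant\<close>).

  Under the Proper Forcing Axiom the averages are avoided, in the way in which this axiom excludes
  S-spaces. If some uncountable set of states has no countable dense subset, for the topology of the
  inequalities \<open>\<sigma>(a\<^sub>\<alpha>) < 1/2\<close>, it contains a sequence that is left-separated as well as right-separated,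
  and such a sequence is discrete (\<open>left_separated_discrete\<close>). Otherwise add to the finite free sets
  finite chains of countable models as side conditions. They force every finite pattern outside of a
  model to be one of uncountably many at each step; separability finds a copy of the pattern inside
  the model that has no bad pair with the original (\<open>large_realised_in_model\<close>), and the copy and the
  original amalgamate. So the order is proper (\<open>proper_poset\<close>), and the axiom yields an uncountable
  free set.\<close>

section \<open>The first uncountable ordinal as a type\<close>

unbundle cardinal_syntax

lemma Card_order_omega1: "Card_order omega1"
  unfolding omega1_def by (rule cardSuc_Card_order[OF natLeq_Card_order])

lemma Well_order_omega1: "Well_order omega1"
  using Card_order_omega1 card_order_on_well_order_on by blast

lemma natLeq_less_omega1: "natLeq <o omega1"
  unfolding omega1_def by (rule cardSuc_greater[OF natLeq_Card_order])

lemma countable_iff_ordLeq_natLeq: "countable A \<longleftrightarrow> |A| \<le>o natLeq"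
proof -
  have "countable A \<longleftrightarrow> |A| \<le>o |UNIV :: nat set|"
    unfolding countable_def card_of_ordLeq[symmetric] by auto
  then show ?thesis
    using card_of_nat ordLeq_ordIso_trans ordIso_symmetric by blast
qed

lemma uncountable_Field_omega1: "uncountable (Field omega1)"
proof
  assume "countable (Field omega1)"
  then have "|Field omega1| \<le>o natLeq"
    by (simp add: countable_iff_ordLeq_natLeq)
  then have "omega1 \<le>o natLeq"
    using card_of_Field_ordIso[OF Card_order_omega1] ordIso_ordLeq_trans ordIso_symmetric by blast
  then show False
    using natLeq_less_omega1 not_ordLess_ordLeq by blast
qed

lemma countable_underS_omega1:
  assumes "\<alpha> \<in> Field omega1"
  shows "countable (underS omega1 \<alpha>)"
proof -
  have "|underS omega1 \<alpha>| <o omega1"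
    using card_of_underS[OF Card_order_omega1 assms] .
  then have "|underS omega1 \<alpha>| \<le>o natLeq"
    unfolding omega1_def by (simp add: cardSuc_ordLeq_ordLess[OF natLeq_Card_order card_of_Card_order])
  then show ?thesis
    by (simp add: countable_iff_ordLeq_natLeq)
qed

text \<open>A type whose order is that of \<open>\<omega>\<^sub>1\<close>: the class \<^class>\<open>wellorder\<close> then gives minima,
  transfinite recursion and the usual notation for initial segments.\<close>

typedef w1 = "Field omega1"
  using uncountable_Field_omega1 by (metis countable_empty ex_in_conv)

instantiation w1 :: wellorder
begin

definition less_eq_w1 :: "w1 \<Rightarrow> w1 \<Rightarrow> bool" where
  "x \<le> y \<longleftrightarrow> (Rep_w1 x, Rep_w1 y) \<in> omega1"

definition less_w1 :: "w1 \<Rightarrow> w1 \<Rightarrow> bool" where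
  "x < y \<longleftrightarrow> (x \<le> y \<and> x \<noteq> y)" for x y :: w1

instance
proof
  have wo: "refl_on (Field omega1) omega1" "trans omega1" "antisym omega1"
      "total_on (Field omega1) omega1" "wf (omega1 - Id)"
    using Well_order_omega1
    unfolding well_order_on_def linear_order_on_def partial_order_on_def preorder_on_def by auto
  fix x y z :: w1
  show anti: "x \<le> y \<Longrightarrow> y \<le> x \<Longrightarrow> x = y"
    using wo(3) unfolding less_eq_w1_def antisym_def by (metis Rep_w1_inject)
  show "x < y \<longleftrightarrow> x \<le> y \<and> \<not> y \<le> x"
    using wo(3) wo(1) unfolding less_w1_def less_eq_w1_def antisym_def refl_on_def
    by (metis Rep_w1_inject Rep_w1)
  show "x \<le> x"
    using wo(1) Rep_w1 unfolding less_eq_w1_def refl_on_def by blast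
  show "x \<le> y \<Longrightarrow> y \<le> z \<Longrightarrow> x \<le> z"
    using wo(2) unfolding less_eq_w1_def trans_def by blast
  show "x \<le> y \<or> y \<le> x"
    using wo(4) wo(1) Rep_w1 unfolding less_eq_w1_def total_on_def refl_on_def by metis
  show "P a" if step: "\<And>x. (\<And>y. y < x \<Longrightarrow> P y) \<Longrightarrow> P x" for P and a :: w1
  proof -
    have "wf (inv_image (omega1 - Id) Rep_w1)"
      using wo(5) by (rule wf_inv_image)
    then show ?thesis
    proof (induction a rule: wf_induct_rule)
      case (less x)
      show ?case
        by (rule step, rule less) (auto simp: less_w1_def less_eq_w1_def Rep_w1_inject)
    qed
  qed
qed

end

lemma uncountable_UNIV_w1: "uncountable (UNIV :: w1 set)"
proof
  assume "countable (UNIV :: w1 set)"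
  then have "countable (range Rep_w1)" by blast
  moreover have "range Rep_w1 = Field omega1"
    using type_definition.Rep_range[OF type_definition_w1] .
  ultimately show False using uncountable_Field_omega1 by simp
qed

lemma countable_lessThan_w1: "countable {..<\<alpha> :: w1}"
proof -
  have "Rep_w1 ` {..<\<alpha>} \<subseteq> underS omega1 (Rep_w1 \<alpha>)"
    by (auto simp: less_w1_def less_eq_w1_def underS_def Rep_w1_inject)
  then have "countable (Rep_w1 ` {..<\<alpha>})"
    using countable_underS_omega1[OF Rep_w1] countable_subset by blast
  then show ?thesis
    by (rule countable_image_inj_on) (simp add: inj_on_def Rep_w1_inject)
qed

lemma countable_atMost_w1: "countable {..\<alpha> :: w1}"
proof -
  have "{..\<alpha>} = insert \<alpha> {..<\<alpha>}" by auto
  then show ?thesis by (simp add: countable_lessThan_w1)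
qed

text \<open>A countable subset of \<open>\<omega>\<^sub>1\<close> generates a countable initial segment, so an uncountable set
  escapes it.\<close>

lemma exists_above_countable:
  fixes X S :: "w1 set"
  assumes "countable X" "uncountable S"
  shows "\<exists>\<alpha>\<in>S. \<forall>\<beta>\<in>X. \<beta> < \<alpha>"
proof -
  have "countable (\<Union>\<beta>\<in>X. {..\<beta>})"
    using assms(1) countable_atMost_w1 by blast
  then obtain \<alpha> where "\<alpha> \<in> S" "\<alpha> \<notin> (\<Union>\<beta>\<in>X. {..\<beta>})"
    using assms(2) by (meson countable_subset subsetI)
  then show ?thesis by (auto simp: not_le)
qed

lemma uncountable_w1_if_unbounded:
  assumes "\<And>\<xi> :: w1. \<exists>\<alpha>\<in>S. \<xi> \<le> \<alpha>"
  shows "uncountable S"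
proof
  assume "countable S"
  then obtain \<xi> where "\<forall>\<beta>\<in>S. \<beta> < \<xi>"
    using exists_above_countable uncountable_UNIV_w1 by blast
  then show False using assms[of \<xi>] by force
qed

lemma uncountable_range_w1:
  fixes f :: "w1 \<Rightarrow> 'b"
  assumes "inj f"
  shows "uncountable (range f)"
  using assms countable_image_inj_on uncountable_UNIV_w1 by blast

text \<open>By transfinite recursion: each value is taken above the countably many earlier values and
  their images under \<open>g\<close>.\<close>

lemma spaced_enumeration:
  fixes S :: "w1 set" and g :: "w1 \<Rightarrow> w1"
  assumes "uncountable S"
  obtains f :: "w1 \<Rightarrow> w1" where "strict_mono f" "range f \<subseteq> S" "\<And>\<zeta> \<xi>. \<zeta> < \<xi> \<Longrightarrow> g (f \<zeta>) < f \<xi>"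
proof -
  let ?P = "\<lambda>(f :: w1 \<Rightarrow> w1) \<xi> r. r \<in> S \<and> (\<forall>\<zeta><\<xi>. f \<zeta> < r \<and> g (f \<zeta>) < r)"
  have "\<exists>f. \<forall>\<xi>. ?P f \<xi> (f \<xi>)"
  proof (rule dependent_wf_choice[where R = "{(x :: w1, y). x < y}"])
    show "wf {(x :: w1, y). x < y}" by (rule wellorder_class.wf)
    fix f :: "w1 \<Rightarrow> w1" and \<xi> :: w1
    have "countable (f ` {..<\<xi>} \<union> g ` f ` {..<\<xi>})"
      using countable_lessThan_w1 by blast
    from exists_above_countable[OF this assms]
    show "\<exists>r. ?P f \<xi> r" by auto
  qed auto
  then obtain f where f: "\<forall>\<xi>. ?P f \<xi> (f \<xi>)" ..
  show thesis
  proof (rule that)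
    show "strict_mono f" "range f \<subseteq> S" using f by (auto simp: strict_mono_def)
    show "g (f \<zeta>) < f \<xi>" if "\<zeta> < \<xi>" for \<zeta> \<xi> using f that by simp
  qed
qed

text \<open>The cardinal \<open>\<omega>\<^sub>1\<close> is at most the cardinality of the field, hence at most the length of the
  well-order itself.\<close>

lemma omega1_embeds_uncountable_well_order:
  assumes "Well_order r" "uncountable (Field r)"
  obtains e :: "w1 \<Rightarrow> 'i" where
    "\<And>\<alpha>. e \<alpha> \<in> Field r" "\<And>\<alpha> \<beta>. \<beta> < \<alpha> \<Longrightarrow> (e \<beta>, e \<alpha>) \<in> r \<and> e \<beta> \<noteq> e \<alpha>"
proof -
  have "\<not> |Field r| \<le>o natLeq"
    using assms(2) by (simp add: countable_iff_ordLeq_natLeq)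
  then have "natLeq <o |Field r|"
    using natLeq_Well_order card_of_Well_order not_ordLeq_iff_ordLess by blast
  then have "omega1 \<le>o |Field r|"
    unfolding omega1_def
    using cardSuc_ordLess_ordLeq[OF natLeq_Card_order card_of_Card_order] by blast
  moreover have "|Field r| \<le>o r"
    using card_of_least[of "Field r" r] assms(1) by (simp add: well_order_on_def)
  ultimately have "omega1 \<le>o r"
    using ordLeq_transitive by blast
  then obtain f where f: "embed omega1 r f"
    unfolding ordLeq_def by blast
  have inj: "inj_on f (Field omega1)"
    using embed_inj_on[OF Well_order_omega1 f] .
  have comp: "compat omega1 r f"
    using embed_compat[OF f] .
  show thesis
  proof
    show "f (Rep_w1 \<alpha>) \<in> Field r" for \<alpha>
      using embed_Field[OF f] Rep_w1 by blast
    show "(f (Rep_w1 \<beta>), f (Rep_w1 \<alpha>)) \<in> r \<and> f (Rep_w1 \<beta>) \<noteq> f (Rep_w1 \<alpha>)" if "\<beta> < \<alpha>" for \<alpha> \<beta>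
    proof -
      have "(Rep_w1 \<beta>, Rep_w1 \<alpha>) \<in> omega1" "Rep_w1 \<beta> \<noteq> Rep_w1 \<alpha>"
        using that by (simp_all add: less_w1_def less_eq_w1_def Rep_w1_inject)
      then show ?thesis
        using comp inj_onD[OF inj] Rep_w1 unfolding compat_def by blast
    qed
  qed
qed

unbundle no cardinal_syntax

section \<open>Forcing axioms along injections of partial orders\<close>

lemma filter_in_posetD:
  assumes "filter_in_poset P r G"
  shows "G \<subseteq> P" "G \<noteq> {}" "p \<in> G \<Longrightarrow> q \<in> P \<Longrightarrow> (p, q) \<in> r \<Longrightarrow> q \<in> G"
    "p \<in> G \<Longrightarrow> q \<in> G \<Longrightarrow> \<exists>s\<in>G. (s, p) \<in> r \<and> (s, q) \<in> r"
  using assms unfolding filter_in_poset_def by auto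

text \<open>Dense sets indexed by the type \<^typ>\<open>w1\<close> in place of the field of the well-order.\<close>

lemma meets_dense_sets_w1:
  fixes D :: "w1 \<Rightarrow> 'p set"
  assumes "meets_omega1_dense_sets P r" "\<And>\<xi>. dense_in_poset P r (D \<xi>)"
  shows "\<exists>G. filter_in_poset P r G \<and> (\<forall>\<xi>. G \<inter> D \<xi> \<noteq> {})"
proof -
  have "\<exists>G. filter_in_poset P r G \<and> (\<forall>x\<in>Field omega1. G \<inter> D (Abs_w1 x) \<noteq> {})"
    using assms(1)[unfolded meets_omega1_dense_sets_def, rule_format, of "\<lambda>x. D (Abs_w1 x)"]
      assms(2) by blast
  then obtain G where G: "filter_in_poset P r G" "\<And>x. x \<in> Field omega1 \<Longrightarrow> G \<inter> D (Abs_w1 x) \<noteq> {}"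
    by blast
  have "G \<inter> D \<xi> \<noteq> {}" for \<xi>
    using G(2)[OF Rep_w1, of \<xi>] by (simp add: Rep_w1_inverse)
  with G(1) show ?thesis by iprover
qed

text \<open>A forcing axiom speaks about partial orders on the type \<^typ>\<open>forcing_universe\<close>. The conditions
  used below have other types; an injection \<open>j\<close> carries a partial order over to the universe, and
  each ingredient of the axioms is invariant under \<open>j\<close>.\<close>

lemma map_prod_image_iff:
  assumes "inj j"
  shows "(j x, j y) \<in> map_prod j j ` r \<longleftrightarrow> (x, y) \<in> r"
  using inj_image_mem_iff[OF prod.inj_map[OF assms assms], of "(x, y)" r] by simp

lemma partial_order_on_image:
  assumes "inj j" "partial_order_on P r"
  shows "partial_order_on (j ` P) (map_prod j j ` r)"
proof -
  have r: "r \<subseteq> P \<times> P" "refl_on P r" "trans r" "antisym r"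
    using assms(2) unfolding partial_order_on_def preorder_on_def by auto
  have "map_prod j j ` r \<subseteq> j ` P \<times> j ` P" using r(1) by auto
  moreover have "refl_on (j ` P) (map_prod j j ` r)"
    using r(2) by (auto simp: refl_on_def map_prod_image_iff[OF assms(1)])
  moreover have "trans (map_prod j j ` r)"
  proof (rule transI)
    fix u v w assume *: "(u, v) \<in> map_prod j j ` r" "(v, w) \<in> map_prod j j ` r"
    obtain x y where xy: "u = j x" "v = j y" "(x, y) \<in> r" using *(1) by auto
    obtain y' z where z: "v = j y'" "w = j z" "(y', z) \<in> r" using *(2) by auto
    have "y' = y" using assms(1) xy(2) z(1) by (simp add: inj_def)
    then have "(x, z) \<in> r" using xy z r(3) by (meson transD)
    then show "(u, w) \<in> map_prod j j ` r" using xy z by (simp add: map_prod_image_iff[OF assms(1)])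
  qed
  moreover have "antisym (map_prod j j ` r)"
  proof (rule antisymI)
    fix u v assume *: "(u, v) \<in> map_prod j j ` r" "(v, u) \<in> map_prod j j ` r"
    then obtain x y where xy: "u = j x" "v = j y" "(x, y) \<in> r" by auto
    then have "(y, x) \<in> r" using * by (simp add: map_prod_image_iff[OF assms(1)])
    then have "x = y" using xy(3) r(4) by (meson antisymD)
    then show "u = v" using xy by simp
  qed
  ultimately show ?thesis unfolding partial_order_on_def preorder_on_def by blast
qed

lemma compatible_image:
  assumes "inj j"
  shows "compatible (j ` P) (map_prod j j ` r) (j p) (j q) \<longleftrightarrow> compatible P r p q"
  unfolding compatible_def by (auto simp: map_prod_image_iff[OF assms])

lemma dense_in_poset_image:
  assumes "inj j"
  shows "dense_in_poset (j ` P) (map_prod j j ` r) (j ` D) \<longleftrightarrow> dense_in_poset P r D"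
  unfolding dense_in_poset_def
  by (auto simp: map_prod_image_iff[OF assms] inj_image_subset_iff[OF assms])

lemma meets_omega1_dense_sets_image:
  assumes "inj j" "meets_omega1_dense_sets (j ` P) (map_prod j j ` r)"
  shows "meets_omega1_dense_sets P r"
  unfolding meets_omega1_dense_sets_def
proof (intro allI impI)
  fix D :: "nat set \<Rightarrow> _ set"
  assume D: "\<forall>\<xi>\<in>Field omega1. dense_in_poset P r (D \<xi>)"
  then have "\<forall>\<xi>\<in>Field omega1. dense_in_poset (j ` P) (map_prod j j ` r) (j ` D \<xi>)"
    by (simp add: dense_in_poset_image[OF assms(1)])
  then obtain G where G: "filter_in_poset (j ` P) (map_prod j j ` r) G"
      and meets: "\<forall>\<xi>\<in>Field omega1. G \<inter> j ` D \<xi> \<noteq> {}"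
    using assms(2)[unfolded meets_omega1_dense_sets_def, rule_format, of "\<lambda>\<xi>. j ` D \<xi>"] by blast
  note GD = filter_in_posetD[OF G]
  have G_eq: "G = j ` (j -` G)"
    using GD(1) by blast
  have "filter_in_poset P r (j -` G)"
    unfolding filter_in_poset_def
  proof (intro conjI ballI impI)
    show "j -` G \<subseteq> P"
      using GD(1) inj_image_mem_iff[OF assms(1)] by blast
    show "j -` G \<noteq> {}"
      using GD(2) G_eq by force
    show "q \<in> j -` G" if "p \<in> j -` G" "q \<in> P" "(p, q) \<in> r" for p q
      using GD(3)[of "j p" "j q"] that by (simp add: map_prod_image_iff[OF assms(1)])
    show "\<exists>s\<in>j -` G. (s, p) \<in> r \<and> (s, q) \<in> r" if pq: "p \<in> j -` G" "q \<in> j -` G" for p q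
    proof -
      obtain t where t: "t \<in> G" "(t, j p) \<in> map_prod j j ` r" "(t, j q) \<in> map_prod j j ` r"
        using GD(4)[of "j p" "j q"] pq unfolding vimage_eq by meson
      obtain s where "t = j s" using t(1) GD(1) by auto
      then show ?thesis
        using t by (intro bexI[of _ s]) (simp_all add: map_prod_image_iff[OF assms(1)])
    qed
  qed
  moreover have "\<forall>\<xi>\<in>Field omega1. j -` G \<inter> D \<xi> \<noteq> {}"
    using meets by blast
  ultimately show "\<exists>G. filter_in_poset P r G \<and> (\<forall>\<xi>\<in>Field omega1. G \<inter> D \<xi> \<noteq> {})"
    by blast
qed

lemma ccc_image:
  assumes "inj j" "ccc P r"
  shows "ccc (j ` P) (map_prod j j ` r)"
  unfolding ccc_def
proof (intro allI impI)
  fix A assume A: "A \<subseteq> j ` P"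
    "\<forall>p\<in>A. \<forall>q\<in>A. p \<noteq> q \<longrightarrow> \<not> compatible (j ` P) (map_prod j j ` r) p q"
  have A_eq: "A = j ` (j -` A)" using A(1) by blast
  have "j -` A \<subseteq> P"
    using A(1) inj_image_mem_iff[OF assms(1)] by blast
  moreover have "\<not> compatible P r p q" if "p \<in> j -` A" "q \<in> j -` A" "p \<noteq> q" for p q
    using A(2) that compatible_image[OF assms(1), of P r p q] inj_eq[OF assms(1), of p q] by blast
  ultimately have "countable (j -` A)"
    using assms(2)[unfolded ccc_def, rule_format, of "j -` A"] by simp
  then have "countable (j ` (j -` A))" by (rule countable_image)
  then show "countable A" using A_eq by simp
qed

lemma club_countable_image:
  assumes "inj g" "club_countable X C"
  shows "club_countable (g ` X) (image g ` C)"
  unfolding club_countable_def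
proof (intro conjI ballI allI impI)
  note C = assms(2)[unfolded club_countable_def]
  fix M assume "M \<in> image g ` C"
  with C show "M \<subseteq> g ` X" "countable M" by auto
next
  note C = assms(2)[unfolded club_countable_def]
  fix N assume N: "N \<subseteq> g ` X \<and> countable N"
  then have "g -` N \<subseteq> X" using inj_image_mem_iff[OF assms(1)] by blast
  moreover have "countable (g -` N)"
  proof (rule countable_image_inj_on)
    show "countable (g ` (g -` N))" using N countable_subset[OF image_vimage_subset] by blast
    show "inj_on g (g -` N)" using assms(1) inj_on_subset by blast
  qed
  ultimately obtain M where "M \<in> C" "g -` N \<subseteq> M"
    using C[THEN conjunct2, THEN conjunct1, rule_format, of "g -` N"] by auto
  have "N \<subseteq> g ` M"
  proof
    fix x assume "x \<in> N"
    then obtain y where "x = g y" "y \<in> g -` N" using N by auto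
    then show "x \<in> g ` M" using \<open>g -` N \<subseteq> M\<close> by blast
  qed
  with \<open>M \<in> C\<close> show "\<exists>M\<in>image g ` C. N \<subseteq> M" by (intro bexI[of _ "g ` M"]) simp_all
next
  note C = assms(2)[unfolded club_countable_def]
  fix M :: "nat \<Rightarrow> _ set" assume M: "\<forall>n. M n \<in> image g ` C \<and> M n \<subseteq> M (Suc n)"
  then have "\<forall>n. \<exists>K. M n = g ` K \<and> K \<in> C" by blast
  then obtain K where K: "\<And>n. M n = g ` K n" "\<And>n. K n \<in> C" by metis
  have "K n \<subseteq> K (Suc n)" for n
    using M K(1) inj_image_subset_iff[OF assms(1)] by metis
  then have "(\<Union>n. K n) \<in> C"
    using C[THEN conjunct2, THEN conjunct2, rule_format, of K] K(2) by simp
  moreover have "(\<Union>n. M n) = g ` (\<Union>n. K n)" using K(1) by blast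
  ultimately show "(\<Union>n. M n) \<in> image g ` C" by blast
qed

lemma proper_forcing_image:
  assumes "inj j" "proper_forcing P r"
  shows "proper_forcing (j ` P) (map_prod j j ` r)"
proof -
  let ?r = "map_prod j j ` r" and ?g = "map_sum j (image j)"
  obtain C where C: "club_countable (P <+> Pow P) C"
      "\<And>M p. M \<in> C \<Longrightarrow> Inl p \<in> M \<Longrightarrow> \<exists>q. (q, p) \<in> r \<and> generic_condition P r M q"
    using assms(2) unfolding proper_forcing_def by blast
  have g: "inj ?g"
    using assms(1) by (intro sum.inj_map) (auto simp: inj_image_eq_iff inj_def)
  have "Pow (j ` P) = image j ` Pow P"
    by (rule image_Pow_surj[symmetric]) simp
  then have "?g ` (P <+> Pow P) = j ` P <+> Pow (j ` P)"
    unfolding Plus_def by (simp add: image_Un image_image)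
  then have "club_countable (j ` P <+> Pow (j ` P)) (image ?g ` C)"
    using club_countable_image[OF g C(1)] by simp
  moreover have "\<exists>q. (q, p) \<in> ?r \<and> generic_condition (j ` P) ?r M q"
    if M: "M \<in> image ?g ` C" and p: "Inl p \<in> M" for M p
  proof -
    obtain K where K: "K \<in> C" "M = ?g ` K" using M by blast
    obtain p' where p': "Inl p' \<in> K" "p = j p'"
    proof -
      from p obtain x where "x \<in> K" "Inl p = ?g x" unfolding K(2) by blast
      then show thesis by (cases x) (auto intro: that)
    qed
    obtain q where q: "(q, p') \<in> r" "generic_condition P r K q"
      using C(2)[OF K(1) p'(1)] by blast
    have "generic_condition (j ` P) ?r M (j q)"
      unfolding generic_condition_def
    proof (intro conjI allI impI ballI)
      show "j q \<in> j ` P" using q(2) unfolding generic_condition_def by blast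
      fix D s assume D: "Inr D \<in> M \<and> dense_in_poset (j ` P) ?r D"
        and s: "s \<in> j ` P" "(s, j q) \<in> ?r"
      obtain D' where D': "Inr D' \<in> K" "D = j ` D'"
      proof -
        from D obtain x where "x \<in> K" "Inr D = ?g x" unfolding K(2) by blast
        then show thesis by (cases x) (auto intro: that)
      qed
      obtain s' where s': "s' \<in> P" "s = j s'" using s by blast
      have "dense_in_poset P r D'"
        using D unfolding D'(2) by (simp add: dense_in_poset_image[OF assms(1)])
      moreover have "(s', q) \<in> r" using s s'(2) by (simp add: map_prod_image_iff[OF assms(1)])
      ultimately obtain d where "d \<in> D'" "Inl d \<in> K" "compatible P r s' d"
        using q(2)[unfolded generic_condition_def, THEN conjunct2, rule_format, of D' s'] D'(1) s'(1)
        by blast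
      then show "\<exists>d\<in>D. Inl d \<in> M \<and> compatible (j ` P) ?r s d"
        unfolding D'(2) K(2) s'(2)
        by (intro bexI[of _ "j d"]) (auto simp: compatible_image[OF assms(1)] intro: rev_image_eqI)
    qed
    then show ?thesis using q(1) p'(2) by (auto simp: map_prod_image_iff[OF assms(1)])
  qed
  ultimately show ?thesis unfolding proper_forcing_def by blast
qed

lemma Martins_Axiom_transfer:
  fixes j :: "'p \<Rightarrow> forcing_universe" and P :: "'p set"
  assumes "Martins_Axiom" "inj j" "P \<noteq> {}" "partial_order_on P r" "ccc P r"
  shows "meets_omega1_dense_sets P r"
proof (rule meets_omega1_dense_sets_image[OF assms(2)])
  have "j ` P \<noteq> {}" using assms(3) by simp
  with partial_order_on_image[OF assms(2,4)] ccc_image[OF assms(2,5)]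
  show "meets_omega1_dense_sets (j ` P) (map_prod j j ` r)"
    using assms(1) unfolding Martins_Axiom_def by metis
qed

lemma Proper_Forcing_Axiom_transfer:
  fixes j :: "'p \<Rightarrow> forcing_universe" and P :: "'p set"
  assumes "Proper_Forcing_Axiom" "inj j" "P \<noteq> {}" "partial_order_on P r" "proper_forcing P r"
  shows "meets_omega1_dense_sets P r"
proof (rule meets_omega1_dense_sets_image[OF assms(2)])
  have "j ` P \<noteq> {}" using assms(3) by simp
  with partial_order_on_image[OF assms(2,4)] proper_forcing_image[OF assms(2,5)]
  show "meets_omega1_dense_sets (j ` P) (map_prod j j ` r)"
    using assms(1) unfolding Proper_Forcing_Axiom_def by metis
qed


section \<open>Free sets and linked blocks under Martin's Axiom\<close>

text \<open>The root \<open>\<Delta>\<close> is a set of maximal size among those contained in uncountably many members of a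
  fixed size \<open>n\<close>. By maximality, each further point lies in only countably many of these members, so
  outside of \<open>\<Delta>\<close> they can be found arbitrarily high in \<open>\<omega>\<^sub>1\<close>. The inclusion is strict since only one
  member can equal the root.\<close>

lemma delta_system:
  fixes \<A> :: "w1 set set"
  assumes unc: "uncountable \<A>" and fin: "\<And>F. F \<in> \<A> \<Longrightarrow> finite F"
  obtains \<Delta> n where "\<And>\<xi>. \<exists>F\<in>\<A>. \<Delta> \<subset> F \<and> card F = n \<and> (\<forall>x\<in>F - \<Delta>. \<xi> < x)"
proof -
  define B where "B n = {F \<in> \<A>. card F = n}" for n
  have "\<A> = (\<Union>n. B n)" unfolding B_def by blast
  then obtain n where n: "uncountable (B n)"
    using unc by (metis countable_UN countableI_type)
  define Q where "Q k \<longleftrightarrow> (\<exists>\<Delta>. finite \<Delta> \<and> card \<Delta> = k \<and> uncountable {F \<in> B n. \<Delta> \<subseteq> F})" for k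
  have "Q 0" unfolding Q_def using n by (intro exI[of _ "{}"]) simp
  have bound: "k \<le> n" if Qk: "Q k" for k
  proof -
    obtain \<Delta> where \<Delta>: "card \<Delta> = k" "uncountable {F \<in> B n. \<Delta> \<subseteq> F}"
      using Qk unfolding Q_def by blast
    from \<Delta>(2) have "{F \<in> B n. \<Delta> \<subseteq> F} \<noteq> {}" by (metis countable_empty)
    then obtain F where "F \<in> B n" "\<Delta> \<subseteq> F" by blast
    then show ?thesis using card_mono[of F \<Delta>] fin \<Delta>(1) unfolding B_def by simp
  qed
  define k where "k = (GREATEST k. Q k)"
  have "Q k" unfolding k_def by (rule GreatestI_nat[of Q, OF \<open>Q 0\<close> bound])
  then obtain \<Delta> where \<Delta>: "finite \<Delta>" "card \<Delta> = k" "uncountable {F \<in> B n. \<Delta> \<subseteq> F}"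
    unfolding Q_def by blast
  have small: "countable {F \<in> B n. insert x \<Delta> \<subseteq> F}" if "x \<notin> \<Delta>" for x
  proof (rule ccontr)
    assume "\<not> ?thesis"
    then have "Q (Suc k)" unfolding Q_def using \<Delta> that by (intro exI[of _ "insert x \<Delta>"]) simp
    then have "Suc k \<le> k" unfolding k_def by (rule Greatest_le_nat[of Q, OF _ bound])
    then show False by simp
  qed
  have "\<exists>F\<in>\<A>. \<Delta> \<subset> F \<and> card F = n \<and> (\<forall>x\<in>F - \<Delta>. \<xi> < x)" for \<xi>
  proof -
    let ?N = "insert \<Delta> (\<Union>x\<in>{..\<xi>} - \<Delta>. {F \<in> B n. insert x \<Delta> \<subseteq> F})"
    have "countable ({..\<xi>} - \<Delta>)"
      using countable_atMost_w1 countable_subset by blast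
    then have "countable ?N"
      using small by (intro countable_insert countable_UN) auto
    then have "\<not> {F \<in> B n. \<Delta> \<subseteq> F} \<subseteq> ?N"
      using \<Delta>(3) countable_subset[of "{F \<in> B n. \<Delta> \<subseteq> F}" ?N] by iprover
    then obtain F where F: "F \<in> B n" "\<Delta> \<subseteq> F" "F \<notin> ?N" by blast
    have "\<xi> < x" if x: "x \<in> F - \<Delta>" for x
      using F x by (auto simp: not_le[symmetric])
    moreover have "F \<in> \<A>" "card F = n" using F(1) unfolding B_def by auto
    ultimately show ?thesis using F by blast
  qed
  then show thesis by (rule that)
qed

text \<open>Restricted to \<open>\<beta> < \<alpha>\<close> because a semibiorthogonal system has \<open>\<tau>\<^sub>\<alpha>(a\<^sub>\<beta>) = 0\<close> for such pairs: freeness is a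
  condition on the values \<open>\<tau>\<^sub>\<beta>(a\<^sub>\<alpha>)\<close>.\<close>

definition free_of :: "(w1 \<Rightarrow> w1 \<Rightarrow> bool) \<Rightarrow> w1 set \<Rightarrow> bool" where
  "free_of bad T \<longleftrightarrow> (\<forall>\<alpha>\<in>T. \<forall>\<beta>\<in>T. \<beta> < \<alpha> \<longrightarrow> \<not> bad \<beta> \<alpha>)"

text \<open>The parameter \<open>F0\<close> restricts the partial order to the conditions below \<open>F0\<close>.\<close>

definition finite_free_above :: "(w1 \<Rightarrow> w1 \<Rightarrow> bool) \<Rightarrow> w1 set \<Rightarrow> w1 set set" where
  "finite_free_above bad F0 = {F. finite F \<and> free_of bad F \<and> F0 \<subseteq> F}"

definition reverse_inclusion :: "'x set set \<Rightarrow> 'x set rel" where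
  "reverse_inclusion P = {(p, q). p \<in> P \<and> q \<in> P \<and> q \<subseteq> p}"

lemma partial_order_reverse_inclusion: "partial_order_on P (reverse_inclusion P)"
  unfolding partial_order_on_def preorder_on_def reverse_inclusion_def
  by (auto simp: refl_on_def trans_def antisym_def)

lemma compatible_finite_free_above:
  assumes "p \<in> finite_free_above bad F0" "q \<in> finite_free_above bad F0"
  shows "compatible (finite_free_above bad F0) (reverse_inclusion (finite_free_above bad F0)) p q
    \<longleftrightarrow> free_of bad (p \<union> q)"
proof
  show "free_of bad (p \<union> q)"
    if "compatible (finite_free_above bad F0) (reverse_inclusion (finite_free_above bad F0)) p q"
    using that unfolding compatible_def reverse_inclusion_def finite_free_above_def free_of_def
    by blast
  show "compatible (finite_free_above bad F0) (reverse_inclusion (finite_free_above bad F0)) p q"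
    if "free_of bad (p \<union> q)"
    unfolding compatible_def
    using assms that
    by (intro bexI[of _ "p \<union> q"]) (auto simp: reverse_inclusion_def finite_free_above_def)
qed

text \<open>The blocks are the members of an uncountable antichain with the root of a \<open>\<Delta>\<close>-system removed.
  Each member is free, so a bad pair in the union of two of them must join their blocks.\<close>

lemma linked_blocks:
  assumes unc: "uncountable \<A>"
    and fin: "\<And>F. F \<in> \<A> \<Longrightarrow> finite F \<and> free_of bad F"
    and anti: "\<And>F F'. F \<in> \<A> \<Longrightarrow> F' \<in> \<A> \<Longrightarrow> F \<noteq> F' \<Longrightarrow> \<not> free_of bad (F \<union> F')"
  obtains E n where "\<And>\<xi> :: w1. finite (E \<xi>)" "\<And>\<xi>. card (E \<xi>) = n" "n > 0"
    "\<And>\<zeta> \<xi> \<beta> \<alpha>. \<zeta> < \<xi> \<Longrightarrow> \<beta> \<in> E \<zeta> \<Longrightarrow> \<alpha> \<in> E \<xi> \<Longrightarrow> \<beta> < \<alpha>"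
    "\<And>\<zeta> \<xi>. \<zeta> < \<xi> \<Longrightarrow> \<exists>\<beta>\<in>E \<zeta>. \<exists>\<alpha>\<in>E \<xi>. bad \<beta> \<alpha>"
proof -
  obtain \<Delta> n where "\<And>\<xi>. \<exists>F\<in>\<A>. \<Delta> \<subset> F \<and> card F = n \<and> (\<forall>x\<in>F - \<Delta>. \<xi> < x)"
    using delta_system[OF unc] fin by metis
  then obtain H where H: "\<And>\<xi>. H \<xi> \<in> \<A>" "\<And>\<xi>. \<Delta> \<subset> H \<xi>" "\<And>\<xi>. card (H \<xi>) = n"
      "\<And>\<xi> x. x \<in> H \<xi> - \<Delta> \<Longrightarrow> \<xi> < x"
    by metis
  have finH: "finite (H \<xi>)" "free_of bad (H \<xi>)" for \<xi> using fin H(1) by auto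
  obtain f :: "w1 \<Rightarrow> w1" where f: "strict_mono f" "\<And>\<zeta> \<xi>. \<zeta> < \<xi> \<Longrightarrow> Max (H (f \<zeta>)) < f \<xi>"
    using spaced_enumeration[OF uncountable_UNIV_w1, of "\<lambda>\<xi>. Max (H \<xi>)"] by metis
  define E where "E \<xi> = H (f \<xi>) - \<Delta>" for \<xi>
  have fin\<Delta>: "finite \<Delta>" using H(2) finH(1) by (meson finite_subset psubset_imp_subset)
  have finE: "finite (E \<xi>)" for \<xi> using finH unfolding E_def by simp
  have cardE: "card (E \<xi>) = n - card \<Delta>" for \<xi>
    using H(2,3) fin\<Delta> unfolding E_def by (simp add: card_Diff_subset psubset_imp_subset)
  have neE: "E \<xi> \<noteq> {}" for \<xi> using H(2) unfolding E_def by blast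
  then have pos: "n - card \<Delta> > 0" using finE cardE card_gt_0_iff by metis
  have order: "\<beta> < \<alpha>" if "\<zeta> < \<xi>" "\<beta> \<in> E \<zeta>" "\<alpha> \<in> E \<xi>" for \<zeta> \<xi> \<beta> \<alpha>
  proof -
    have "\<beta> \<le> Max (H (f \<zeta>))" using that(2) finH unfolding E_def by simp
    also have "\<dots> < f \<xi>" using f(2) that(1) .
    also have "f \<xi> < \<alpha>" using H(4) that(3) unfolding E_def by blast
    finally show ?thesis .
  qed
  have linked: "\<exists>\<beta>\<in>E \<zeta>. \<exists>\<alpha>\<in>E \<xi>. bad \<beta> \<alpha>" if "\<zeta> < \<xi>" for \<zeta> \<xi>
  proof -
    obtain x where "x \<in> E \<zeta>" using neE by blast
    then have "x \<notin> H (f \<xi>)" using order[OF that] unfolding E_def by blast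
    then have "H (f \<zeta>) \<noteq> H (f \<xi>)" using \<open>x \<in> E \<zeta>\<close> unfolding E_def by blast
    then obtain \<alpha> \<beta> where *: "\<alpha> \<in> H (f \<zeta>) \<union> H (f \<xi>)" "\<beta> \<in> H (f \<zeta>) \<union> H (f \<xi>)" "\<beta> < \<alpha>" "bad \<beta> \<alpha>"
      using anti[OF H(1) H(1)] unfolding free_of_def by blast
    have "\<not> (\<alpha> \<in> H (f \<zeta>) \<and> \<beta> \<in> H (f \<zeta>))" "\<not> (\<alpha> \<in> H (f \<xi>) \<and> \<beta> \<in> H (f \<xi>))"
      using finH(2) * unfolding free_of_def by blast+
    then have "\<alpha> \<in> E \<zeta> \<and> \<beta> \<in> E \<xi> \<or> \<alpha> \<in> E \<xi> \<and> \<beta> \<in> E \<zeta>"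
      using * H(2)[of "f \<zeta>"] H(2)[of "f \<xi>"] unfolding E_def by blast
    then show ?thesis using *(3,4) order[OF that] by (meson order.asym)
  qed
  show thesis
    by (rule that[OF finE cardE pos order linked])
qed

text \<open>An uncountable antichain of finite free sets yields the blocks. If there is none, the finite
  free sets form a ccc order, and a generic filter has a free union. For the union to be uncountable,
  the order must be cut down below a condition that forces unboundedly many elements.\<close>

lemma Martins_Axiom_dichotomy:
  assumes MA: "Martins_Axiom"
  obtains (free) T where "uncountable T" "free_of bad T"
  | (blocks) E n where "\<And>\<xi> :: w1. finite (E \<xi>)" "\<And>\<xi>. card (E \<xi>) = n" "n > 0"
    "\<And>\<zeta> \<xi> \<beta> \<alpha>. \<zeta> < \<xi> \<Longrightarrow> \<beta> \<in> E \<zeta> \<Longrightarrow> \<alpha> \<in> E \<xi> \<Longrightarrow> \<beta> < \<alpha>"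
    "\<And>\<zeta> \<xi>. \<zeta> < \<xi> \<Longrightarrow> \<exists>\<beta>\<in>E \<zeta>. \<exists>\<alpha>\<in>E \<xi>. bad \<beta> \<alpha>"
proof (cases "\<exists>\<A>. uncountable \<A> \<and> (\<forall>F\<in>\<A>. finite F \<and> free_of bad F) \<and>
    (\<forall>F\<in>\<A>. \<forall>F'\<in>\<A>. F \<noteq> F' \<longrightarrow> \<not> free_of bad (F \<union> F'))")
  case True
  then obtain \<A> where \<A>: "uncountable \<A>" "\<forall>F\<in>\<A>. finite F \<and> free_of bad F"
      "\<forall>F\<in>\<A>. \<forall>F'\<in>\<A>. F \<noteq> F' \<longrightarrow> \<not> free_of bad (F \<union> F')"
    by (elim exE conjE)
  show thesis
    by (rule linked_blocks[OF \<A>(1) \<A>(2)[rule_format] \<A>(3)[rule_format]]) (assumption+, rule blocks)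
next
  case False
  \<comment> \<open>If no singleton had this property, each \<open>{\<alpha>}\<close> would have an extension \<open>q \<alpha>\<close> with a bound \<open>g \<alpha>\<close> on
    all further elements. For a sparse set of indices \<open>\<alpha>\<close> these \<open>q \<alpha>\<close> would form an uncountable antichain.\<close>
  have "\<exists>\<alpha>. \<forall>q. finite q \<and> free_of bad q \<and> \<alpha> \<in> q \<longrightarrow>
      (\<forall>\<xi>. \<exists>s. finite s \<and> free_of bad s \<and> q \<subseteq> s \<and> (\<exists>\<gamma>\<in>s. \<xi> \<le> \<gamma>))"
  proof (rule ccontr)
    assume "\<not> ?thesis"
    then have "\<forall>\<alpha>. \<exists>q. (finite q \<and> free_of bad q \<and> \<alpha> \<in> q) \<and>
        (\<exists>\<xi>. \<not> (\<exists>s. finite s \<and> free_of bad s \<and> q \<subseteq> s \<and> (\<exists>\<gamma>\<in>s. \<xi> \<le> \<gamma>)))"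
      unfolding not_ex not_all not_imp .
    from choice[OF this] obtain q
      where q: "finite (q \<alpha>) \<and> free_of bad (q \<alpha>) \<and> \<alpha> \<in> q \<alpha>"
        and ex: "\<exists>\<xi>. \<not> (\<exists>s. finite s \<and> free_of bad s \<and> q \<alpha> \<subseteq> s \<and> (\<exists>\<gamma>\<in>s. \<xi> \<le> \<gamma>))" for \<alpha>
      by iprover
    from choice[OF allI, OF ex] obtain g
      where g': "\<not> (\<exists>s. finite s \<and> free_of bad s \<and> q \<alpha> \<subseteq> s \<and> (\<exists>\<gamma>\<in>s. g \<alpha> \<le> \<gamma>))" for \<alpha>
      by iprover
    have g: "\<gamma> < g \<alpha>" if "finite s" "free_of bad s" "q \<alpha> \<subseteq> s" "\<gamma> \<in> s" for \<alpha> s \<gamma>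
      using g'[of \<alpha>] that not_le by blast
    obtain f :: "w1 \<Rightarrow> w1" where f: "strict_mono f" "\<And>\<zeta> \<xi>. \<zeta> < \<xi> \<Longrightarrow> g (f \<zeta>) < f \<xi>"
      using spaced_enumeration[OF uncountable_UNIV_w1] by metis
    have incompat: "\<not> free_of bad (q (f \<zeta>) \<union> q (f \<xi>))" if "\<zeta> < \<xi>" for \<zeta> \<xi>
    proof
      assume "free_of bad (q (f \<zeta>) \<union> q (f \<xi>))"
      then have "f \<xi> < g (f \<zeta>)"
        using g[of "q (f \<zeta>) \<union> q (f \<xi>)" "f \<zeta>" "f \<xi>"] q by simp
      then show False using f(2)[OF that] by simp
    qed
    then have incompat': "\<not> free_of bad (q (f \<zeta>) \<union> q (f \<xi>))" if "\<zeta> \<noteq> \<xi>" for \<zeta> \<xi>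
      using that by (metis Un_commute linorder_less_linear)
    have "inj (\<lambda>\<xi>. q (f \<xi>))"
      by (rule injI, rule ccontr) (metis incompat' q Un_absorb)
    then have "uncountable (range (\<lambda>\<xi>. q (f \<xi>)))" by (rule uncountable_range_w1)
    moreover have "\<forall>F\<in>range (\<lambda>\<xi>. q (f \<xi>)). finite F \<and> free_of bad F"
      using q by simp
    moreover have "\<forall>F\<in>range (\<lambda>\<xi>. q (f \<xi>)). \<forall>F'\<in>range (\<lambda>\<xi>. q (f \<xi>)). F \<noteq> F' \<longrightarrow> \<not> free_of bad (F \<union> F')"
    proof (intro ballI impI)
      fix F F' assume "F \<in> range (\<lambda>\<xi>. q (f \<xi>))" "F' \<in> range (\<lambda>\<xi>. q (f \<xi>))" "F \<noteq> F'"
      then obtain \<zeta> \<xi> where "F = q (f \<zeta>)" "F' = q (f \<xi>)" "\<zeta> \<noteq> \<xi>" by auto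
      then show "\<not> free_of bad (F \<union> F')" using incompat' by simp
    qed
    ultimately show False using False by iprover
  qed
  then obtain \<alpha>0 where above: "\<And>q \<xi>. finite q \<Longrightarrow> free_of bad q \<Longrightarrow> \<alpha>0 \<in> q \<Longrightarrow>
      \<exists>s. finite s \<and> free_of bad s \<and> q \<subseteq> s \<and> (\<exists>\<gamma>\<in>s. \<xi> \<le> \<gamma>)"
    by iprover
  let ?P = "finite_free_above bad {\<alpha>0}"
  let ?r = "reverse_inclusion ?P"
  have "{\<alpha>0} \<in> ?P" by (simp add: finite_free_above_def free_of_def)
  moreover have "ccc ?P ?r"
    unfolding ccc_def
  proof (intro allI impI)
    fix A assume A: "A \<subseteq> ?P" "\<forall>p\<in>A. \<forall>q\<in>A. p \<noteq> q \<longrightarrow> \<not> compatible ?P ?r p q"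
    have "\<not> free_of bad (p \<union> q)" if "p \<in> A" "q \<in> A" "p \<noteq> q" for p q
      using A(2)[rule_format, OF that]
        compatible_finite_free_above[OF subsetD[OF A(1) that(1)] subsetD[OF A(1) that(2)]] by simp
    moreover have "finite p \<and> free_of bad p" if "p \<in> A" for p
      using subsetD[OF A(1) that] unfolding finite_free_above_def by simp
    ultimately show "countable A" using False by meson
  qed
  moreover have "inj (\<lambda>F :: w1 set. {{Rep_w1 ` F}})"
    by (simp add: inj_def inj_image_eq_iff Rep_w1_inject)
  ultimately have meets: "meets_omega1_dense_sets ?P ?r"
    using Martins_Axiom_transfer[OF MA _ _ partial_order_reverse_inclusion] by (metis empty_iff)
  have "dense_in_poset ?P ?r {s \<in> ?P. \<exists>\<gamma>\<in>s. \<xi> \<le> \<gamma>}" for \<xi>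
    unfolding dense_in_poset_def
  proof (intro conjI ballI)
    fix q assume q: "q \<in> ?P"
    then obtain s where "finite s" "free_of bad s" "q \<subseteq> s" "\<exists>\<gamma>\<in>s. \<xi> \<le> \<gamma>"
      using above[of q \<xi>] unfolding finite_free_above_def by auto
    then show "\<exists>d\<in>{s \<in> ?P. \<exists>\<gamma>\<in>s. \<xi> \<le> \<gamma>}. (d, q) \<in> ?r"
      using q by (intro bexI[of _ s]) (auto simp: finite_free_above_def reverse_inclusion_def)
  qed auto
  from meets_dense_sets_w1[OF meets this]
  obtain G where G: "filter_in_poset ?P ?r G" "\<And>\<xi>. G \<inter> {s \<in> ?P. \<exists>\<gamma>\<in>s. \<xi> \<le> \<gamma>} \<noteq> {}"
    by iprover
  have "uncountable (\<Union>G)"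
    by (rule uncountable_w1_if_unbounded) (use G(2) in blast)
  moreover have "free_of bad (\<Union>G)"
    unfolding free_of_def
  proof (intro ballI impI)
    fix \<alpha> \<beta> assume "\<alpha> \<in> \<Union>G" "\<beta> \<in> \<Union>G" "\<beta> < \<alpha>"
    then obtain p q where "p \<in> G" "q \<in> G" "\<alpha> \<in> p" "\<beta> \<in> q" by blast
    then obtain s where "s \<in> G" "(s, p) \<in> ?r" "(s, q) \<in> ?r"
      using filter_in_posetD(4)[OF G(1)] by meson
    then have "free_of bad s" "\<alpha> \<in> s" "\<beta> \<in> s"
      using \<open>\<alpha> \<in> p\<close> \<open>\<beta> \<in> q\<close> unfolding reverse_inclusion_def finite_free_above_def by auto
    then show "\<not> bad \<beta> \<alpha>" using \<open>\<beta> < \<alpha>\<close> unfolding free_of_def by blast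
  qed
  ultimately show thesis by (rule free)
qed

section \<open>Clubs of countable sets closed under demands\<close>

text \<open>The countable subsets of \<open>X\<close> that contain every element of \<open>X\<close> demanded by their finite subsets. This
  plays the role of the countable elementary submodels: the Skolem functions that an argument uses
  become demands.\<close>

definition closed_sets :: "'x set \<Rightarrow> ('x set \<Rightarrow> 'x set) \<Rightarrow> 'x set set" where
  "closed_sets X \<Phi> = {M. M \<subseteq> X \<and> countable M \<and> (\<forall>e. finite e \<and> e \<subseteq> M \<longrightarrow> \<Phi> e \<inter> X \<subseteq> M)}"

lemma closed_setsD:
  assumes "M \<in> closed_sets X \<Phi>" "finite e" "e \<subseteq> M" "x \<in> \<Phi> e" "x \<in> X"
  shows "x \<in> M"
  using assms unfolding closed_sets_def by blast

lemma finite_subset_incseq_Union: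
  fixes M :: "nat \<Rightarrow> 'x set"
  assumes "finite e" "e \<subseteq> (\<Union>n. M n)" "\<And>n. M n \<subseteq> M (Suc n)"
  shows "\<exists>n. e \<subseteq> M n"
  using assms(1,2)
proof (induction e)
  case (insert x e)
  then obtain n m where "e \<subseteq> M n" "x \<in> M m" by auto
  moreover have "M n \<subseteq> M (max n m)" "M m \<subseteq> M (max n m)"
    by (rule lift_Suc_mono_le[of M, OF assms(3)]; simp)+
  ultimately show ?case by blast
qed simp

text \<open>Cofinality is a closing-off argument in \<open>\<omega>\<close> steps.\<close>

lemma club_closed_sets:
  assumes "\<And>e. finite e \<Longrightarrow> countable (\<Phi> e)"
  shows "club_countable X (closed_sets X \<Phi>)"
  unfolding club_countable_def
proof (intro conjI ballI allI impI)
  fix M assume "M \<in> closed_sets X \<Phi>"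
  then show "M \<subseteq> X" "countable M" unfolding closed_sets_def by auto
next
  fix N assume N: "N \<subseteq> X \<and> countable N"
  define step where "step M = M \<union> (\<Union>e\<in>{e. finite e \<and> e \<subseteq> M}. \<Phi> e \<inter> X)" for M
  define K where "K n = (step ^^ n) N" for n
  have K: "K 0 = N" "K (Suc n) = step (K n)" for n unfolding K_def by simp_all
  have K_props: "K n \<subseteq> X \<and> countable (K n)" for n
  proof (induction n)
    case 0
    show ?case using N K(1) by simp
  next
    case (Suc n)
    have "countable (\<Union>e\<in>{e. finite e \<and> e \<subseteq> K n}. \<Phi> e \<inter> X)"
    proof (rule countable_UN)
      show "countable {e. finite e \<and> e \<subseteq> K n}"
        using countable_Collect_finite_subset Suc by blast
      show "countable (\<Phi> e \<inter> X)" if "e \<in> {e. finite e \<and> e \<subseteq> K n}" for e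
        using assms that by simp
    qed
    then show ?case using Suc unfolding K(2) step_def by auto
  qed
  have K_mono: "K n \<subseteq> K (Suc n)" for n unfolding K(2) step_def by blast
  have "(\<Union>n. K n) \<in> closed_sets X \<Phi>"
    unfolding closed_sets_def
  proof (intro CollectI conjI allI impI)
    show "(\<Union>n. K n) \<subseteq> X" "countable (\<Union>n. K n)" using K_props by auto
    fix e assume e: "finite e \<and> e \<subseteq> (\<Union>n. K n)"
    then obtain n where n: "e \<subseteq> K n"
      using finite_subset_incseq_Union[of e K] K_mono by meson
    have "\<Phi> e \<inter> X \<subseteq> K (Suc n)"
      unfolding K(2) step_def using e n by blast
    then show "\<Phi> e \<inter> X \<subseteq> (\<Union>n. K n)" by blast
  qed
  moreover have "N \<subseteq> (\<Union>n. K n)" using K(1) by blast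
  ultimately show "\<exists>M\<in>closed_sets X \<Phi>. N \<subseteq> M" by (rule rev_bexI)
next
  fix M :: "nat \<Rightarrow> 'a set" assume M: "\<forall>n. M n \<in> closed_sets X \<Phi> \<and> M n \<subseteq> M (Suc n)"
  show "(\<Union>n. M n) \<in> closed_sets X \<Phi>"
    unfolding closed_sets_def
  proof (intro CollectI conjI allI impI)
    show "(\<Union>n. M n) \<subseteq> X" "countable (\<Union>n. M n)" using M unfolding closed_sets_def by auto
    fix e assume e: "finite e \<and> e \<subseteq> (\<Union>n. M n)"
    then obtain n where n: "e \<subseteq> M n"
      using finite_subset_incseq_Union[of e M] M by meson
    have "M n \<in> closed_sets X \<Phi>" using M by simp
    then have "\<Phi> e \<inter> X \<subseteq> M n"
      using e n unfolding closed_sets_def by simp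
    then show "\<Phi> e \<inter> X \<subseteq> (\<Union>n. M n)" by blast
  qed
qed


section \<open>Codes for countable models\<close>

text \<open>Models are countable sets of codes, and a model is itself given by a code, so that one model can
  be an element of another. A code of a model packs a sequence of codes into one set, with
  \<^const>\<open>prod_encode\<close> combining the position in the sequence with the first component. The pairs
  \<open>(0, l)\<close> in a code describe a set of lists of ordinals.\<close>

type_synonym code = "(nat \<times> w1 list) set"

definition members :: "code \<Rightarrow> code set" where
  "members c = range (\<lambda>n. {(m, l). (prod_encode (n, m), l) \<in> c})"

lemma countable_members: "countable (members c)"
  unfolding members_def by simp

lemma members_surj:
  assumes "countable N" "N \<noteq> {}"
  obtains c where "members c = N"
proof -
  let ?c = "{(k, l). (snd (prod_decode k), l) \<in> from_nat_into N (fst (prod_decode k))}"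
  have "members ?c = range (from_nat_into N)"
    unfolding members_def by simp
  also have "\<dots> = N" using range_from_nat_into[OF assms(2,1)] .
  finally show thesis by (rule that)
qed

definition ordinal :: "w1 \<Rightarrow> code" where
  "ordinal \<alpha> = {(0, [\<alpha>])}"

lemma inj_ordinal: "inj ordinal"
  unfolding ordinal_def by (rule injI) simp

definition ord_part :: "code set \<Rightarrow> w1 set" where
  "ord_part N = {\<alpha>. ordinal \<alpha> \<in> N}"

lemma ord_part_mono: "N \<subseteq> N' \<Longrightarrow> ord_part N \<subseteq> ord_part N'"
  unfolding ord_part_def by blast

lemma countable_ord_part:
  assumes "countable N"
  shows "countable (ord_part N)"
proof (rule countable_image_inj_on)
  show "countable (ordinal ` ord_part N)"
    by (rule countable_subset[OF _ assms]) (auto simp: ord_part_def)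
  show "inj_on ordinal (ord_part N)" using inj_ordinal inj_on_subset by blast
qed

lemma finite_ord_part:
  assumes "finite N"
  shows "finite (ord_part N)"
proof (rule finite_imageD)
  show "finite (ordinal ` ord_part N)"
    by (rule finite_subset[OF _ assms]) (auto simp: ord_part_def)
  show "inj_on ordinal (ord_part N)" using inj_ordinal inj_on_subset by blast
qed

text \<open>The derivative at \<open>\<alpha>\<close> of the set of lists described by \<open>c\<close>.\<close>

definition tail :: "w1 \<Rightarrow> code \<Rightarrow> code" where
  "tail \<alpha> c = {(m, l). (m, \<alpha> # l) \<in> c}"

text \<open>Uncountably many \<open>\<alpha>\<^sub>1\<close> such that for uncountably many \<open>\<alpha>\<^sub>2\<close> and so on the list \<open>[\<alpha>\<^sub>1, \<dots>, \<alpha>\<^sub>n]\<close> is in the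
  set of lists described by \<open>c\<close>.\<close>

primrec large :: "nat \<Rightarrow> code \<Rightarrow> bool" where
  "large 0 c \<longleftrightarrow> (0, []) \<in> c"
| "large (Suc n) c \<longleftrightarrow> uncountable {\<alpha>. large n (tail \<alpha> c)}"


section \<open>Finite free sets with chains of models as side conditions\<close>

text \<open>Think of \<open>bad \<beta> \<alpha>\<close> as \<open>x\<^sub>\<beta> \<in> U\<^sub>\<alpha>\<close> for a closed neighbourhood \<open>U\<^sub>\<alpha>\<close> of a point \<open>x\<^sub>\<alpha>\<close> that omits all later
  points. The set \<open>skeleton B\<close> is countable and dense in \<open>{x\<^sub>\<beta>. \<beta> \<in> B}\<close> for the topology generated
  by the complements of the \<open>U\<^sub>\<alpha>\<close>. The relation is thus that of a right-separated, hereditarily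
  separable space, and the goal is an uncountable discrete subspace.\<close>

locale separable_relation =
  fixes bad :: "w1 \<Rightarrow> w1 \<Rightarrow> bool" and skeleton :: "w1 set \<Rightarrow> w1 set"
  assumes bad_le: "bad \<beta> \<alpha> \<Longrightarrow> \<beta> \<le> \<alpha>"
    and countable_skeleton: "countable (skeleton B)"
    and skeleton_subset: "skeleton B \<subseteq> B"
    and skeleton_dense: "\<lbrakk>finite A; \<beta> \<in> B; \<forall>\<alpha>\<in>A. \<not> bad \<beta> \<alpha>\<rbrakk> \<Longrightarrow>
      \<exists>\<gamma>\<in>skeleton B. \<forall>\<alpha>\<in>A. \<not> bad \<gamma> \<alpha>"
begin

text \<open>The ordinals that a model containing \<open>c\<close> must contain: all possible first entries if there are
  only countably many, and otherwise a countable dense set of them. The first case makes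
  \<^const>\<open>large\<close> hold for patterns realised outside the model, the second one reflects large patterns
  into the model.\<close>

definition witness :: "nat \<Rightarrow> code \<Rightarrow> w1 set" where
  "witness n c = (let B = {\<alpha>. large n (tail \<alpha> c)} in if countable B then B else skeleton B)"

lemma countable_witness: "countable (witness n c)"
  unfolding witness_def Let_def by (simp add: countable_skeleton)

text \<open>What is used of a countable elementary submodel: closure under derivatives, under the witnesses
  above, under taking elements of coded models, and downwards on the ordinals.\<close>

definition good :: "code set \<Rightarrow> bool" where
  "good N \<longleftrightarrow>
     (\<forall>c\<in>N. \<forall>\<alpha>\<in>ord_part N. tail \<alpha> c \<in> N) \<and>
     (\<forall>c\<in>N. \<forall>n. witness n c \<subseteq> ord_part N) \<and>
     (\<forall>d\<in>N. members d \<subseteq> N) \<and>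
     (\<forall>\<alpha>\<in>ord_part N. \<forall>\<beta><\<alpha>. \<beta> \<in> ord_part N)"

lemma goodD:
  assumes "good N"
  shows "\<lbrakk>c \<in> N; \<alpha> \<in> ord_part N\<rbrakk> \<Longrightarrow> tail \<alpha> c \<in> N"
    "\<lbrakk>c \<in> N; \<alpha> \<in> witness n c\<rbrakk> \<Longrightarrow> \<alpha> \<in> ord_part N"
    "d \<in> N \<Longrightarrow> members d \<subseteq> N"
    "\<lbrakk>\<alpha> \<in> ord_part N; \<beta> < \<alpha>\<rbrakk> \<Longrightarrow> \<beta> \<in> ord_part N"
  using assms unfolding good_def by (simp_all add: subset_iff)

text \<open>The entries are chosen one after another. At each step there are uncountably many candidates, and
  those above \<open>A\<close> avoid \<open>A\<close> by \<open>bad_le\<close>. By density some candidate in the skeleton,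
  hence in the model, avoids \<open>A\<close> as well.\<close>

lemma large_realised_in_model:
  assumes "good N" "finite A" "c \<in> N" "large n c"
  shows "\<exists>l. length l = n \<and> (0, l) \<in> c \<and> set l \<subseteq> ord_part N \<and> (\<forall>\<beta>\<in>set l. \<forall>\<alpha>\<in>A. \<not> bad \<beta> \<alpha>)"
  using assms(3,4)
proof (induction n arbitrary: c)
  case 0
  then show ?case by (intro exI[of _ "[]"]) simp
next
  case (Suc n)
  let ?B = "{\<alpha>. large n (tail \<alpha> c)}"
  have unc: "uncountable ?B" using Suc.prems(2) by simp
  then obtain \<beta> where \<beta>: "\<beta> \<in> ?B" "\<forall>\<alpha>\<in>A. \<alpha> < \<beta>"
    using exists_above_countable[OF countable_finite[OF assms(2)]] by meson
  have "\<forall>\<alpha>\<in>A. \<not> bad \<beta> \<alpha>" using \<beta>(2) bad_le by (meson leD)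
  from skeleton_dense[OF assms(2) \<beta>(1) this]
  obtain \<gamma> where \<gamma>: "\<gamma> \<in> skeleton ?B" "\<forall>\<alpha>\<in>A. \<not> bad \<gamma> \<alpha>" by meson
  have "\<gamma> \<in> witness n c" unfolding witness_def Let_def using unc \<gamma>(1) by simp
  then have tr: "\<gamma> \<in> ord_part N" using goodD(2)[OF assms(1) Suc.prems(1)] by simp
  then have "tail \<gamma> c \<in> N" using goodD(1)[OF assms(1) Suc.prems(1)] by simp
  moreover have "large n (tail \<gamma> c)" using \<gamma>(1) skeleton_subset by blast
  ultimately obtain l where l: "length l = n" "(0, l) \<in> tail \<gamma> c" "set l \<subseteq> ord_part N"
      "\<forall>\<beta>\<in>set l. \<forall>\<alpha>\<in>A. \<not> bad \<beta> \<alpha>"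
    using Suc.IH by meson
  show ?case
    using l tr \<gamma>(2) by (intro exI[of _ "\<gamma> # l"]) (auto simp: tail_def)
qed

definition separated_by :: "code set \<Rightarrow> w1 set \<Rightarrow> bool" where
  "separated_by D F \<longleftrightarrow>
     (\<forall>\<alpha>\<in>F. \<forall>\<beta>\<in>F. \<alpha> < \<beta> \<longrightarrow> (\<exists>d\<in>D. \<alpha> \<in> ord_part (members d) \<and> \<beta> \<notin> ord_part (members d)))"

definition model_chain :: "code set \<Rightarrow> bool" where
  "model_chain D \<longleftrightarrow> (\<forall>d\<in>D. good (members d)) \<and>
     (\<forall>d\<in>D. \<forall>d'\<in>D. d = d' \<or> d \<in> members d' \<or> d' \<in> members d)"

text \<open>Finite free sets are the working part. The models in \<open>D\<close> separate the elements of \<open>F\<close>: this makes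
  every finite pattern that a condition contains outside of one of its models a large one.\<close>

definition cond :: "w1 set \<Rightarrow> code set \<Rightarrow> bool" where
  "cond F D \<longleftrightarrow> finite F \<and> finite D \<and> free_of bad F \<and> model_chain D \<and> separated_by D F"

lemma model_chainD:
  assumes "model_chain D" "d \<in> D"
  shows "good (members d)" "d' \<in> D \<Longrightarrow> d = d' \<or> d \<in> members d' \<or> d' \<in> members d"
  using assms unfolding model_chain_def by simp_all

lemma model_chain_subset:
  assumes "model_chain D" "d \<in> D" "d' \<in> D" "d \<in> members d'"
  shows "members d \<subseteq> members d'"
  using goodD(3)[OF model_chainD(1)[OF assms(1,3)] assms(4)] .

text \<open>Between any two entries of the list there is a model that contains the earlier one and the code,
  but not the later one. If only countably many first entries were possible, all of them would belong
  to the model \<open>d0\<close>, contrary to the choice of the list; the same applies to each later entry, with the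
  derivative of \<open>c\<close> and the model next to it.\<close>

lemma pattern_large:
  assumes "cond F D" "d0 \<in> D" "sorted_wrt (<) l" "set l \<subseteq> F" "set l \<inter> ord_part (members d0) = {}"
    "c \<in> members d0" "(0, l) \<in> c"
  shows "large (length l) c"
  using assms(2-)
proof (induction l arbitrary: c d0)
  case (Cons \<alpha> l)
  have chain: "model_chain D" and sep: "separated_by D F" using assms(1) unfolding cond_def by simp_all
  have tail_in: "(0, l) \<in> tail \<alpha> c" using Cons.prems(6) unfolding tail_def by simp
  have "large (length l) (tail \<alpha> c)"
  proof (cases l)
    case Nil
    then show ?thesis using tail_in by simp
  next
    case (Cons \<beta> l')
    have "\<alpha> \<in> F" "\<beta> \<in> F" "\<alpha> < \<beta>" using Cons.prems(2,3) Cons by auto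
    then obtain d1 where d1: "d1 \<in> D" "\<alpha> \<in> ord_part (members d1)" "\<beta> \<notin> ord_part (members d1)"
      using sep unfolding separated_by_def by meson
    have g1: "good (members d1)" using model_chainD(1)[OF chain d1(1)] .
    have "\<alpha> \<notin> ord_part (members d0)" using Cons.prems(4) by simp
    then have "d1 \<noteq> d0" "\<not> members d1 \<subseteq> members d0" using d1(2) ord_part_mono by auto
    then have "d0 \<in> members d1"
      using model_chainD(2)[OF chain d1(1) Cons.prems(1)] model_chain_subset[OF chain d1(1) Cons.prems(1)]
      by meson
    then have sub: "members d0 \<subseteq> members d1" using goodD(3)[OF g1] by simp
    have "set l \<inter> ord_part (members d1) = {}"
    proof -
      have "\<gamma> \<notin> ord_part (members d1)" if "\<gamma> \<in> set l" for \<gamma>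
      proof
        assume \<gamma>: "\<gamma> \<in> ord_part (members d1)"
        have "\<beta> = \<gamma> \<or> \<beta> < \<gamma>" using that Cons Cons.prems(2) by auto
        then have "\<beta> \<in> ord_part (members d1)" using \<gamma> goodD(4)[OF g1 \<gamma>] by auto
        then show False using d1(3) by simp
      qed
      then show ?thesis by blast
    qed
    moreover have "tail \<alpha> c \<in> members d1"
      using goodD(1)[OF g1 _ d1(2)] sub Cons.prems(5) by blast
    ultimately show ?thesis
      using Cons.IH[OF d1(1)] Cons.prems(2,3) tail_in by simp
  qed
  then have \<alpha>: "\<alpha> \<in> {\<alpha>. large (length l) (tail \<alpha> c)}" by simp
  show ?case
  proof (rule ccontr)
    assume "\<not> large (length (\<alpha> # l)) c"
    then have "countable {\<alpha>. large (length l) (tail \<alpha> c)}" by simp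
    then have "\<alpha> \<in> witness (length l) c" using \<alpha> unfolding witness_def Let_def by simp
    then have "\<alpha> \<in> ord_part (members d0)"
      using goodD(2)[OF model_chainD(1)[OF chain Cons.prems(1)] Cons.prems(5)] by simp
    then show False using Cons.prems(4) by simp
  qed
qed simp

text \<open>A model of \<open>D\<close> that separates two ordinals of the model \<open>d\<close> cannot contain \<open>d\<close>, so it is an element of \<open>d\<close>.\<close>

lemma cond_restrict:
  assumes "cond F D" "d \<in> D"
  shows "cond (F \<inter> ord_part (members d)) (D \<inter> members d)"
proof -
  have chain: "model_chain D" using assms(1) unfolding cond_def by simp
  have "separated_by (D \<inter> members d) (F \<inter> ord_part (members d))"
    unfolding separated_by_def
  proof (intro ballI impI)
    fix \<alpha> \<beta> assume \<alpha>: "\<alpha> \<in> F \<inter> ord_part (members d)" and \<beta>: "\<beta> \<in> F \<inter> ord_part (members d)" and "\<alpha> < \<beta>"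
    then obtain d' where d': "d' \<in> D" "\<alpha> \<in> ord_part (members d')" "\<beta> \<notin> ord_part (members d')"
      using assms(1) unfolding cond_def separated_by_def by auto
    have "d \<noteq> d'" "\<not> members d \<subseteq> members d'" using d'(3) \<beta> ord_part_mono by auto
    then have "d' \<in> members d"
      using model_chainD(2)[OF chain assms(2) d'(1)] model_chain_subset[OF chain assms(2) d'(1)] by meson
    then show "\<exists>d'\<in>D \<inter> members d. \<alpha> \<in> ord_part (members d') \<and> \<beta> \<notin> ord_part (members d')"
      using d' by (intro bexI[of _ d']) simp_all
  qed
  then show ?thesis
    using assms(1) unfolding cond_def free_of_def model_chain_def by auto
qed

lemma cond_insert_model:
  assumes "cond F D" "good (members d)" "F \<subseteq> ord_part (members d)" "D \<subseteq> members d"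
  shows "cond F (insert d D)"
  using assms unfolding cond_def model_chain_def separated_by_def by (auto simp: subset_iff)

text \<open>The condition \<open>(F, D)\<close> contains the model \<open>d\<close>, and \<open>(F', D')\<close> lies inside \<open>d\<close> and extends the part of
  \<open>(F, D)\<close> that \<open>d\<close> sees. New pairs join an ordinal inside \<open>d\<close> with one outside, and \<open>d\<close> separates them.
  The models of \<open>D'\<close> are elements of \<open>d\<close> and hence of all models of \<open>D\<close> above \<open>d\<close>.\<close>

lemma cond_amalgamate:
  assumes r: "cond F D" "d \<in> D" and x: "cond F' D'" "F' \<subseteq> ord_part (members d)" "D' \<subseteq> members d"
    and ext: "F \<inter> ord_part (members d) \<subseteq> F'" "D \<inter> members d \<subseteq> D'"
    and avoid: "\<And>\<alpha> \<beta>. \<alpha> \<in> F - ord_part (members d) \<Longrightarrow> \<beta> \<in> F' \<Longrightarrow> \<not> bad \<beta> \<alpha>"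
  shows "cond (F \<union> F') (D \<union> D')"
proof -
  have chain: "model_chain D" "model_chain D'" using r(1) x(1) unfolding cond_def by simp_all
  have gd: "good (members d)" using model_chainD(1)[OF chain(1) r(2)] .
  have above: "\<beta> < \<alpha>" if "\<alpha> \<in> F - ord_part (members d)" "\<beta> \<in> F'" for \<alpha> \<beta>
  proof (rule ccontr)
    assume "\<not> \<beta> < \<alpha>"
    then have "\<alpha> = \<beta> \<or> \<alpha> < \<beta>" by auto
    moreover have "\<beta> \<in> ord_part (members d)" using that(2) x(2) by blast
    ultimately have "\<alpha> \<in> ord_part (members d)" using goodD(4)[OF gd] by auto
    then show False using that(1) by simp
  qed
  have "free_of bad (F \<union> F')"
    unfolding free_of_def
  proof (intro ballI impI)
    fix \<alpha> \<beta> assume \<alpha>: "\<alpha> \<in> F \<union> F'" and \<beta>: "\<beta> \<in> F \<union> F'" and lt: "\<beta> < \<alpha>"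
    consider "\<alpha> \<in> F'" "\<beta> \<in> F'" | "\<alpha> \<in> F" "\<beta> \<in> F" | "\<alpha> \<in> F - ord_part (members d)" "\<beta> \<in> F'"
      | "\<alpha> \<in> F'" "\<beta> \<in> F - ord_part (members d)"
      using \<alpha> \<beta> ext(1) by blast
    then show "\<not> bad \<beta> \<alpha>"
    proof cases
      case 1
      then show ?thesis using x(1) lt unfolding cond_def free_of_def by simp
    next
      case 2
      then show ?thesis using r(1) lt unfolding cond_def free_of_def by simp
    next
      case 3
      then show ?thesis by (rule avoid)
    next
      case 4
      then show ?thesis using above[OF 4(2,1)] lt by simp
    qed
  qed
  moreover have "model_chain (D \<union> D')"
    unfolding model_chain_def
  proof (intro conjI ballI)
    fix e assume "e \<in> D \<union> D'"
    then show "good (members e)" using model_chainD(1) chain by blast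
  next
    have mixed: "e \<in> D' \<or> e' \<in> members e" if "e \<in> D" "e' \<in> D'" for e e'
    proof -
      have "e' \<in> members d" using that(2) x(3) by blast
      then show ?thesis
        using model_chainD(2)[OF chain(1) r(2) that(1)] model_chain_subset[OF chain(1) r(2) that(1)]
          ext(2) that(1) by blast
    qed
    fix e e' assume e: "e \<in> D \<union> D'" "e' \<in> D \<union> D'"
    consider "e \<in> D" "e' \<in> D" | "e \<in> D'" "e' \<in> D'" | "e \<in> D" "e' \<in> D'" | "e \<in> D'" "e' \<in> D"
      using e by blast
    then show "e = e' \<or> e \<in> members e' \<or> e' \<in> members e"
    proof cases
      case 1
      then show ?thesis using model_chainD(2)[OF chain(1)] by simp
    next
      case 2
      then show ?thesis using model_chainD(2)[OF chain(2)] by simp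
    next
      case 3
      then show ?thesis using mixed[OF 3] model_chainD(2)[OF chain(2) _ 3(2)] by auto
    next
      case 4
      then show ?thesis using mixed[OF 4(2,1)] model_chainD(2)[OF chain(2) 4(1)] by auto
    qed
  qed
  moreover have "separated_by (D \<union> D') (F \<union> F')"
    unfolding separated_by_def
  proof (intro ballI impI)
    fix \<alpha> \<beta> assume \<alpha>: "\<alpha> \<in> F \<union> F'" and \<beta>: "\<beta> \<in> F \<union> F'" and lt: "\<alpha> < \<beta>"
    consider "\<alpha> \<in> F'" "\<beta> \<in> F'" | "\<alpha> \<in> F" "\<beta> \<in> F" | "\<alpha> \<in> F - ord_part (members d)" "\<beta> \<in> F'"
      | "\<alpha> \<in> F'" "\<beta> \<in> F - ord_part (members d)"
      using \<alpha> \<beta> ext(1) by blast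
    then show "\<exists>e\<in>D \<union> D'. \<alpha> \<in> ord_part (members e) \<and> \<beta> \<notin> ord_part (members e)"
    proof cases
      case 1
      then show ?thesis using x(1) lt unfolding cond_def separated_by_def by (meson UnI2)
    next
      case 2
      then show ?thesis using r(1) lt unfolding cond_def separated_by_def by (meson UnI1)
    next
      case 3
      then show ?thesis using above[OF 3] lt by simp
    next
      case 4
      then show ?thesis using x(2) r(2) by (intro bexI[of _ d]) auto
    qed
  qed
  ultimately show ?thesis using r(1) x(1) unfolding cond_def by simp
qed

end

section \<open>The forcing notion and a club of models\<close>

type_synonym condition = "w1 set \<times> code set \<times> code set"

context separable_relation
begin

text \<open>The third component is an arbitrary finite set of codes. It provides, for each code \<open>c\<close>, a condition
  naming \<open>c\<close> (see \<open>mark\<close> below), so that a countable set of conditions determines a countable set of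
  codes. The order is restricted to the conditions below \<open>(F0, D0)\<close>.\<close>

definition poset :: "w1 set \<Rightarrow> code set \<Rightarrow> condition set" where
  "poset F0 D0 = {(F, D, J). cond F D \<and> finite J \<and> F0 \<subseteq> F \<and> D0 \<subseteq> D}"

definition extends :: "w1 set \<Rightarrow> code set \<Rightarrow> condition rel" where
  "extends F0 D0 = {((F, D, J), (F', D', J')). (F, D, J) \<in> poset F0 D0 \<and> (F', D', J') \<in> poset F0 D0 \<and>
     F' \<subseteq> F \<and> D' \<subseteq> D \<and> J' \<subseteq> J}"

lemma extends_iff:
  "((F, D, J), (F', D', J')) \<in> extends F0 D0 \<longleftrightarrow>
     (F, D, J) \<in> poset F0 D0 \<and> (F', D', J') \<in> poset F0 D0 \<and> F' \<subseteq> F \<and> D' \<subseteq> D \<and> J' \<subseteq> J"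
  unfolding extends_def by simp

lemma partial_order_extends: "partial_order_on (poset F0 D0) (extends F0 D0)"
  unfolding partial_order_on_def preorder_on_def
proof (intro conjI)
  show "extends F0 D0 \<subseteq> poset F0 D0 \<times> poset F0 D0" unfolding extends_def by auto
  show "refl_on (poset F0 D0) (extends F0 D0)"
    by (rule refl_onI) (auto simp: extends_def)
  show "trans (extends F0 D0)" unfolding trans_def by (auto simp: extends_iff)
  show "antisym (extends F0 D0)" unfolding antisym_def by (auto simp: extends_iff)
qed

definition mark :: "w1 set \<Rightarrow> code set \<Rightarrow> code \<Rightarrow> condition + condition set" where
  "mark F0 D0 c = Inl (F0, D0, {c})"

lemma inj_mark: "inj (mark F0 D0)"
  unfolding mark_def by (rule injI) simp

definition codes :: "w1 set \<Rightarrow> code set \<Rightarrow> (condition + condition set) set \<Rightarrow> code set" where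
  "codes F0 D0 M = {c. mark F0 D0 c \<in> M}"

text \<open>The end parts \<open>l\<close> of those conditions in \<open>\<Delta>\<close> that add exactly the elements of \<open>l\<close> to the working part of \<open>p\<close>.\<close>

definition patterns :: "condition set \<Rightarrow> condition \<Rightarrow> code" where
  "patterns \<Delta> p = {(m, l). m = 0 \<and> (\<exists>D J. (fst p \<union> set l, D, J) \<in> \<Delta> \<and> fst (snd p) \<subseteq> D)}"

definition pick :: "condition set \<Rightarrow> condition \<Rightarrow> w1 list \<Rightarrow> condition" where
  "pick \<Delta> p l = (SOME q. q \<in> \<Delta> \<and> fst q = fst p \<union> set l \<and> fst (snd p) \<subseteq> fst (snd q))"

lemma pick:
  assumes "(0, l) \<in> patterns \<Delta> p"
  shows "pick \<Delta> p l \<in> \<Delta>" "fst (pick \<Delta> p l) = fst p \<union> set l"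
    "fst (snd p) \<subseteq> fst (snd (pick \<Delta> p l))"
proof -
  from assms obtain D J where "(fst p \<union> set l, D, J) \<in> \<Delta>" "fst (snd p) \<subseteq> D"
    unfolding patterns_def by auto
  then have "\<exists>q. q \<in> \<Delta> \<and> fst q = fst p \<union> set l \<and> fst (snd p) \<subseteq> fst (snd q)"
    by (intro exI[of _ "(fst p \<union> set l, D, J)"]) simp
  from someI_ex[OF this]
  show "pick \<Delta> p l \<in> \<Delta>" "fst (pick \<Delta> p l) = fst p \<union> set l"
    "fst (snd p) \<subseteq> fst (snd (pick \<Delta> p l))"
    unfolding pick_def by simp_all
qed

text \<open>In the order of the definition, a model \<open>M\<close> closed under these demands has a nonempty set of codes that is
  closed under derivatives, witnesses, elements of coded models and smaller ordinals; it contains the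
  ordinals and models that occur in its conditions and the ordinal \<open>bound p\<close> for each of its conditions \<open>p\<close>;
  it contains the pattern sets of its members, each condition that is built from its codes, and for
  each \<open>\<Delta>\<close> and \<open>p\<close> in \<open>M\<close> a member of \<open>\<Delta>\<close> realising a given pattern.\<close>

definition demands ::
    "w1 set \<Rightarrow> code set \<Rightarrow> (condition \<Rightarrow> w1) \<Rightarrow> (condition + condition set) set \<Rightarrow> (condition + condition set) set" where
  "demands F0 D0 bound e =
    (let C = codes F0 D0 e; T = ord_part C; p_part = {p \<in> poset F0 D0. Inl p \<in> e}; \<Delta>_part = {\<Delta>. Inr \<Delta> \<in> e} in
       mark F0 D0 ` (
         insert {} ((\<Union>\<alpha>\<in>T. \<Union>c\<in>C. {tail \<alpha> c}) \<union> (\<Union>n. \<Union>c\<in>C. ordinal ` witness n c) \<union>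
         (\<Union>d\<in>C. members d) \<union> (\<Union>\<alpha>\<in>T. ordinal ` {..<\<alpha>}) \<union>
         (\<Union>p\<in>p_part. ordinal ` insert (bound p) (fst p) \<union> fst (snd p)) \<union>
         (\<Union>\<Delta>\<in>\<Delta>_part. \<Union>p\<in>p_part. {patterns \<Delta> p}))) \<union>
       (\<Union>F\<in>Pow T. \<Union>D\<in>Pow C. {Inl (F, D, {})}) \<union>
       (\<Union>\<Delta>\<in>\<Delta>_part. \<Union>p\<in>p_part. \<Union>l\<in>lists T. {Inl (pick \<Delta> p l)}))"

lemma poset_finite:
  assumes "p \<in> poset F0 D0"
  shows "finite (fst p)" "finite (fst (snd p))"
  using assms unfolding poset_def cond_def by auto

lemma finite_codes:
  assumes "finite e"
  shows "finite (codes F0 D0 e)"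
  unfolding codes_def using finite_vimageI[OF assms inj_mark] unfolding vimage_def .

lemma countable_demands:
  assumes "finite e"
  shows "countable (demands F0 D0 bound e)"
proof -
  define C where "C = codes F0 D0 e"
  define T where "T = ord_part C"
  define p_part where "p_part = {p \<in> poset F0 D0. Inl p \<in> e}"
  define \<Delta>_part where "\<Delta>_part = {\<Delta> :: condition set. Inr \<Delta> \<in> e}"
  have finC: "finite C" unfolding C_def by (rule finite_codes[OF assms])
  have finT: "finite T" unfolding T_def by (rule finite_ord_part[OF finC])
  have "finite (Inl -` e)" by (rule finite_vimageI[OF assms inj_Inl])
  then have finp: "finite p_part" unfolding p_part_def by (rule rev_finite_subset) auto
  have "finite (Inr -` e)" by (rule finite_vimageI[OF assms inj_Inr])
  then have fin\<Delta>: "finite \<Delta>_part" unfolding \<Delta>_part_def vimage_def .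
  note cf = countable_finite[OF finC] countable_finite[OF finT] countable_finite[OF finp]
    countable_finite[OF fin\<Delta>]
  have 1: "countable (\<Union>\<alpha>\<in>T. \<Union>c\<in>C. {tail \<alpha> c})" using cf by (intro countable_UN) simp_all
  have 2: "countable (\<Union>n. \<Union>c\<in>C. ordinal ` witness n c)"
    using cf countable_witness by (intro countable_UN countable_image) simp_all
  have 3: "countable (\<Union>d\<in>C. members d)" using cf countable_members by (intro countable_UN) simp_all
  have 4: "countable (\<Union>\<alpha>\<in>T. ordinal ` {..<\<alpha>})"
    using cf countable_lessThan_w1 by (intro countable_UN countable_image) simp_all
  have "countable (ordinal ` insert (bound p) (fst p) \<union> fst (snd p))" if "p \<in> p_part" for p
    using that poset_finite[of p F0 D0] unfolding p_part_def by (intro countable_finite) simp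
  then have 5: "countable (\<Union>p\<in>p_part. ordinal ` insert (bound p) (fst p) \<union> fst (snd p))"
    using cf by (intro countable_UN) simp_all
  have 6: "countable (\<Union>\<Delta>\<in>\<Delta>_part. \<Union>p\<in>p_part. {patterns \<Delta> p})" using cf by (intro countable_UN) simp_all
  have 7: "countable (\<Union>F\<in>Pow T. \<Union>D\<in>Pow C. {Inl (F, D, {})} :: (condition + condition set) set)"
    using finT finC by (intro countable_finite) simp
  have 8: "countable (\<Union>\<Delta>\<in>\<Delta>_part. \<Union>p\<in>p_part. \<Union>l\<in>lists T. {Inl (pick \<Delta> p l)} :: (condition + condition set) set)"
    using cf countable_lists[OF cf(2)] by (intro countable_UN) simp_all
  show ?thesis
    unfolding demands_def Let_def C_def[symmetric] T_def[symmetric] p_part_def[symmetric] \<Delta>_part_def[symmetric]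
    using 1 2 3 4 5 6 7 8 by (intro countable_Un countable_image countable_insert) simp_all
qed

definition models :: "w1 set \<Rightarrow> code set \<Rightarrow> (condition \<Rightarrow> w1) \<Rightarrow> (condition + condition set) set set" where
  "models F0 D0 bound = closed_sets (poset F0 D0 <+> Pow (poset F0 D0)) (demands F0 D0 bound)"

lemma club_models: "club_countable (poset F0 D0 <+> Pow (poset F0 D0)) (models F0 D0 bound)"
  unfolding models_def by (rule club_closed_sets[OF countable_demands])

lemma mark_mem:
  assumes "cond F0 D0"
  shows "mark F0 D0 c \<in> poset F0 D0 <+> Pow (poset F0 D0)"
  using assms unfolding mark_def poset_def by auto

lemma codesI:
  assumes "cond F0 D0" "M \<in> models F0 D0 bound" "finite e" "e \<subseteq> M"
    "mark F0 D0 c \<in> demands F0 D0 bound e"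
  shows "c \<in> codes F0 D0 M"
  unfolding codes_def
  using closed_setsD[OF assms(2)[unfolded models_def] assms(3-5) mark_mem[OF assms(1)]] by simp

text \<open>The demands, read off for a closed set \<open>M\<close>.\<close>

lemma models_rules:
  assumes base: "cond F0 D0" and M: "M \<in> models F0 D0 bound"
  shows "{} \<in> codes F0 D0 M"
    and "\<lbrakk>c \<in> codes F0 D0 M; \<alpha> \<in> ord_part (codes F0 D0 M)\<rbrakk> \<Longrightarrow> tail \<alpha> c \<in> codes F0 D0 M"
    and "\<lbrakk>c \<in> codes F0 D0 M; \<alpha> \<in> witness n c\<rbrakk> \<Longrightarrow> \<alpha> \<in> ord_part (codes F0 D0 M)"
    and "\<lbrakk>d \<in> codes F0 D0 M; c \<in> members d\<rbrakk> \<Longrightarrow> c \<in> codes F0 D0 M"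
    and "\<lbrakk>\<alpha> \<in> ord_part (codes F0 D0 M); \<beta> < \<alpha>\<rbrakk> \<Longrightarrow> \<beta> \<in> ord_part (codes F0 D0 M)"
    and "\<lbrakk>Inl p \<in> M; \<alpha> \<in> insert (bound p) (fst p)\<rbrakk> \<Longrightarrow> \<alpha> \<in> ord_part (codes F0 D0 M)"
    and "\<lbrakk>Inl p \<in> M; d \<in> fst (snd p)\<rbrakk> \<Longrightarrow> d \<in> codes F0 D0 M"
    and "\<lbrakk>Inr \<Delta> \<in> M; Inl p \<in> M\<rbrakk> \<Longrightarrow> patterns \<Delta> p \<in> codes F0 D0 M"
    and "\<lbrakk>finite F; finite D; F \<subseteq> ord_part (codes F0 D0 M); D \<subseteq> codes F0 D0 M; (F, D, {}) \<in> poset F0 D0\<rbrakk> \<Longrightarrow>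
      Inl (F, D, {}) \<in> M"
    and "\<lbrakk>Inr \<Delta> \<in> M; Inl p \<in> M; set l \<subseteq> ord_part (codes F0 D0 M); (0, l) \<in> patterns \<Delta> p\<rbrakk> \<Longrightarrow>
      Inl (pick \<Delta> p l) \<in> M"
proof -
  let ?m = "mark F0 D0" and ?X = "poset F0 D0 <+> Pow (poset F0 D0)"
  have MX: "M \<subseteq> ?X" using M unfolding models_def closed_sets_def by simp
  have Inl_poset: "p \<in> poset F0 D0" if "Inl p \<in> M" for p using MX that by blast
  have Inr_poset: "\<Delta> \<subseteq> poset F0 D0" if "Inr \<Delta> \<in> M" for \<Delta> using MX that by blast
  note I = codesI[OF base M]
  note unf = demands_def Let_def ord_part_def codes_def
  show "{} \<in> codes F0 D0 M"
    by (rule I[of "{}"]) (simp_all add: unf)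
  show "tail \<alpha> c \<in> codes F0 D0 M" if "c \<in> codes F0 D0 M" "\<alpha> \<in> ord_part (codes F0 D0 M)"
  proof (rule I[of "{?m c, ?m (ordinal \<alpha>)}"])
    show "{?m c, ?m (ordinal \<alpha>)} \<subseteq> M" using that unfolding ord_part_def codes_def by simp
    show "?m (tail \<alpha> c) \<in> demands F0 D0 bound {?m c, ?m (ordinal \<alpha>)}"
      unfolding demands_def Let_def
      by (rule UnI1, rule UnI1, rule imageI, rule insertI2) (auto simp: ord_part_def codes_def inj_eq[OF inj_mark] inj_image_mem_iff[OF inj_ordinal])
  qed simp
  show "\<alpha> \<in> ord_part (codes F0 D0 M)" if "c \<in> codes F0 D0 M" "\<alpha> \<in> witness n c"
    unfolding ord_part_def mem_Collect_eq
  proof (rule I[of "{?m c}"])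
    show "{?m c} \<subseteq> M" using that unfolding codes_def by simp
    show "?m (ordinal \<alpha>) \<in> demands F0 D0 bound {?m c}"
      unfolding demands_def Let_def using that(2)
      by (intro UnI1, intro imageI insertI2) (auto simp: ord_part_def codes_def inj_eq[OF inj_mark] inj_image_mem_iff[OF inj_ordinal])
  qed simp
  show "c \<in> codes F0 D0 M" if "d \<in> codes F0 D0 M" "c \<in> members d"
  proof (rule I[of "{?m d}"])
    show "{?m d} \<subseteq> M" using that unfolding codes_def by simp
    show "?m c \<in> demands F0 D0 bound {?m d}"
      unfolding demands_def Let_def using that(2)
      by (intro UnI1, intro imageI insertI2) (auto simp: ord_part_def codes_def inj_eq[OF inj_mark] inj_image_mem_iff[OF inj_ordinal])
  qed simp
  show "\<beta> \<in> ord_part (codes F0 D0 M)" if "\<alpha> \<in> ord_part (codes F0 D0 M)" "\<beta> < \<alpha>"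
    unfolding ord_part_def mem_Collect_eq
  proof (rule I[of "{?m (ordinal \<alpha>)}"])
    show "{?m (ordinal \<alpha>)} \<subseteq> M" using that unfolding codes_def ord_part_def by simp
    show "?m (ordinal \<beta>) \<in> demands F0 D0 bound {?m (ordinal \<alpha>)}"
      unfolding demands_def Let_def using that(2)
      by (intro UnI1, intro imageI insertI2) (auto simp: ord_part_def codes_def inj_eq[OF inj_mark] inj_image_mem_iff[OF inj_ordinal])
  qed simp
  show "\<alpha> \<in> ord_part (codes F0 D0 M)" if "Inl p \<in> M" "\<alpha> \<in> insert (bound p) (fst p)"
    unfolding ord_part_def mem_Collect_eq
  proof (rule I[of "{Inl p}"])
    show "{Inl p} \<subseteq> M" using that by simp
    show "?m (ordinal \<alpha>) \<in> demands F0 D0 bound {Inl p}"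
      unfolding demands_def Let_def using that(2) Inl_poset[OF that(1)]
      by (intro UnI1, intro imageI insertI2) auto
  qed simp
  show "d \<in> codes F0 D0 M" if "Inl p \<in> M" "d \<in> fst (snd p)"
  proof (rule I[of "{Inl p}"])
    show "{Inl p} \<subseteq> M" using that by simp
    show "?m d \<in> demands F0 D0 bound {Inl p}"
      unfolding demands_def Let_def using that(2) Inl_poset[OF that(1)]
      by (intro UnI1, intro imageI insertI2) auto
  qed simp
  show "patterns \<Delta> p \<in> codes F0 D0 M" if "Inr \<Delta> \<in> M" "Inl p \<in> M"
  proof (rule I[of "{Inr \<Delta>, Inl p}"])
    show "{Inr \<Delta>, Inl p} \<subseteq> M" using that by simp
    show "?m (patterns \<Delta> p) \<in> demands F0 D0 bound {Inr \<Delta>, Inl p}"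
      unfolding demands_def Let_def using Inl_poset[OF that(2)]
      by (intro UnI1, intro imageI insertI2) auto
  qed simp
  show "Inl (F, D, {}) \<in> M" if fin: "finite F" "finite D"
    and sub: "F \<subseteq> ord_part (codes F0 D0 M)" "D \<subseteq> codes F0 D0 M" and P: "(F, D, {}) \<in> poset F0 D0"
  proof (rule closed_setsD[OF M[unfolded models_def]])
    let ?e = "?m ` (ordinal ` F \<union> D)"
    show "finite ?e" using fin by simp
    show "?e \<subseteq> M" using sub unfolding ord_part_def codes_def by auto
    show "Inl (F, D, {}) \<in> demands F0 D0 bound ?e"
      unfolding demands_def Let_def
      by (rule UnI1, rule UnI2) (auto simp: ord_part_def codes_def inj_eq[OF inj_mark] inj_image_mem_iff[OF inj_ordinal])
    show "Inl (F, D, {}) \<in> ?X" using P by (rule InlI)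
  qed
  show "Inl (pick \<Delta> p l) \<in> M" if \<Delta>: "Inr \<Delta> \<in> M" "Inl p \<in> M"
    and l: "set l \<subseteq> ord_part (codes F0 D0 M)" "(0, l) \<in> patterns \<Delta> p"
  proof (rule closed_setsD[OF M[unfolded models_def]])
    let ?e = "insert (Inr \<Delta>) (insert (Inl p) (?m ` ordinal ` set l))"
    show "finite ?e" by simp
    show "?e \<subseteq> M" using \<Delta> l unfolding ord_part_def codes_def by auto
    have "l \<in> lists (ord_part (codes F0 D0 ?e))"
      unfolding ord_part_def codes_def by auto
    then show "Inl (pick \<Delta> p l) \<in> demands F0 D0 bound ?e"
      unfolding demands_def Let_def using Inl_poset[OF \<Delta>(2)]
      by (intro UnI2 UN_I[of \<Delta>] UN_I[of p] UN_I[of l]) simp_all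
    show "Inl (pick \<Delta> p l) \<in> ?X" by (rule InlI, rule subsetD[OF Inr_poset[OF \<Delta>(1)] pick(1)[OF l(2)]])
  qed
qed


section \<open>Generic conditions and properness\<close>

lemma good_codes:
  assumes "cond F0 D0" "M \<in> models F0 D0 bound"
  shows "good (codes F0 D0 M)"
  unfolding good_def
proof (intro conjI ballI allI impI subsetI)
  note R = models_rules[OF assms]
  show "tail \<alpha> c \<in> codes F0 D0 M" if "c \<in> codes F0 D0 M" "\<alpha> \<in> ord_part (codes F0 D0 M)" for c \<alpha>
    using R(2)[OF that] .
  show "\<alpha> \<in> ord_part (codes F0 D0 M)" if "c \<in> codes F0 D0 M" "\<alpha> \<in> witness n c" for c \<alpha> n
    using R(3)[OF that] .
  show "c \<in> codes F0 D0 M" if "d \<in> codes F0 D0 M" "c \<in> members d" for c d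
    using R(4)[OF that] .
  show "\<beta> \<in> ord_part (codes F0 D0 M)" if "\<alpha> \<in> ord_part (codes F0 D0 M)" "\<beta> < \<alpha>" for \<alpha> \<beta>
    using R(5)[OF that] .
qed

lemma code_for_model:
  assumes "cond F0 D0" "M \<in> models F0 D0 bound"
  obtains d where "members d = codes F0 D0 M"
proof -
  have "countable M" using assms(2) unfolding models_def closed_sets_def by simp
  then have "countable (mark F0 D0 ` codes F0 D0 M)"
    by (rule countable_subset[rotated]) (auto simp: codes_def)
  then have "countable (codes F0 D0 M)"
    by (rule countable_image_inj_on) (rule inj_on_subset[OF inj_mark subset_UNIV])
  moreover have "codes F0 D0 M \<noteq> {}" using models_rules(1)[OF assms] by blast
  ultimately show thesis using members_surj that by meson
qed

text \<open>Given a dense set \<open>\<Delta>\<close> in \<open>M\<close>, extend the given condition to some \<open>r\<close> in \<open>\<Delta>\<close>. The part of \<open>r\<close> that \<open>M\<close> sees is a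
  condition \<open>r0\<close> in \<open>M\<close>, and the rest of the working part of \<open>r\<close> is a pattern over \<open>r0\<close>. It lies outside the
  model, so the set of such patterns is large, and some pattern of ordinals in \<open>M\<close> has no bad pair with
  the working part of \<open>r\<close>. A member of \<open>\<Delta>\<close> in \<open>M\<close> realises it and is compatible with \<open>r\<close>.\<close>

lemma generic_if_model_in_condition:
  assumes base: "cond F0 D0" and M: "M \<in> models F0 D0 bound"
    and d: "members d = codes F0 D0 M"
    and q: "q \<in> poset F0 D0" "d \<in> fst (snd q)"
  shows "generic_condition (poset F0 D0) (extends F0 D0) M q"
  unfolding generic_condition_def
proof (intro conjI allI impI ballI)
  show "q \<in> poset F0 D0" by (rule q)
  note R = models_rules[OF base M]
  let ?N = "members d"
  note RN = R[folded d]
  have goodN: "good ?N" using good_codes[OF base M] d by simp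
  fix \<Delta> s
  assume \<Delta>: "Inr \<Delta> \<in> M \<and> dense_in_poset (poset F0 D0) (extends F0 D0) \<Delta>"
    and s: "s \<in> poset F0 D0" "(s, q) \<in> extends F0 D0"
  obtain Fs Ds Js where s_eq: "s = (Fs, Ds, Js)" by (rule prod_cases3)
  obtain Fq Dq Jq where q_eq: "q = (Fq, Dq, Jq)" by (rule prod_cases3)
  obtain r where r: "r \<in> \<Delta>" "(r, s) \<in> extends F0 D0"
    using \<Delta> s(1) unfolding dense_in_poset_def by meson
  obtain F D J where r_eq: "r = (F, D, J)" by (rule prod_cases3)
  have rs: "Fs \<subseteq> F" "Ds \<subseteq> D" "Js \<subseteq> J" "(F, D, J) \<in> poset F0 D0"
    using r(2) unfolding r_eq s_eq extends_iff by simp_all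
  then have cr: "cond F D" "finite J" "F0 \<subseteq> F" "D0 \<subseteq> D" unfolding poset_def by simp_all
  have dD: "d \<in> D" using q(2) s(2) rs(2) unfolding s_eq q_eq extends_iff by auto
  \<comment> \<open>the condition \<open>r0 = (?F, ?D, {})\<close>, the part of \<open>r\<close> that \<open>M\<close> sees\<close>
  let ?F = "F \<inter> ord_part ?N" and ?D = "D \<inter> ?N"
  have mark_empty: "Inl (F0, D0, {{}}) \<in> M" using R(1) unfolding codes_def mark_def by simp
  have F0N: "F0 \<subseteq> ord_part ?N" using RN(6)[OF mark_empty] by auto
  have D0N: "D0 \<subseteq> ?N" using RN(7)[OF mark_empty] by auto
  have c0: "cond ?F ?D" using cond_restrict[OF cr(1) dD] .
  then have r0P: "(?F, ?D, {}) \<in> poset F0 D0"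
    using cr F0N D0N unfolding poset_def by simp
  have fin: "finite ?F" "finite ?D" using c0 unfolding cond_def by simp_all
  have r0M: "Inl (?F, ?D, {}) \<in> M"
    using RN(9)[OF fin _ _ r0P] by simp
  \<comment> \<open>the part of \<open>r\<close> outside of \<open>M\<close> as an increasing list, and the pattern set to which it belongs\<close>
  let ?l = "sorted_list_of_set (F - ord_part ?N)"
  let ?c = "patterns \<Delta> (?F, ?D, {})"
  have finF: "finite F" using cr(1) unfolding cond_def by simp
  have setl: "set ?l = F - ord_part ?N" using finF by simp
  have c_in: "?c \<in> ?N" using RN(8)[of \<Delta>] \<Delta> r0M by simp
  have "?F \<union> set ?l = F" using setl by auto
  then have l_in: "(0, ?l) \<in> ?c" using r(1) unfolding patterns_def r_eq by auto
  have "large (length ?l) ?c"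
    by (rule pattern_large[OF cr(1) dD _ _ _ c_in l_in]) (use setl in auto)
  then obtain l where l: "(0, l) \<in> ?c" "set l \<subseteq> ord_part ?N"
      "\<forall>\<beta>\<in>set l. \<forall>\<alpha>\<in>F. \<not> bad \<beta> \<alpha>"
    using large_realised_in_model[OF goodN finF c_in] by meson
  define x where "x = pick \<Delta> (?F, ?D, {}) l"
  obtain Fx Dx Jx where x_eq: "x = (Fx, Dx, Jx)" by (rule prod_cases3)
  have xM: "Inl x \<in> M" unfolding x_def
    using RN(10)[of \<Delta> "(?F, ?D, {})" l] \<Delta> r0M l(1,2) by simp
  have x\<Delta>: "x \<in> \<Delta>" and Fx: "Fx = ?F \<union> set l" and Dx: "?D \<subseteq> Dx"
    using pick[OF l(1)] unfolding x_def[symmetric] x_eq by simp_all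
  have xP: "x \<in> poset F0 D0" using x\<Delta> \<Delta> unfolding dense_in_poset_def by blast
  then have cx: "cond Fx Dx" "finite Jx" "F0 \<subseteq> Fx" "D0 \<subseteq> Dx" unfolding poset_def x_eq by simp_all
  have FxN: "Fx \<subseteq> ord_part ?N" and DxN: "Dx \<subseteq> ?N"
    using RN(6)[OF xM] RN(7)[OF xM] unfolding x_eq by auto
  have "cond (F \<union> Fx) (D \<union> Dx)"
  proof (rule cond_amalgamate[OF cr(1) dD cx(1) FxN DxN])
    show "?F \<subseteq> Fx" unfolding Fx by simp
    show "?D \<subseteq> Dx" by (rule Dx)
    fix \<alpha> \<beta> assume \<alpha>: "\<alpha> \<in> F - ord_part ?N" and \<beta>: "\<beta> \<in> Fx"
    show "\<not> bad \<beta> \<alpha>"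
    proof (cases "\<beta> \<in> set l")
      case True
      then show ?thesis using l(3) \<alpha> by simp
    next
      case False
      then have \<beta>F: "\<beta> \<in> F" "\<beta> \<in> ord_part ?N" using \<beta> unfolding Fx by auto
      have "\<beta> < \<alpha>"
      proof (rule ccontr)
        assume "\<not> \<beta> < \<alpha>"
        then have "\<alpha> = \<beta> \<or> \<alpha> < \<beta>" by auto
        then show False using goodD(4)[OF goodN \<beta>F(2)] \<alpha> \<beta>F(2) by auto
      qed
      then show ?thesis using cr(1) \<alpha> \<beta>F(1) unfolding cond_def free_of_def by simp
    qed
  qed
  then have tP: "(F \<union> Fx, D \<union> Dx, J \<union> Jx) \<in> poset F0 D0"
    using cr cx unfolding poset_def by auto
  moreover have "((F \<union> Fx, D \<union> Dx, J \<union> Jx), s) \<in> extends F0 D0"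
    using tP s(1) rs unfolding s_eq extends_iff by auto
  moreover have "((F \<union> Fx, D \<union> Dx, J \<union> Jx), x) \<in> extends F0 D0"
    using tP xP unfolding x_eq extends_iff by auto
  ultimately have "compatible (poset F0 D0) (extends F0 D0) s x"
    unfolding compatible_def by meson
  then show "\<exists>x\<in>\<Delta>. Inl x \<in> M \<and> compatible (poset F0 D0) (extends F0 D0) s x"
    using x\<Delta> xM by (intro bexI[of _ x]) simp_all
qed

text \<open>Adding the code of the model to a condition of the model yields a generic condition. This works
  for every function \<open>bound\<close>, so an arbitrary one is fixed.\<close>

lemma proper_poset:
  assumes base: "cond F0 D0"
  shows "proper_forcing (poset F0 D0) (extends F0 D0)"
  unfolding proper_forcing_def
proof (intro exI[of _ "models F0 D0 undefined"] conjI ballI allI impI)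
  show "club_countable (poset F0 D0 <+> Pow (poset F0 D0)) (models F0 D0 undefined)"
    by (rule club_models)
  fix M p assume M: "M \<in> models F0 D0 undefined" and p: "Inl p \<in> M"
  obtain F D J where p_eq: "p = (F, D, J)" by (rule prod_cases3)
  have "M \<subseteq> poset F0 D0 <+> Pow (poset F0 D0)"
    using M unfolding models_def closed_sets_def by simp
  then have pP: "(F, D, J) \<in> poset F0 D0" using p unfolding p_eq by auto
  obtain d where d: "members d = codes F0 D0 M" by (rule code_for_model[OF base M])
  note R = models_rules[OF base M]
  have "cond F (insert d D)"
  proof (rule cond_insert_model)
    show "cond F D" using pP unfolding poset_def by simp
    show "good (members d)" using good_codes[OF base M] d by simp
    show "F \<subseteq> ord_part (members d)" "D \<subseteq> members d"
      using R(6)[OF p] R(7)[OF p] unfolding d p_eq by auto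
  qed
  then have qP: "(F, insert d D, J) \<in> poset F0 D0" using pP unfolding poset_def by auto
  show "\<exists>q. (q, p) \<in> extends F0 D0 \<and> generic_condition (poset F0 D0) (extends F0 D0) M q"
  proof (intro exI conjI)
    show "((F, insert d D, J), p) \<in> extends F0 D0" using pP qP unfolding p_eq extends_iff by auto
    show "generic_condition (poset F0 D0) (extends F0 D0) M (F, insert d D, J)"
      by (rule generic_if_model_in_condition[OF base M d qP]) simp
  qed
qed

text \<open>Otherwise the conditions that bound all their extensions are dense. Take a model \<open>M\<close> that contains
  this dense set and is closed under the bounds, and an ordinal \<open>\<alpha>\<close> outside of \<open>M\<close>. The condition with
  working part \<open>{\<alpha>}\<close> and the single model \<open>M\<close> is generic, so it is compatible with some bounded condition in
  \<open>M\<close>, whose bound is below \<open>\<alpha>\<close>.\<close>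

lemma condition_forcing_unbounded:
  obtains F0 D0 where "cond F0 D0"
    "\<forall>F D J \<xi>. (F, D, J) \<in> poset F0 D0 \<longrightarrow>
      (\<exists>F' D' J'. ((F', D', J'), (F, D, J)) \<in> extends F0 D0 \<and> (\<exists>\<gamma>\<in>F'. \<xi> \<le> \<gamma>))"
proof -
  let ?P = "poset {} {}" and ?r = "extends {} {}"
  have base: "cond {} {}"
    unfolding cond_def free_of_def model_chain_def separated_by_def by simp
  define Bd where "Bd q \<xi> \<longleftrightarrow> (\<forall>s. (s, q) \<in> ?r \<longrightarrow> (\<forall>\<gamma>\<in>fst s. \<gamma> < \<xi>))" for q \<xi>
  define \<Delta> where "\<Delta> = {q \<in> ?P. \<exists>\<xi>. Bd q \<xi>}"
  define bound where "bound q = (SOME \<xi>. Bd q \<xi>)" for q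
  have bound: "Bd q (bound q)" if "q \<in> \<Delta>" for q
    using that unfolding \<Delta>_def bound_def by (auto intro: someI_ex)
  have "\<not> dense_in_poset ?P ?r \<Delta>"
  proof
    assume dense: "dense_in_poset ?P ?r \<Delta>"
    have "\<Delta> \<subseteq> ?P" unfolding \<Delta>_def by simp
    then have "{Inr \<Delta>} \<subseteq> ?P <+> Pow ?P \<and> countable {Inr \<Delta> :: condition + condition set}" by auto
    then obtain M where M: "M \<in> models {} {} bound" "{Inr \<Delta>} \<subseteq> M"
      using club_models[of "{}" "{}" bound, unfolded club_countable_def, THEN conjunct2, THEN conjunct1,
          rule_format, of "{Inr \<Delta>}"]
      by auto
    obtain d where d: "members d = codes {} {} M" by (rule code_for_model[OF base M(1)])
    have "countable (ord_part (members d))"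
      by (rule countable_ord_part[OF countable_members])
    then obtain \<alpha> where \<alpha>: "\<alpha> \<notin> ord_part (members d)"
      using uncountable_UNIV_w1 by (metis UNIV_eq_I)
    have "cond {\<alpha>} {d}"
      using good_codes[OF base M(1)]
      unfolding cond_def free_of_def model_chain_def separated_by_def by (simp add: d)
    then have qP: "({\<alpha>}, {d}, {}) \<in> ?P" unfolding poset_def by simp
    have "generic_condition ?P ?r M ({\<alpha>}, {d}, {})"
      by (rule generic_if_model_in_condition[OF base M(1) d qP]) simp
    moreover have "(({\<alpha>}, {d}, {}), ({\<alpha>}, {d}, {})) \<in> ?r" using qP unfolding extends_iff by simp
    ultimately obtain x where x: "x \<in> \<Delta>" "Inl x \<in> M" "compatible ?P ?r ({\<alpha>}, {d}, {}) x"
      unfolding generic_condition_def using dense M(2) qP by (meson insert_subset)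
    then obtain t where t: "(t, ({\<alpha>}, {d}, {})) \<in> ?r" "(t, x) \<in> ?r"
      unfolding compatible_def by meson
    have "\<alpha> \<in> fst t" using t(1) by (cases t) (auto simp: extends_iff)
    then have "\<alpha> < bound x" using bound[OF x(1)] t(2) unfolding Bd_def by blast
    moreover have "bound x \<in> ord_part (members d)"
      unfolding d by (rule models_rules(6)[OF base M(1) x(2)]) simp
    moreover have "good (members d)" unfolding d by (rule good_codes[OF base M(1)])
    ultimately have "\<alpha> \<in> ord_part (members d)" using goodD(4) by meson
    then show False using \<alpha> by simp
  qed
  moreover have "\<Delta> \<subseteq> ?P" unfolding \<Delta>_def by simp
  ultimately obtain p where p: "p \<in> ?P" "\<And>x. x \<in> \<Delta> \<Longrightarrow> (x, p) \<notin> ?r"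
    unfolding dense_in_poset_def by meson
  obtain F0 D0 J0 where p_eq: "p = (F0, D0, J0)" by (rule prod_cases3)
  have c0: "cond F0 D0" "finite J0" using p(1) unfolding p_eq poset_def by simp_all
  show thesis
  proof (rule that[OF c0(1)], intro allI impI)
    fix F D J \<xi> assume q: "(F, D, J) \<in> poset F0 D0"
    let ?q = "(F, D, J \<union> J0)"
    have qP: "?q \<in> ?P" using q c0(2) unfolding poset_def by simp
    have "(?q, p) \<in> ?r" using q qP p(1) unfolding p_eq extends_iff by (simp add: poset_def)
    then have "?q \<notin> \<Delta>" using p(2) by blast
    then have "\<not> Bd ?q \<xi>" using qP unfolding \<Delta>_def by blast
    then obtain s \<gamma> where s: "(s, ?q) \<in> ?r" "\<gamma> \<in> fst s" "\<xi> \<le> \<gamma>"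
      unfolding Bd_def by (auto simp: not_less)
    obtain F' D' J' where s_eq: "s = (F', D', J')" by (rule prod_cases3)
    have "((F', D', J'), (F, D, J)) \<in> extends F0 D0"
      using s(1) q unfolding s_eq extends_iff by (auto simp: poset_def)
    then show "\<exists>F' D' J'. ((F', D', J'), (F, D, J)) \<in> extends F0 D0 \<and> (\<exists>\<gamma>\<in>F'. \<xi> \<le> \<gamma>)"
      using s(2,3) unfolding s_eq by auto
  qed
qed

lemma uncountable_free_set:
  fixes j :: "condition \<Rightarrow> forcing_universe"
  assumes PFA: "Proper_Forcing_Axiom" and j: "inj j"
  obtains T where "uncountable T" "free_of bad T"
proof -
  obtain F0 D0 where base: "cond F0 D0"
    and unbounded: "\<forall>F D J \<xi>. (F, D, J) \<in> poset F0 D0 \<longrightarrow>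
      (\<exists>F' D' J'. ((F', D', J'), (F, D, J)) \<in> extends F0 D0 \<and> (\<exists>\<gamma>\<in>F'. \<xi> \<le> \<gamma>))"
    by (rule condition_forcing_unbounded)
  let ?P = "poset F0 D0" and ?r = "extends F0 D0"
  have "(F0, D0, {}) \<in> ?P" using base unfolding poset_def by simp
  then have ne: "?P \<noteq> {}" by blast
  have meets: "meets_omega1_dense_sets ?P ?r"
    by (rule Proper_Forcing_Axiom_transfer[OF PFA j ne partial_order_extends proper_poset[OF base]])
  have "dense_in_poset ?P ?r {q \<in> ?P. \<exists>\<gamma>\<in>fst q. \<xi> \<le> \<gamma>}" for \<xi>
    unfolding dense_in_poset_def
  proof (intro conjI ballI)
    fix p assume p: "p \<in> ?P"
    obtain F D J where p_eq: "p = (F, D, J)" by (rule prod_cases3)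
    from unbounded[rule_format, OF p[unfolded p_eq], of \<xi>]
    obtain F' D' J' where s: "((F', D', J'), p) \<in> ?r" "\<exists>\<gamma>\<in>F'. \<xi> \<le> \<gamma>" unfolding p_eq by meson
    then have "(F', D', J') \<in> ?P" unfolding p_eq extends_iff by simp
    with s show "\<exists>q\<in>{q \<in> ?P. \<exists>\<gamma>\<in>fst q. \<xi> \<le> \<gamma>}. (q, p) \<in> ?r"
      by (intro bexI[of _ "(F', D', J')"]) simp_all
  qed simp
  from meets_dense_sets_w1[OF meets this]
  obtain G where G: "filter_in_poset ?P ?r G"
      and hit: "\<And>\<xi>. G \<inter> {q \<in> ?P. \<exists>\<gamma>\<in>fst q. \<xi> \<le> \<gamma>} \<noteq> {}"
    by iprover
  let ?T = "\<Union>(fst ` G)"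
  have "uncountable ?T"
  proof (rule uncountable_w1_if_unbounded)
    fix \<xi>
    show "\<exists>\<gamma>\<in>?T. \<xi> \<le> \<gamma>" using hit[of \<xi>] by auto
  qed
  moreover have "free_of bad ?T"
    unfolding free_of_def
  proof (intro ballI impI)
    fix \<alpha> \<beta> assume "\<alpha> \<in> ?T" "\<beta> \<in> ?T" and lt: "\<beta> < \<alpha>"
    then obtain p q where pq: "p \<in> G" "q \<in> G" "\<alpha> \<in> fst p" "\<beta> \<in> fst q" by auto
    obtain s where s: "s \<in> G" "(s, p) \<in> ?r" "(s, q) \<in> ?r"
      using filter_in_posetD(4)[OF G pq(1,2)] by meson
    obtain F D J where s_eq: "s = (F, D, J)" by (rule prod_cases3)
    have "free_of bad F"
      using s(2) unfolding s_eq by (cases p) (simp add: extends_iff poset_def cond_def)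
    moreover have "\<alpha> \<in> F" "\<beta> \<in> F"
      using s pq unfolding s_eq by (cases p; cases q; auto simp: extends_iff)+
    ultimately show "\<not> bad \<beta> \<alpha>" using lt unfolding free_of_def by simp
  qed
  ultimately show thesis by (rule that)
qed

end

section \<open>Conditions fit into the forcing universe\<close>

lemma inj_image_exists:
  assumes "\<exists>f :: 'x \<Rightarrow> 'y. inj f"
  shows "\<exists>f :: 'x set \<Rightarrow> 'y set. inj f"
proof -
  from assms obtain f :: "'x \<Rightarrow> 'y" where "inj f" ..
  then have "inj (image f)" by (simp add: inj_def inj_image_eq_iff)
  then show ?thesis by (rule exI[of inj])
qed

lemma inj_comp_exists:
  assumes "\<exists>f :: 'x \<Rightarrow> 'y. inj f" "\<exists>g :: 'y \<Rightarrow> 'z. inj g"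
  shows "\<exists>h :: 'x \<Rightarrow> 'z. inj h"
  using assms inj_compose by blast

lemma inj_prod_exists:
  assumes "infinite (UNIV :: 'z set)" "\<exists>f :: 'x \<Rightarrow> 'z. inj f" "\<exists>g :: 'y \<Rightarrow> 'z. inj g"
  shows "\<exists>h :: 'x \<times> 'y \<Rightarrow> 'z. inj h"
proof -
  have "ordLeq3 (card_of (UNIV :: 'x set)) (card_of (UNIV :: 'z set))"
    "ordLeq3 (card_of (UNIV :: 'y set)) (card_of (UNIV :: 'z set))"
    using assms(2,3) card_of_ordLeq[of "UNIV :: 'x set" "UNIV :: 'z set"]
      card_of_ordLeq[of "UNIV :: 'y set" "UNIV :: 'z set"] by auto
  from card_of_Times_ordLeq_infinite_Field[OF _ this card_of_Card_order]
  have "ordLeq3 (card_of ((UNIV :: 'x set) \<times> (UNIV :: 'y set))) (card_of (UNIV :: 'z set))"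
    using assms(1) unfolding Field_card_of .
  then show ?thesis
    using card_of_ordLeq[of "(UNIV :: 'x set) \<times> (UNIV :: 'y set)" "UNIV :: 'z set"] by auto
qed

lemma inj_singleton_exists: "\<exists>f :: 'x \<Rightarrow> 'x set. inj f"
proof
  show "inj (\<lambda>x :: 'x. {x})" by (rule injI) simp
qed

text \<open>A condition is a triple of sets of ordinals or codes. A list of ordinals is a set of pairs of a
  position and an ordinal, which is two power sets above \<open>\<nat>\<close>; a code adds one power set, and a set of codes
  another one.\<close>

lemma condition_embeds_in_universe: "\<exists>j :: condition \<Rightarrow> forcing_universe. inj j"
proof -
  note single = inj_singleton_exists and comp = inj_comp_exists and pow = inj_image_exists
  have w1: "\<exists>f :: w1 \<Rightarrow> nat set. inj f"
    using Rep_w1_inject by (intro exI[of _ Rep_w1] injI) simp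
  have inf1: "infinite (UNIV :: nat set set set)" and inf2: "infinite (UNIV :: forcing_universe set)"
    by (simp_all add: Finite_Set.finite_set)
  have "inj (\<lambda>l :: w1 list. (\<lambda>i. (i, l ! i)) ` {..<length l})"
  proof (rule injI)
    fix l l' :: "w1 list"
    assume eq: "(\<lambda>i. (i, l ! i)) ` {..<length l} = (\<lambda>i. (i, l' ! i)) ` {..<length l'}"
    then have "fst ` (\<lambda>i. (i, l ! i)) ` {..<length l} = fst ` (\<lambda>i. (i, l' ! i)) ` {..<length l'}"
      by simp
    then have len: "length l = length l'" by (simp add: image_image)
    show "l = l'"
    proof (rule nth_equalityI[OF len])
      fix i assume "i < length l"
      then have "(i, l ! i) \<in> (\<lambda>i. (i, l' ! i)) ` {..<length l'}" unfolding eq[symmetric] by simp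
      then show "l ! i = l' ! i" by auto
    qed
  qed
  then have "\<exists>f :: w1 list \<Rightarrow> (nat \<times> w1) set. inj f" by (rule exI[of inj])
  then have "\<exists>f :: w1 list \<Rightarrow> nat set set. inj f"
    by (rule comp) (rule pow, rule inj_prod_exists[OF _ single w1], simp add: Finite_Set.finite_set)
  from inj_prod_exists[OF inf1 comp[OF single single] this]
  have "\<exists>f :: nat \<times> w1 list \<Rightarrow> nat set set. inj f" .
  from pow[OF pow[OF this]] have code: "\<exists>f :: code set \<Rightarrow> forcing_universe. inj f" .
  have "\<exists>f :: w1 set \<Rightarrow> forcing_universe. inj f"
    by (rule comp[OF pow[OF w1] comp[OF single single]])
  from inj_prod_exists[OF inf2 this inj_prod_exists[OF inf2 code code]]
  show ?thesis .
qed

section \<open>Square roots and positive functionals in unital C*-algebras\<close>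

text \<open>Makes the binomial series of \<open>sqrt (1 - x)\<close> converge absolutely for \<open>norm x < 1\<close>.\<close>

lemma abs_half_gchoose_le_1: "\<bar>(1/2 :: real) gchoose n\<bar> \<le> 1"
proof (induction n)
  case (Suc n)
  have "(real (Suc n)) * ((1/2) gchoose Suc n) = (1/2 - real n) * ((1/2) gchoose n)"
    using gbinomial_mult_1[of "1/2 :: real" n] by (simp add: algebra_simps)
  then have "real (Suc n) * \<bar>(1/2 :: real) gchoose Suc n\<bar> = \<bar>1/2 - real n\<bar> * \<bar>(1/2 :: real) gchoose n\<bar>"
    by (metis abs_mult abs_of_nat)
  also have "\<dots> \<le> real (Suc n) * 1"
    using Suc by (intro mult_mono) auto
  finally show ?case by (simp add: mult_le_cancel_left_pos)
qed simp

lemma norm_star_le: "norm x \<le> norm (star x)" for x :: "'a :: unital_cstar_algebra"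
proof (cases "x = 0")
  case False
  have "norm x * norm x = norm (star x * x)" by (simp add: cstar_identity power2_eq_square)
  also have "\<dots> \<le> norm (star x) * norm x" by (rule norm_mult_ineq)
  finally show ?thesis using False by simp
qed simp

lemma norm_star: "norm (star x) = norm (x :: 'a :: unital_cstar_algebra)"
  using norm_star_le[of x] norm_star_le[of "star x"] by (simp add: star_star)

lemma scaleC_minus1: "(- 1) *\<^sub>C x = - (x :: 'a :: unital_cstar_algebra)"
  using scaleC_of_real[of "-1" x] by simp

lemma star_scaleR: "star (t *\<^sub>R x) = t *\<^sub>R star (x :: 'a :: unital_cstar_algebra)"
  using star_scaleC[of "complex_of_real t" x] by (simp add: scaleC_of_real)

lemma bounded_linear_star: "bounded_linear (star :: 'a :: unital_cstar_algebra \<Rightarrow> 'a)"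
  by (rule bounded_linear_intro[where K = 1]) (simp_all add: star_add star_scaleR norm_star)

lemmas star_minus = bounded_linear.linear[OF bounded_linear_star, THEN linear_neg]
lemmas star_diff = bounded_linear.linear[OF bounded_linear_star, THEN linear_diff]

lemma star_one [simp]: "star 1 = (1 :: 'a :: unital_cstar_algebra)"
proof -
  have "star 1 = star 1 * star (star (1 :: 'a))" by (simp add: star_star)
  also have "\<dots> = star (star 1 * 1)" by (simp only: star_mult)
  also have "\<dots> = 1" by (simp add: star_star)
  finally show ?thesis .
qed

lemma star_power: "star (x ^ n) = star (x :: 'a :: unital_cstar_algebra) ^ n"
  by (induction n) (simp_all add: star_mult power_commutes)

text \<open>The binomial series of \<open>sqrt (1 - x)\<close>, squared as a Cauchy product; the coefficients of the square are
  computed by the Vandermonde identity. It takes the place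
  of spectral theory as the source of positive elements.\<close>

lemma square_root_one_minus:
  fixes x :: "'a :: unital_cstar_algebra"
  assumes sa: "star x = x" and nx: "norm x < 1"
  obtains s where "star s = s" "s * s = 1 - x"
proof -
  define c :: "nat \<Rightarrow> real" where "c n = (1/2 gchoose n) * (-1) ^ n" for n
  define f where "f n = c n *\<^sub>R x ^ n" for n
  have abs_c: "\<bar>c n\<bar> \<le> 1" for n
    unfolding c_def using abs_half_gchoose_le_1[of n] by (simp add: abs_mult power_abs)
  have summ: "summable (\<lambda>n. norm (f n))"
  proof (rule summable_comparison_test[OF _ summable_geometric])
    show "norm (norm x) < 1" using nx by simp
    have "norm (f n) \<le> norm x ^ n" for n
    proof -
      have "norm (f n) = \<bar>c n\<bar> * norm (x ^ n)" unfolding f_def by simp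
      also have "\<dots> \<le> 1 * norm x ^ n"
        using abs_c by (intro mult_mono norm_power_ineq) auto
      finally show ?thesis by simp
    qed
    then show "\<exists>N. \<forall>n\<ge>N. norm (norm (f n)) \<le> norm x ^ n" by auto
  qed
  have conv: "(\<Sum>i\<le>k. f i * f (k - i)) = (if k = 0 then 1 else if k = 1 then - x else 0)" for k
  proof -
    have "(\<Sum>i\<le>k. f i * f (k - i)) = (\<Sum>i\<le>k. (c i * c (k - i)) *\<^sub>R x ^ k)"
      unfolding f_def by (intro sum.cong) (simp_all add: power_add[symmetric])
    also have "\<dots> = (\<Sum>i\<le>k. c i * c (k - i)) *\<^sub>R x ^ k"
      by (simp add: scaleR_left.sum)
    also have "(\<Sum>i\<le>k. c i * c (k - i)) = (\<Sum>i=0..k. ((1/2) gchoose i) * ((1/2) gchoose (k - i))) * (-1) ^ k"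
      unfolding c_def sum_distrib_right atLeast0AtMost
    proof (rule sum.cong)
      fix i assume "i \<in> {..k}"
      then have "(-1 :: real) ^ k = (-1) ^ i * (-1) ^ (k - i)" by (simp flip: power_add)
      then show "(1/2 gchoose i) * (-1) ^ i * ((1/2 gchoose (k - i)) * (-1) ^ (k - i)) =
          (1/2 gchoose i) * (1/2 gchoose (k - i)) * (-1 :: real) ^ k"
        by (simp only: mult_ac)
    qed simp
    also have "(\<Sum>i=0..k. ((1/2 :: real) gchoose i) * ((1/2) gchoose (k - i))) = 1 gchoose k"
      using gbinomial_Vandermonde[of "1/2 :: real" "1/2" k] by simp
    also have "(1 :: real) gchoose k = (if k \<le> 1 then 1 else 0)"
      using binomial_gbinomial[of 1 k, where 'a = real] by (cases k) (auto simp: binomial_eq_0)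
    finally show ?thesis by (cases k) auto
  qed
  define s where "s = (\<Sum>n. f n)"
  have "(\<lambda>k. \<Sum>i\<le>k. f i * f (k - i)) sums (s * s)"
    unfolding s_def by (rule Cauchy_product_sums[OF summ summ])
  moreover have "(\<lambda>k. \<Sum>i\<le>k. f i * f (k - i)) sums (\<Sum>k\<in>{0 :: nat, 1}. if k = 0 then 1 else if k = 1 then - x else 0)"
    unfolding conv by (rule sums_finite) auto
  ultimately have "s * s = (\<Sum>k\<in>{0 :: nat, 1}. if k = 0 then 1 else if k = 1 then - x else 0)"
    by (rule sums_unique2)
  then have "s * s = 1 - x" by simp
  moreover have "star s = s"
  proof -
    have "star (f n) = f n" for n unfolding f_def by (simp add: star_scaleR star_power sa)
    moreover have "star s = (\<Sum>n. star (f n))"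
      unfolding s_def
      using bounded_linear.suminf[OF bounded_linear_star summable_norm_cancel[OF summ]] by simp
    ultimately show ?thesis unfolding s_def by simp
  qed
  ultimately show thesis by (intro that)
qed

lemma positive_one_minus:
  fixes x :: "'a :: unital_cstar_algebra"
  assumes "star x = x" "norm x < 1"
  shows "positive_element (1 - x)"
proof -
  obtain s where "star s = s" "s * s = 1 - x" by (rule square_root_one_minus[OF assms])
  then show ?thesis unfolding positive_element_def by metis
qed

lemma positive_star_mult: "positive_element (star x * x)"
  unfolding positive_element_def by blast

lemma positive_one: "positive_element (1 :: 'a :: unital_cstar_algebra)"
  using positive_star_mult[of "1 :: 'a"] by simp

lemma cdual_scaleC: "\<tau> \<in> cdual \<Longrightarrow> blinfun_apply \<tau> (c *\<^sub>C x) = c * blinfun_apply \<tau> x"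
  unfolding cdual_def by simp

lemma positive_functionalD:
  assumes "\<tau> \<in> positive_functionals"
  shows "\<tau> \<in> cdual" "positive_element x \<Longrightarrow> 0 \<le> Re (blinfun_apply \<tau> x)"
    "positive_element x \<Longrightarrow> Im (blinfun_apply \<tau> x) = 0"
  using assms unfolding positive_functionals_def by (auto simp: complex_nonneg_Reals_iff)

text \<open>The elements \<open>1 - x / t\<close> are positive for all \<open>t > norm x\<close>.\<close>

lemma positive_functional_selfadjoint:
  fixes x :: "'a :: unital_cstar_algebra"
  assumes \<tau>: "\<tau> \<in> positive_functionals" and sa: "star x = x"
  shows "Im (blinfun_apply \<tau> x) = 0" "Re (blinfun_apply \<tau> x) \<le> Re (blinfun_apply \<tau> 1) * norm x"
proof -
  have pos: "positive_element (1 - (1 / t) *\<^sub>R x)" if "norm x < t" for t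
  proof (rule positive_one_minus)
    show "star ((1 / t) *\<^sub>R x) = (1 / t) *\<^sub>R x" by (simp add: star_scaleR sa)
    have "0 < t" using that norm_ge_zero[of x] by linarith
    then show "norm ((1 / t) *\<^sub>R x) < 1" using that by simp
  qed
  have val: "blinfun_apply \<tau> (1 - (1 / t) *\<^sub>R x) = blinfun_apply \<tau> 1 - blinfun_apply \<tau> x / t" for t :: real
    unfolding blinfun.diff_right blinfun.scaleR_right
    by (simp add: scaleR_conv_of_real divide_inverse mult.commute)
  obtain t where t: "norm x < t" "0 < t" using norm_ge_zero[of x] by (meson gt_ex le_less_trans)
  show "Im (blinfun_apply \<tau> x) = 0"
    using positive_functionalD(3)[OF \<tau> pos[OF t(1)]] positive_functionalD(3)[OF \<tau> positive_one] t(2)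
    unfolding val by simp
  show "Re (blinfun_apply \<tau> x) \<le> Re (blinfun_apply \<tau> 1) * norm x"
  proof (rule field_le_epsilon)
    fix e :: real assume e: "0 < e"
    define d where "d = e / (Re (blinfun_apply \<tau> 1) + 1)"
    have 1: "0 \<le> Re (blinfun_apply \<tau> 1)" by (rule positive_functionalD(2)[OF \<tau> positive_one])
    then have d: "0 < d" unfolding d_def using e by simp
    then have t: "norm x < norm x + d" "0 < norm x + d"
      using norm_ge_zero[of x] by linarith+
    have "0 \<le> Re (blinfun_apply \<tau> 1) - Re (blinfun_apply \<tau> x) / (norm x + d)"
      using positive_functionalD(2)[OF \<tau> pos[OF t(1)]] unfolding val minus_complex.sel Re_divide_of_real .
    then have "Re (blinfun_apply \<tau> x) \<le> Re (blinfun_apply \<tau> 1) * (norm x + d)"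
      using t(2) by (simp add: field_simps)
    also have "\<dots> = Re (blinfun_apply \<tau> 1) * norm x + Re (blinfun_apply \<tau> 1) * d"
      by (simp add: algebra_simps)
    also have "Re (blinfun_apply \<tau> 1) * d \<le> (Re (blinfun_apply \<tau> 1) + 1) * d"
      using d by (intro mult_right_mono) simp_all
    also have "\<dots> = e" unfolding d_def using 1 by simp
    finally show "Re (blinfun_apply \<tau> x) \<le> Re (blinfun_apply \<tau> 1) * norm x + e" by simp
  qed
qed

definition re_part :: "'a :: unital_cstar_algebra \<Rightarrow> 'a" where
  "re_part x = (1 / 2) *\<^sub>R (x + star x)"

definition im_part :: "'a :: unital_cstar_algebra \<Rightarrow> 'a" where
  "im_part x = (- \<i> / 2) *\<^sub>C (x - star x)"

lemma star_re_part: "star (re_part x) = re_part x"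
  unfolding re_part_def by (simp add: star_scaleR star_add star_star add.commute)

lemma star_im_part: "star (im_part x) = im_part x"
proof -
  have "star (im_part x) = (\<i> / 2) *\<^sub>C (star x - x)"
    unfolding im_part_def by (simp add: star_scaleC star_diff star_star)
  also have "\<dots> = (\<i> / 2) *\<^sub>C ((- 1) *\<^sub>C (x - star x))" by (simp add: scaleC_minus1)
  also have "\<dots> = im_part x" unfolding im_part_def scaleC_scaleC by simp
  finally show ?thesis .
qed

lemma i_scaleC_im_part: "\<i> *\<^sub>C im_part x = (1 / 2) *\<^sub>R (x - star x)"
  unfolding im_part_def using scaleC_of_real[of "1/2" "x - star x"] by (simp add: scaleC_scaleC)

text \<open>With this, statements on self-adjoint elements extend to all elements by linearity.\<close>

lemma re_im_decompose: "x = re_part x + \<i> *\<^sub>C im_part x"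
  unfolding i_scaleC_im_part re_part_def by (simp add: scaleR_add_right[symmetric] flip: scaleR_2)

lemma star_re_im: "star x = re_part x - \<i> *\<^sub>C im_part x"
  unfolding i_scaleC_im_part re_part_def by (simp add: scaleR_diff_right[symmetric] flip: scaleR_2)

lemma norm_re_part_le: "norm (re_part x) \<le> norm x"
proof -
  have "norm (x + star x) \<le> norm x + norm x"
    using norm_triangle_ineq[of x "star x"] by (simp add: norm_star)
  then show ?thesis unfolding re_part_def by simp
qed

lemma positive_functional_star:
  assumes \<tau>: "\<tau> \<in> positive_functionals"
  shows "blinfun_apply \<tau> (star x) = cnj (blinfun_apply \<tau> x)"
proof -
  note lin = cdual_scaleC[OF positive_functionalD(1)[OF \<tau>]]
  have "Im (blinfun_apply \<tau> (re_part x)) = 0" "Im (blinfun_apply \<tau> (im_part x)) = 0"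
    using positive_functional_selfadjoint(1)[OF \<tau>] star_re_part star_im_part by blast+
  then have "cnj (blinfun_apply \<tau> (re_part x)) = blinfun_apply \<tau> (re_part x)"
      "cnj (blinfun_apply \<tau> (im_part x)) = blinfun_apply \<tau> (im_part x)"
    by (simp_all add: complex_eq_iff)
  moreover have "blinfun_apply \<tau> x = blinfun_apply \<tau> (re_part x) + \<i> * blinfun_apply \<tau> (im_part x)"
    using arg_cong[OF re_im_decompose[of x], of "blinfun_apply \<tau>"] by (simp add: blinfun.add_right lin)
  moreover have "blinfun_apply \<tau> (star x) = blinfun_apply \<tau> (re_part x) - \<i> * blinfun_apply \<tau> (im_part x)"
    using arg_cong[OF star_re_im[of x], of "blinfun_apply \<tau>"] by (simp add: blinfun.diff_right lin)
  ultimately show ?thesis by simp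
qed

text \<open>Rotate \<open>x\<close> so that its value becomes a nonnegative real number. This value is then attained by the
  self-adjoint part.\<close>

lemma positive_functional_bound:
  assumes \<tau>: "\<tau> \<in> positive_functionals"
  shows "cmod (blinfun_apply \<tau> x) \<le> Re (blinfun_apply \<tau> 1) * norm x"
proof (cases "blinfun_apply \<tau> x = 0")
  case True
  then show ?thesis using positive_functionalD(2)[OF \<tau> positive_one] by simp
next
  case False
  note lin = cdual_scaleC[OF positive_functionalD(1)[OF \<tau>]]
  define u where "u = complex_of_real (cmod (blinfun_apply \<tau> x)) / blinfun_apply \<tau> x"
  have u: "cmod u = 1" "u * blinfun_apply \<tau> x = cmod (blinfun_apply \<tau> x)"
    unfolding u_def using False by (simp_all add: norm_divide)
  let ?y = "u *\<^sub>C x"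
  have "blinfun_apply \<tau> (re_part ?y) = Re (blinfun_apply \<tau> ?y)"
    unfolding re_part_def
    by (simp add: blinfun.scaleR_right blinfun.add_right positive_functional_star[OF \<tau>] complex_eq_iff)
  then have "cmod (blinfun_apply \<tau> x) = Re (blinfun_apply \<tau> (re_part ?y))"
    using u(2) by (simp add: lin)
  also have "\<dots> \<le> Re (blinfun_apply \<tau> 1) * norm (re_part ?y)"
    by (rule positive_functional_selfadjoint(2)[OF \<tau> star_re_part])
  also have "\<dots> \<le> Re (blinfun_apply \<tau> 1) * norm x"
    using norm_re_part_le[of ?y] u(1) positive_functionalD(2)[OF \<tau> positive_one]
    by (intro mult_left_mono) (simp_all add: norm_scaleC)
  finally show ?thesis .
qed

lemma norm_positive_functional:
  assumes \<tau>: "\<tau> \<in> positive_functionals"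
  shows "norm \<tau> = Re (blinfun_apply \<tau> 1)"
proof (rule antisym)
  show "norm \<tau> \<le> Re (blinfun_apply \<tau> 1)"
    using positive_functionalD(2)[OF \<tau> positive_one] positive_functional_bound[OF \<tau>]
    by (intro norm_blinfun_bound) simp_all
  have "Re (blinfun_apply \<tau> 1) \<le> norm (blinfun_apply \<tau> 1)" by (rule complex_Re_le_cmod)
  also have "\<dots> \<le> norm \<tau>" using norm_blinfun[of \<tau> 1] by simp
  finally show "Re (blinfun_apply \<tau> 1) \<le> norm \<tau>" .
qed

lemma states_iff: "\<tau> \<in> states \<longleftrightarrow> \<tau> \<in> positive_functionals \<and> blinfun_apply \<tau> 1 = 1"
proof (cases "\<tau> \<in> positive_functionals")
  case True
  then show ?thesis
    using norm_positive_functional[OF True] positive_functionalD(3)[OF True positive_one]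
    unfolding states_def by (auto simp: complex_eq_iff)
qed (simp add: states_def)

lemma pure_states_subset: "pure_states \<subseteq> states"
  unfolding pure_states_def extreme_point_of_def by blast

section \<open>Multiplicativity of pure states, and averages of states\<close>

lemma positive_functionalI:
  assumes "\<tau> \<in> cdual" "\<And>x. blinfun_apply \<tau> (star x * x) \<in> \<real>\<^sub>\<ge>\<^sub>0"
  shows "\<tau> \<in> positive_functionals"
  using assms unfolding positive_functionals_def positive_element_def by blast

lemma positive_functional_star_mult:
  assumes "\<tau> \<in> positive_functionals"
  shows "blinfun_apply \<tau> (star x * x) \<in> \<real>\<^sub>\<ge>\<^sub>0"
  using assms positive_star_mult unfolding positive_functionals_def by blast

definition mult_functional :: "'a :: unital_cstar_algebra \<Rightarrow> ('a \<Rightarrow>\<^sub>L complex) \<Rightarrow> ('a \<Rightarrow>\<^sub>L complex)" where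
  "mult_functional b \<tau> = \<tau> o\<^sub>L blinfun_mult_right b"

lemma mult_functional_apply: "blinfun_apply (mult_functional b \<tau>) x = blinfun_apply \<tau> (b * x)"
  unfolding mult_functional_def by (simp add: blinfun_mult_right.rep_eq)

lemma mult_functional_cdual: "\<tau> \<in> cdual \<Longrightarrow> mult_functional b \<tau> \<in> cdual"
  unfolding cdual_def by (simp add: mult_functional_apply mult_scaleC_right)

lemma positive_mult_functional:
  fixes \<tau> :: "'a :: unital_cstar_algebra \<Rightarrow>\<^sub>L complex"
  assumes comm: "\<And>x y :: 'a. x * y = y * x" and \<tau>: "\<tau> \<in> positive_functionals" and b: "positive_element b"
  shows "mult_functional b \<tau> \<in> positive_functionals"
proof (rule positive_functionalI)
  show "mult_functional b \<tau> \<in> cdual"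
    by (rule mult_functional_cdual[OF positive_functionalD(1)[OF \<tau>]])
  fix x
  obtain c where c: "b = star c * c" using b unfolding positive_element_def by blast
  have "b * (star x * x) = star (c * x) * (c * x)"
    unfolding c star_mult by (metis comm mult.assoc)
  then show "blinfun_apply (mult_functional b \<tau>) (star x * x) \<in> \<real>\<^sub>\<ge>\<^sub>0"
    unfolding mult_functional_apply using positive_functional_star_mult[OF \<tau>] by simp
qed

lemma cdual_scaleR: "\<tau> \<in> cdual \<Longrightarrow> t *\<^sub>R \<tau> \<in> cdual"
  unfolding cdual_def by (simp add: blinfun.scaleR_left scaleR_conv_of_real mult_ac)

lemma cdual_sum: "(\<And>i. i \<in> I \<Longrightarrow> \<tau> i \<in> cdual) \<Longrightarrow> sum \<tau> I \<in> cdual"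
  unfolding cdual_def by (simp add: blinfun.sum_left sum_distrib_left)

lemma positive_functionals_scaleR:
  assumes "\<tau> \<in> positive_functionals" "0 \<le> t"
  shows "t *\<^sub>R \<tau> \<in> positive_functionals"
  using assms positive_functional_star_mult[OF assms(1)] cdual_scaleR[OF positive_functionalD(1)[OF assms(1)]]
  by (intro positive_functionalI) (auto simp: blinfun.scaleR_left complex_nonneg_Reals_iff)

lemma positive_functionals_sum:
  assumes "\<And>i. i \<in> I \<Longrightarrow> \<tau> i \<in> positive_functionals"
  shows "sum \<tau> I \<in> positive_functionals"
proof (rule positive_functionalI)
  show "sum \<tau> I \<in> cdual" using positive_functionalD(1) assms by (intro cdual_sum) blast
  show "blinfun_apply (sum \<tau> I) (star x * x) \<in> \<real>\<^sub>\<ge>\<^sub>0" for x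
    using positive_functional_star_mult[OF assms] unfolding blinfun.sum_left
    by (auto simp: complex_nonneg_Reals_iff intro!: sum_nonneg)
qed

text \<open>For \<open>0 \<le> b \<le> 1\<close> the state splits into the positive functionals \<open>x \<mapsto> \<tau> (b * x)\<close> and
  \<open>x \<mapsto> \<tau> ((1 - b) * x)\<close>. By extremality the normalised parts agree with \<open>\<tau>\<close>.\<close>

lemma pure_state_absorbs:
  fixes \<tau> :: "'a :: unital_cstar_algebra \<Rightarrow>\<^sub>L complex"
  assumes comm: "\<And>x y :: 'a. x * y = y * x" and \<tau>: "\<tau> \<in> pure_states"
    and b: "positive_element b" "positive_element (1 - b)"
  shows "blinfun_apply \<tau> (b * x) = blinfun_apply \<tau> b * blinfun_apply \<tau> x"
proof -
  have st: "\<tau> \<in> states" using \<tau> pure_states_subset by blast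
  then have pos: "\<tau> \<in> positive_functionals" and one: "blinfun_apply \<tau> 1 = 1"
    unfolding states_iff by simp_all
  define t where "t = Re (blinfun_apply \<tau> b)"
  have tb: "blinfun_apply \<tau> b = of_real t"
    unfolding t_def using positive_functionalD(3)[OF pos b(1)] by (simp add: complex_eq_iff)
  have t01: "0 \<le> t" "t \<le> 1"
    using positive_functionalD(2)[OF pos b(1)] positive_functionalD(2)[OF pos b(2)]
    unfolding t_def by (simp_all add: blinfun.diff_right one)
  let ?\<phi> = "mult_functional b \<tau>" and ?\<psi> = "mult_functional (1 - b) \<tau>"
  have \<phi>: "?\<phi> \<in> positive_functionals" and \<psi>: "?\<psi> \<in> positive_functionals"
    using positive_mult_functional[OF comm pos] b by blast+
  have \<phi>1: "blinfun_apply ?\<phi> 1 = of_real t" and \<psi>1: "blinfun_apply ?\<psi> 1 = of_real (1 - t)"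
    unfolding mult_functional_apply by (simp_all add: tb blinfun.diff_right one)
  have split: "blinfun_apply \<tau> x = blinfun_apply \<tau> (b * x) + blinfun_apply \<tau> ((1 - b) * x)"
    by (simp add: algebra_simps blinfun.diff_right)
  consider "t = 0" | "t = 1" | "0 < t" "t < 1" using t01 by linarith
  then show ?thesis
  proof cases
    case 1
    then show ?thesis
      using positive_functional_bound[OF \<phi>, of x] \<phi>1 tb by (simp add: mult_functional_apply)
  next
    case 2
    then show ?thesis
      using positive_functional_bound[OF \<psi>, of x] \<psi>1 tb split by (simp add: mult_functional_apply)
  next
    case 3
    define A where "A = (1 / t) *\<^sub>R ?\<phi>"
    define B where "B = (1 / (1 - t)) *\<^sub>R ?\<psi>"
    have A: "A \<in> states"
      unfolding states_iff A_def using 3 positive_functionals_scaleR[OF \<phi>] \<phi>1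
      by (simp add: blinfun.scaleR_left scaleR_conv_of_real)
    have "blinfun_apply B 1 = of_real ((1 / (1 - t)) * (1 - t))"
      unfolding B_def blinfun.scaleR_left \<psi>1 scaleR_conv_of_real of_real_mult ..
    moreover have "(1 / (1 - t)) * (1 - t) = 1" using 3 by simp
    ultimately have B: "B \<in> states"
      unfolding states_iff B_def using 3 positive_functionals_scaleR[OF \<psi>] by simp
    have eq: "\<tau> = (1 - t) *\<^sub>R B + t *\<^sub>R A"
    proof (rule blinfun_eqI)
      fix y
      show "blinfun_apply \<tau> y = blinfun_apply ((1 - t) *\<^sub>R B + t *\<^sub>R A) y"
        unfolding A_def B_def using 3
        by (simp add: blinfun.add_left blinfun.scaleR_left mult_functional_apply
            algebra_simps blinfun.diff_right)
    qed
    have "\<tau> \<notin> open_segment B A"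
      using \<tau> A B unfolding pure_states_def extreme_point_of_def by blast
    then have "B = A" using eq 3 unfolding in_segment by blast
    then have "\<tau> = A" using eq by (simp add: scaleR_add_left[symmetric])
    then have "blinfun_apply \<tau> x = blinfun_apply \<tau> (b * x) / of_real t"
      unfolding A_def
      by (metis blinfun.scaleR_left mult_functional_apply scaleR_conv_of_real divide_inverse
          inverse_eq_divide mult.commute of_real_inverse)
    then show ?thesis using 3 tb by (simp add: field_simps)
  qed
qed

text \<open>A self-adjoint \<open>y\<close> is a linear combination of \<open>1\<close> and \<open>b = (1 - y / t) / 2\<close>, where \<open>t > norm y\<close> ensures that
  both \<open>b\<close> and \<open>1 - b\<close> are positive.\<close>

lemma pure_state_mult_selfadjoint:
  fixes \<tau> :: "'a :: unital_cstar_algebra \<Rightarrow>\<^sub>L complex"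
  assumes comm: "\<And>x y :: 'a. x * y = y * x" and \<tau>: "\<tau> \<in> pure_states" and y: "star y = y"
  shows "blinfun_apply \<tau> (y * x) = blinfun_apply \<tau> y * blinfun_apply \<tau> x"
proof -
  have one: "blinfun_apply \<tau> 1 = 1" using \<tau> pure_states_subset states_iff by blast
  obtain t where t: "norm y < t" "0 < t" using norm_ge_zero[of y] by (meson gt_ex le_less_trans)
  define b where "b = (1 / 2) *\<^sub>R (1 - (1 / t) *\<^sub>R y)"
  have half: "positive_element ((1 / 2) *\<^sub>R z)" if z: "positive_element z" for z :: 'a
  proof -
    obtain c where "z = star c * c" using z unfolding positive_element_def by blast
    then have "(1 / 2) *\<^sub>R z = star ((1 / sqrt 2) *\<^sub>R c) * ((1 / sqrt 2) *\<^sub>R c)"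
      by (simp add: star_scaleR)
    then show ?thesis unfolding positive_element_def by blast
  qed
  have n: "norm ((1 / t) *\<^sub>R y) < 1" using t by simp
  let ?z = "(1 / t) *\<^sub>R y"
  have "positive_element (1 - ?z)" "positive_element (1 - (- ?z))"
    using n y by (intro positive_one_minus; simp add: star_scaleR star_minus)+
  moreover have "b + (1 / 2) *\<^sub>R (1 - (- ?z)) = 1"
  proof -
    have "b + (1 / 2) *\<^sub>R (1 - (- ?z)) = (1 / 2) *\<^sub>R ((1 - ?z) + (1 - (- ?z)))"
      unfolding b_def by (rule scaleR_add_right[symmetric])
    also have "(1 - ?z) + (1 - (- ?z)) = 1 + 1" by simp
    finally show ?thesis by (simp only: scaleR_half_double)
  qed
  then have "1 - b = (1 / 2) *\<^sub>R (1 - (- ?z))" by (metis add_diff_cancel_left')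
  ultimately have "positive_element b" "positive_element (1 - b)"
    unfolding b_def using half by simp_all
  from pure_state_absorbs[OF comm \<tau> this, of x]
  have "blinfun_apply \<tau> (b * x) = blinfun_apply \<tau> b * blinfun_apply \<tau> x" .
  moreover have y_eq: "y = t *\<^sub>R (1 - 2 *\<^sub>R b)" unfolding b_def using t by simp
  have "blinfun_apply \<tau> (y * x) = t *\<^sub>R (blinfun_apply \<tau> x - 2 *\<^sub>R blinfun_apply \<tau> (b * x))"
    by (subst y_eq) (simp add: left_diff_distrib blinfun.diff_right blinfun.scaleR_right)
  moreover have "blinfun_apply \<tau> y = t *\<^sub>R (1 - 2 *\<^sub>R blinfun_apply \<tau> b)"
    by (subst y_eq) (simp add: blinfun.diff_right blinfun.scaleR_right one)
  ultimately show ?thesis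
    by (simp add: scaleR_conv_of_real left_diff_distrib)
qed

lemma pure_state_mult:
  fixes \<tau> :: "'a :: unital_cstar_algebra \<Rightarrow>\<^sub>L complex"
  assumes comm: "\<And>x y :: 'a. x * y = y * x" and \<tau>: "\<tau> \<in> pure_states"
  shows "blinfun_apply \<tau> (y * x) = blinfun_apply \<tau> y * blinfun_apply \<tau> x"
proof -
  have "\<tau> \<in> cdual" using \<tau> pure_states_subset states_iff positive_functionalD(1) by blast
  note lin = cdual_scaleC[OF this]
  note sa = pure_state_mult_selfadjoint[OF comm \<tau>]
  have "y * x = re_part y * x + \<i> *\<^sub>C (im_part y * x)"
    using arg_cong[OF re_im_decompose[of y], of "\<lambda>z. z * x"] by (simp add: distrib_right mult_scaleC_left)
  then have "blinfun_apply \<tau> (y * x) = (blinfun_apply \<tau> (re_part y) + \<i> * blinfun_apply \<tau> (im_part y)) * blinfun_apply \<tau> x"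
    by (simp add: blinfun.add_right lin sa star_re_part star_im_part algebra_simps)
  also have "blinfun_apply \<tau> (re_part y) + \<i> * blinfun_apply \<tau> (im_part y) = blinfun_apply \<tau> y"
    using arg_cong[OF re_im_decompose[of y], of "blinfun_apply \<tau>"] by (simp add: blinfun.add_right lin)
  finally show ?thesis .
qed

lemma pure_state_star_mult:
  fixes \<tau> :: "'a :: unital_cstar_algebra \<Rightarrow>\<^sub>L complex"
  assumes "\<And>x y :: 'a. x * y = y * x" "\<tau> \<in> pure_states"
  shows "blinfun_apply \<tau> (star x * x) = (cmod (blinfun_apply \<tau> x))\<^sup>2"
proof -
  have "\<tau> \<in> positive_functionals" using assms(2) pure_states_subset states_iff by blast
  then show ?thesis
    using pure_state_mult[OF assms] positive_functional_star
    by (metis complex_norm_square mult.commute)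
qed

lemma pure_state_prod_list:
  fixes \<tau> :: "'a :: unital_cstar_algebra \<Rightarrow>\<^sub>L complex"
  assumes "\<And>x y :: 'a. x * y = y * x" "\<tau> \<in> pure_states"
  shows "blinfun_apply \<tau> (prod_list xs) = prod_list (map (blinfun_apply \<tau>) xs)"
proof (induction xs)
  case Nil
  show ?case using assms(2) pure_states_subset states_iff by auto
qed (simp add: pure_state_mult[OF assms])

definition average_state :: "('i \<Rightarrow> 'a :: unital_cstar_algebra \<Rightarrow>\<^sub>L complex) \<Rightarrow> 'i set \<Rightarrow> 'a \<Rightarrow>\<^sub>L complex" where
  "average_state \<tau> I = (1 / real (card I)) *\<^sub>R sum \<tau> I"

lemma average_state:
  assumes "finite I" "I \<noteq> {}" "\<And>i. i \<in> I \<Longrightarrow> \<tau> i \<in> states"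
  shows "average_state \<tau> I \<in> states"
proof -
  have "average_state \<tau> I \<in> positive_functionals"
    unfolding average_state_def using assms(3) states_iff
    by (intro positive_functionals_scaleR positive_functionals_sum) auto
  moreover have "blinfun_apply (average_state \<tau> I) 1 = 1"
    unfolding average_state_def using assms states_iff[of "\<tau> _"]
    by (simp add: blinfun.scaleR_left blinfun.sum_left card_gt_0_iff scaleR_conv_of_real)
  ultimately show ?thesis unfolding states_iff by simp
qed

lemma Re_average_state:
  "Re (blinfun_apply (average_state \<tau> I) x) = (\<Sum>i\<in>I. Re (blinfun_apply (\<tau> i) x)) / real (card I)"
  unfolding average_state_def by (simp add: blinfun.scaleR_left blinfun.sum_left)

lemma Re_average_state_ge:
  assumes "finite I" "\<And>i. i \<in> I \<Longrightarrow> 0 \<le> Re (blinfun_apply (\<tau> i) x)" "i \<in> I" "\<epsilon> \<le> Re (blinfun_apply (\<tau> i) x)"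
  shows "\<epsilon> / real (card I) \<le> Re (blinfun_apply (average_state \<tau> I) x)"
proof -
  have "Re (blinfun_apply (\<tau> i) x) \<le> (\<Sum>i\<in>I. Re (blinfun_apply (\<tau> i) x))"
    using assms by (intro member_le_sum) auto
  then show ?thesis unfolding Re_average_state using assms(4) by (intro divide_right_mono) simp_all
qed


section \<open>Weak* discrete sets, UBABS+ and almost irredundant sets\<close>

lemma openin_weak_star_Re:
  assumes "open U"
  shows "openin weak_star_topology {\<sigma> \<in> cdual. Re (blinfun_apply \<sigma> x) \<in> U}"
proof -
  let ?V = "{f :: 'a \<Rightarrow> complex. Re (f x) \<in> U}"
  have "openin (product_topology (\<lambda>_. euclidean) UNIV) {f \<in> topspace (product_topology (\<lambda>_. euclidean) UNIV). f x \<in> Re -` U}"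
    by (rule openin_continuous_map_preimage[OF continuous_map_product_projection])
      (simp_all add: open_vimage[OF assms continuous_on_Re[OF continuous_on_id]])
  then have "openin (product_topology (\<lambda>_. euclidean) UNIV) ?V" by (simp add: vimage_def)
  then show ?thesis
    unfolding weak_star_topology_def openin_pullback_topology
    by (intro exI[of _ ?V]) auto
qed

lemma topspace_weak_star: "topspace weak_star_topology = cdual"
  unfolding weak_star_topology_def topspace_pullback_topology by simp

lemma weak_star_discrete_family:
  fixes t :: "'i \<Rightarrow> 'a :: unital_cstar_algebra \<Rightarrow>\<^sub>L complex"
  assumes sub: "\<And>i. i \<in> I \<Longrightarrow> t i \<in> cdual" and unc: "uncountable I"
    and iso: "\<And>i. i \<in> I \<Longrightarrow> \<exists>V. openin weak_star_topology V \<and> t i \<in> V \<and> (\<forall>k\<in>I. k \<noteq> i \<longrightarrow> t k \<notin> V)"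
  shows "uncountable (t ` I)" "weak_star_discrete (t ` I)"
proof -
  have "inj_on t I"
  proof (rule inj_onI, rule ccontr)
    fix i k assume ik: "i \<in> I" "k \<in> I" "t i = t k" "i \<noteq> k"
    then obtain V where "t i \<in> V" "t k \<notin> V" using iso[of i] by metis
    then show False using ik(3) by simp
  qed
  then show "uncountable (t ` I)" using unc countable_image_inj_on by blast
  have "\<exists>V. openin weak_star_topology V \<and> V \<inter> t ` I = {x}" if "x \<in> t ` I" for x
  proof -
    obtain i where i: "i \<in> I" "x = t i" using \<open>x \<in> t ` I\<close> by blast
    obtain V where "openin weak_star_topology V" "t i \<in> V" "\<forall>k\<in>I. k \<noteq> i \<longrightarrow> t k \<notin> V"
      using iso[OF i(1)] by blast
    then show ?thesis using i by (intro exI[of _ V]) auto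
  qed
  then have "openin (subtopology weak_star_topology (t ` I)) {x}" if "x \<in> t ` I" for x
    using that unfolding openin_subtopology by metis
  moreover have "t ` I \<subseteq> topspace weak_star_topology"
    using sub unfolding topspace_weak_star by blast
  ultimately have "discrete_topology (t ` I) = subtopology weak_star_topology (t ` I)"
    unfolding discrete_topology_unique by (simp add: Int_absorb1)
  then show "weak_star_discrete (t ` I)"
    unfolding weak_star_discrete_def by simp
qed

text \<open>The element \<open>1 - w* w\<close> is positive by the square root construction and at most \<open>1\<close>. It takes the value \<open>1\<close>
  at a state exactly where \<open>w* w\<close> vanishes.\<close>

lemma UBABS_plus_from_vanishing:
  fixes w :: "w1 \<Rightarrow> 'a :: unital_cstar_algebra"
  assumes st: "\<And>\<xi>. \<sigma> \<xi> \<in> states" and nw: "\<And>\<xi>. norm (w \<xi>) < 1"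
    and zero: "\<And>\<xi>. blinfun_apply (\<sigma> \<xi>) (star (w \<xi>) * w \<xi>) = 0"
    and \<delta>: "0 < \<delta>" "\<And>\<xi> \<eta>. \<eta> \<noteq> \<xi> \<Longrightarrow> \<delta> \<le> Re (blinfun_apply (\<sigma> \<xi>) (star (w \<eta>) * w \<eta>))"
  shows "\<exists>\<eta> (b :: nat set \<Rightarrow> 'a) \<sigma>. 0 \<le> \<eta> \<and> \<eta> < 1 \<and> UBABS_plus \<eta> b \<sigma>"
proof -
  define b where "b \<xi> = 1 - star (w \<xi>) * w \<xi>" for \<xi>
  have pos: "\<sigma> \<xi> \<in> positive_functionals" and one: "blinfun_apply (\<sigma> \<xi>) 1 = 1" for \<xi>
    using st unfolding states_iff by simp_all
  have nsw: "norm (star (w \<xi>) * w \<xi>) < 1" for \<xi>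
    using nw[of \<xi>] by (simp add: cstar_identity power_less_one_iff)
  have bpos: "positive_element (b \<xi>)" for \<xi>
    unfolding b_def by (rule positive_one_minus[OF _ nsw]) (simp add: star_mult star_star)
  have b1: "positive_element (1 - b \<xi>)" for \<xi>
    unfolding b_def using positive_star_mult[of "w \<xi>"] by simp
  have bval: "blinfun_apply (\<sigma> \<xi>) (b \<xi>) = 1" for \<xi>
    unfolding b_def by (simp add: blinfun.diff_right one zero)
  let ?\<delta> = "min \<delta> 1"
  have small: "cmod (blinfun_apply (\<sigma> \<xi>) (b \<eta>)) \<le> 1 - ?\<delta>" if "\<eta> \<noteq> \<xi>" for \<xi> \<eta>
  proof -
    have "cmod (blinfun_apply (\<sigma> \<xi>) (b \<eta>)) = Re (blinfun_apply (\<sigma> \<xi>) (b \<eta>))"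
      using positive_functionalD(2,3)[OF pos bpos] by (simp add: cmod_eq_Re)
    also have "\<dots> = 1 - Re (blinfun_apply (\<sigma> \<xi>) (star (w \<eta>) * w \<eta>))"
      unfolding b_def by (simp add: blinfun.diff_right one)
    also have "\<dots> \<le> 1 - ?\<delta>" using \<delta>(2)[OF that] by simp
    finally show ?thesis .
  qed
  have "UBABS_plus (1 - ?\<delta>) (b \<circ> Abs_w1) (\<sigma> \<circ> Abs_w1)"
    unfolding UBABS_plus_def
  proof (intro conjI ballI impI)
    have "norm (b \<xi>) \<le> 2" for \<xi>
      unfolding b_def using norm_triangle_ineq4[of 1 "star (w \<xi>) * w \<xi>"] nsw[of \<xi>] by simp
    then show "bounded ((b \<circ> Abs_w1) ` Field omega1)" by (intro boundedI[of _ 2]) auto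
    have "norm (\<sigma> \<xi>) \<le> 1" for \<xi> using st[of \<xi>] unfolding states_def by simp
    then show "bounded ((\<sigma> \<circ> Abs_w1) ` Field omega1)" by (intro boundedI[of _ 1]) auto
    fix \<alpha> assume \<alpha>: "\<alpha> \<in> Field omega1"
    show "(\<sigma> \<circ> Abs_w1) \<alpha> \<in> states" "positive_element ((b \<circ> Abs_w1) \<alpha>)"
      "positive_element (1 - (b \<circ> Abs_w1) \<alpha>)" "blinfun_apply ((\<sigma> \<circ> Abs_w1) \<alpha>) ((b \<circ> Abs_w1) \<alpha>) = 1"
      using st bpos b1 bval by simp_all
    show "(b \<circ> Abs_w1) \<alpha> \<noteq> 0"
      using bval[of "Abs_w1 \<alpha>"] by (auto simp: blinfun.zero_right)
    fix \<beta> assume "\<beta> \<in> Field omega1" "\<beta> \<noteq> \<alpha>"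
    then have "Abs_w1 \<beta> \<noteq> Abs_w1 \<alpha>" using \<alpha> by (simp add: Abs_w1_inject)
    then show "cmod (blinfun_apply ((\<sigma> \<circ> Abs_w1) \<alpha>) ((b \<circ> Abs_w1) \<beta>)) \<le> 1 - ?\<delta>"
      using small by simp
  qed
  moreover have "0 \<le> 1 - ?\<delta>" "1 - ?\<delta> < 1" using \<delta>(1) by auto
  ultimately show ?thesis by blast
qed

text \<open>In a commutative algebra products of positive elements are positive, so each factor \<open>y \<le> 1\<close> can only
  decrease the value.\<close>

lemma positive_functional_prod_list:
  fixes \<tau> :: "'a :: unital_cstar_algebra \<Rightarrow>\<^sub>L complex"
  assumes comm: "\<And>x y :: 'a. x * y = y * x" and \<tau>: "\<tau> \<in> positive_functionals"
    and ws: "\<And>y. y \<in> set ws \<Longrightarrow> positive_element y \<and> positive_element (1 - y)"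
    and x: "positive_element x"
  shows "positive_element (x * prod_list ws)"
    "Re (blinfun_apply \<tau> (x * prod_list ws)) \<le> Re (blinfun_apply \<tau> x)"
proof -
  have mult: "positive_element (u * v)" if uv: "positive_element u" "positive_element v" for u v :: 'a
  proof -
    obtain c d where "u = star c * c" "v = star d * d" using uv unfolding positive_element_def by blast
    then have "u * v = star (c * d) * (c * d)" unfolding star_mult by (metis comm mult.assoc)
    then show ?thesis unfolding positive_element_def by blast
  qed
  have "positive_element (x * prod_list ws) \<and> Re (blinfun_apply \<tau> (x * prod_list ws)) \<le> Re (blinfun_apply \<tau> x)"
    using ws x
  proof (induction ws arbitrary: x)
    case (Cons y ws)
    have y: "positive_element y" "positive_element (1 - y)" using Cons.prems(1) by simp_all
    have IH: "positive_element ((x * y) * prod_list ws) \<and>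
        Re (blinfun_apply \<tau> ((x * y) * prod_list ws)) \<le> Re (blinfun_apply \<tau> (x * y))"
      using Cons.prems by (intro Cons.IH mult y) simp_all
    have "0 \<le> Re (blinfun_apply \<tau> (x * (1 - y)))"
      by (intro positive_functionalD(2)[OF \<tau>] mult Cons.prems y)
    then have "Re (blinfun_apply \<tau> (x * y)) \<le> Re (blinfun_apply \<tau> x)"
      by (simp add: algebra_simps blinfun.diff_right)
    then show ?case using IH by (simp add: mult.assoc)
  qed simp
  then show "positive_element (x * prod_list ws)"
    "Re (blinfun_apply \<tau> (x * prod_list ws)) \<le> Re (blinfun_apply \<tau> x)" by simp_all
qed

text \<open>At the state \<open>\<sigma> \<alpha>\<close> each word in the other elements has modulus at most that of its first letter, hence at
  most \<open>\<eta>\<close>; so do absolutely convex combinations of words, whereas \<open>b \<alpha>\<close> has the value \<open>1\<close>.\<close>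

lemma UBABS_plus_almost_irredundant:
  fixes b :: "nat set \<Rightarrow> 'a :: unital_cstar_algebra"
  assumes comm: "\<And>x y :: 'a. x * y = y * x" and U: "UBABS_plus \<eta> b \<sigma>" and \<eta>: "0 \<le> \<eta>" "\<eta> < 1"
  shows "uncountable (b ` Field omega1)" "almost_irredundant (b ` Field omega1)"
proof -
  let ?I = "Field omega1"
  have st: "\<sigma> \<alpha> \<in> states" and pos: "positive_element (b \<alpha>)" "positive_element (1 - b \<alpha>)"
    and val: "blinfun_apply (\<sigma> \<alpha>) (b \<alpha>) = 1"
    and small: "\<beta> \<in> ?I \<Longrightarrow> \<beta> \<noteq> \<alpha> \<Longrightarrow> cmod (blinfun_apply (\<sigma> \<alpha>) (b \<beta>)) \<le> \<eta>"
    if "\<alpha> \<in> ?I" for \<alpha> \<beta>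
    using U that unfolding UBABS_plus_def by blast+
  have "inj_on b ?I"
  proof (rule inj_onI, rule ccontr)
    fix \<alpha> \<beta> assume "\<alpha> \<in> ?I" "\<beta> \<in> ?I" "b \<alpha> = b \<beta>" "\<alpha> \<noteq> \<beta>"
    then have "cmod (blinfun_apply (\<sigma> \<alpha>) (b \<alpha>)) \<le> \<eta>" using small[of \<alpha> \<beta>] by simp
    then show False using val[OF \<open>\<alpha> \<in> ?I\<close>] \<eta> by simp
  qed
  then show "uncountable (b ` ?I)"
    using uncountable_Field_omega1 countable_image_inj_on by blast
  show "almost_irredundant (b ` ?I)"
    unfolding almost_irredundant_def
  proof (intro ballI notI)
    fix x assume "x \<in> b ` ?I"
    then obtain \<alpha> where \<alpha>: "\<alpha> \<in> ?I" "x = b \<alpha>" by blast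
    let ?S = "{\<Sum>i<n. c i *\<^sub>C prod_list (w i) | (n::nat) c w.
           n \<ge> 1 \<and> (\<forall>i<n. w i \<noteq> [] \<and> set (w i) \<subseteq> b ` ?I - {x}) \<and> (\<Sum>i<n. cmod (c i)) \<le> 1}"
    assume "x \<in> closure ?S"
    have pf: "\<sigma> \<alpha> \<in> positive_functionals" and n1: "norm (\<sigma> \<alpha>) = 1"
      using st[OF \<alpha>(1)] unfolding states_def by simp_all
    note lin = cdual_scaleC[OF positive_functionalD(1)[OF pf]]
    have word: "cmod (blinfun_apply (\<sigma> \<alpha>) (prod_list w)) \<le> \<eta>"
      if w: "w \<noteq> []" "set w \<subseteq> b ` ?I - {x}" for w
    proof -
      obtain y ws where yws: "w = y # ws" using w(1) by (cases w) auto
      obtain \<beta> where \<beta>: "\<beta> \<in> ?I" "y = b \<beta>" "y \<noteq> x" using w(2) unfolding yws by auto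
      have posw: "positive_element z \<and> positive_element (1 - z)" if "z \<in> set ws" for z
        using w(2) that pos unfolding yws by auto
      have py: "positive_element y" using pos(1)[OF \<beta>(1)] \<beta>(2) by simp
      note P = positive_functional_prod_list[OF comm pf posw py]
      have "cmod (blinfun_apply (\<sigma> \<alpha>) (prod_list w)) = Re (blinfun_apply (\<sigma> \<alpha>) (prod_list w))"
        using positive_functionalD(2,3)[OF pf P(1)] unfolding yws by (simp add: cmod_eq_Re)
      also have "\<dots> \<le> Re (blinfun_apply (\<sigma> \<alpha>) y)" using P(2) unfolding yws by simp
      also have "\<dots> \<le> cmod (blinfun_apply (\<sigma> \<alpha>) y)" by (rule complex_Re_le_cmod)
      also have "\<dots> \<le> \<eta>" using small[OF \<alpha>(1) \<beta>(1)] \<beta>(2,3) \<alpha>(2) by auto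
      finally show ?thesis .
    qed
    have far: "1 - \<eta> \<le> dist y x" if "y \<in> ?S" for y
    proof -
      obtain n c w where y: "y = (\<Sum>i<(n::nat). c i *\<^sub>C prod_list (w i))"
        and w: "\<forall>i<n. w i \<noteq> [] \<and> set (w i) \<subseteq> b ` ?I - {x}" and c: "(\<Sum>i<n. cmod (c i)) \<le> 1"
        using \<open>y \<in> ?S\<close> by blast
      have "cmod (blinfun_apply (\<sigma> \<alpha>) y) \<le> (\<Sum>i<n. cmod (c i) * \<eta>)"
        unfolding y blinfun.sum_right lin
      proof (rule sum_norm_le)
        fix i assume "i \<in> {..<n}"
        then have "w i \<noteq> []" "set (w i) \<subseteq> b ` ?I - {x}" using w by simp_all
        then show "cmod (c i * blinfun_apply (\<sigma> \<alpha>) (prod_list (w i))) \<le> cmod (c i) * \<eta>"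
          using word[of "w i"] by (simp add: norm_mult mult_left_mono)
      qed
      also have "\<dots> = (\<Sum>i<n. cmod (c i)) * \<eta>" by (simp add: sum_distrib_right)
      also have "\<dots> \<le> 1 * \<eta>" using c \<eta>(1) by (rule mult_right_mono)
      finally have "cmod (blinfun_apply (\<sigma> \<alpha>) y) \<le> \<eta>" by simp
      then have "1 - \<eta> \<le> cmod (1 - blinfun_apply (\<sigma> \<alpha>) y)"
        using norm_triangle_ineq2[of 1 "blinfun_apply (\<sigma> \<alpha>) y"] by simp
      also have "1 - blinfun_apply (\<sigma> \<alpha>) y = blinfun_apply (\<sigma> \<alpha>) (x - y)"
        using val[OF \<alpha>(1)] \<alpha>(2) by (simp add: blinfun.diff_right)
      also have "cmod \<dots> \<le> norm (\<sigma> \<alpha>) * norm (x - y)" by (rule norm_blinfun)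
      finally show ?thesis using n1 by (simp add: dist_norm norm_minus_commute)
    qed
    have "\<forall>e>0. \<exists>y\<in>?S. dist y x < e"
      using \<open>x \<in> closure ?S\<close> unfolding closure_approachable .
    moreover have "0 < 1 - \<eta>" using \<eta>(2) by simp
    ultimately have "\<exists>y\<in>?S. dist y x < 1 - \<eta>" by iprover
    then obtain y where y: "y \<in> ?S" "dist y x < 1 - \<eta>" ..
    show False using far[OF y(1)] y(2) by linarith
  qed
qed

section \<open>Systems of pure states indexed by the first uncountable ordinal\<close>

lemma successor_w1:
  obtains s :: "w1 \<Rightarrow> w1" where "\<And>\<xi>. \<xi> < s \<xi>" "\<And>\<zeta> \<xi>. \<zeta> < \<xi> \<Longrightarrow> s \<zeta> \<le> \<xi>"
proof
  fix \<xi> :: w1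
  obtain \<alpha> where "\<xi> < \<alpha>" using exists_above_countable[of "{\<xi>}" UNIV] uncountable_UNIV_w1 by auto
  then show "\<xi> < (LEAST \<alpha>. \<xi> < \<alpha>)" by (rule LeastI)
  show "(LEAST \<alpha>. \<zeta> < \<alpha>) \<le> \<xi>" if "\<zeta> < \<xi>" for \<zeta> :: w1 using that by (rule Least_le)
qed

locale pure_system =
  fixes a :: "w1 \<Rightarrow> 'a :: unital_cstar_algebra" and \<tau> :: "w1 \<Rightarrow> 'a \<Rightarrow>\<^sub>L complex"
  assumes pure: "\<tau> \<alpha> \<in> pure_states"
    and diag: "blinfun_apply (\<tau> \<alpha>) (a \<alpha>) = 1"
    and lower: "\<beta> < \<alpha> \<Longrightarrow> blinfun_apply (\<tau> \<alpha>) (a \<beta>) = 0"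
    and nonneg: "blinfun_apply (\<tau> \<alpha>) (a \<beta>) \<in> \<real>\<^sub>\<ge>\<^sub>0"
begin

lemma state: "\<tau> \<alpha> \<in> states"
  using pure pure_states_subset by blast

lemma in_cdual: "\<tau> \<alpha> \<in> cdual"
  using state states_iff positive_functionalD(1) by blast

lemma nonneg': "0 \<le> Re (blinfun_apply (\<tau> \<alpha>) (a \<beta>))" "Im (blinfun_apply (\<tau> \<alpha>) (a \<beta>)) = 0"
  using nonneg[of \<alpha> \<beta>] by (simp_all add: complex_nonneg_Reals_iff)

text \<open>For \<open>\<beta> < \<alpha>\<close> this is the failure of \<open>a \<alpha>\<close> to separate \<open>\<tau> \<alpha>\<close> from \<open>\<tau> \<beta>\<close>.\<close>

definition bad :: "w1 \<Rightarrow> w1 \<Rightarrow> bool" where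
  "bad \<beta> \<alpha> \<longleftrightarrow> 1 / 2 \<le> Re (blinfun_apply (\<tau> \<beta>) (a \<alpha>))"

lemma bad_le: "bad \<beta> \<alpha> \<Longrightarrow> \<beta> \<le> \<alpha>"
  using lower[of \<alpha> \<beta>] unfolding bad_def by (cases "\<alpha> < \<beta>") auto

lemma reindex: "strict_mono f \<Longrightarrow> pure_system (a \<circ> f) (\<tau> \<circ> f)"
  by unfold_locales (auto simp: pure diag lower nonneg strict_mono_less)

text \<open>The open set given by \<open>Re (\<sigma> (a \<alpha>)) > 1/2\<close> isolates \<open>\<tau> \<alpha>\<close>: later states vanish on \<open>a \<alpha>\<close>, and earlier
  ones are not bad.\<close>

lemma free_set_discrete:
  assumes "uncountable T" "free_of bad T"
  shows "uncountable (\<tau> ` T)" "weak_star_discrete (\<tau> ` T)"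
proof -
  have iso: "\<exists>V. openin weak_star_topology V \<and> \<tau> \<alpha> \<in> V \<and> (\<forall>\<beta>\<in>T. \<beta> \<noteq> \<alpha> \<longrightarrow> \<tau> \<beta> \<notin> V)" if "\<alpha> \<in> T" for \<alpha>
  proof (intro exI conjI ballI impI)
    let ?V = "{\<sigma> \<in> cdual. Re (blinfun_apply \<sigma> (a \<alpha>)) \<in> {1 / 2<..}}"
    show "openin weak_star_topology ?V" by (rule openin_weak_star_Re) simp
    show "\<tau> \<alpha> \<in> ?V" using in_cdual diag by simp
    fix \<beta> assume \<beta>: "\<beta> \<in> T" "\<beta> \<noteq> \<alpha>"
    show "\<tau> \<beta> \<notin> ?V"
    proof (cases "\<beta> < \<alpha>")
      case True
      then have "\<not> bad \<beta> \<alpha>" using assms(2) \<beta> that unfolding free_of_def by blast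
      then show ?thesis unfolding bad_def by simp
    next
      case False
      then have "\<alpha> < \<beta>" using \<beta>(2) by auto
      then show ?thesis using lower by simp
    qed
  qed
  show "uncountable (\<tau> ` T)" "weak_star_discrete (\<tau> ` T)"
    by (rule weak_star_discrete_family[OF in_cdual assms(1) iso]; assumption)+
qed

text \<open>Let \<open>\<sigma> \<xi>\<close> be the average of the states in the block \<open>E \<xi>\<close>, and \<open>g \<xi>\<close> the sum of the elements of the block. Since
  all values are nonnegative, one bad pair, or one diagonal value \<open>1\<close> if \<open>\<zeta> = \<xi>\<close>, suffices for
  \<open>\<sigma> \<zeta> (g \<xi>) \<ge> 1/(2n)\<close> whenever \<open>\<zeta> \<le> \<xi>\<close>, while
  \<open>\<sigma> \<zeta> (g \<xi>) = 0\<close> for \<open>\<zeta> > \<xi>\<close>. So \<open>g (\<xi> + 1) > 0\<close> and \<open>g \<xi> < 1/(2n)\<close> isolate \<open>\<sigma> (\<xi> + 1)\<close>.\<close>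

lemma block_averages_discrete:
  assumes fin: "\<And>\<xi> :: w1. finite (E \<xi>)" and card: "\<And>\<xi>. card (E \<xi>) = n" and n: "n > 0"
    and order: "\<And>\<zeta> \<xi> \<beta> \<alpha>. \<zeta> < \<xi> \<Longrightarrow> \<beta> \<in> E \<zeta> \<Longrightarrow> \<alpha> \<in> E \<xi> \<Longrightarrow> \<beta> < \<alpha>"
    and linked: "\<And>\<zeta> \<xi>. \<zeta> < \<xi> \<Longrightarrow> \<exists>\<beta>\<in>E \<zeta>. \<exists>\<alpha>\<in>E \<xi>. bad \<beta> \<alpha>"
  shows "\<exists>D \<subseteq> (states :: ('a \<Rightarrow>\<^sub>L complex) set). uncountable D \<and> weak_star_discrete D"
proof -
  have ne: "E \<xi> \<noteq> {}" for \<xi> using card[of \<xi>] n by auto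
  define \<sigma> where "\<sigma> \<xi> = average_state \<tau> (E \<xi>)" for \<xi>
  define g where "g \<xi> = (\<Sum>\<alpha>\<in>E \<xi>. a \<alpha>)" for \<xi>
  have \<sigma>: "\<sigma> \<xi> \<in> states" for \<xi>
    unfolding \<sigma>_def by (rule average_state[OF fin ne state])
  have Re_g: "Re (blinfun_apply (\<tau> \<beta>) (g \<xi>)) = (\<Sum>\<alpha>\<in>E \<xi>. Re (blinfun_apply (\<tau> \<beta>) (a \<alpha>)))" for \<beta> \<xi>
    unfolding g_def by (simp add: blinfun.sum_right)
  have Re_g_nonneg: "0 \<le> Re (blinfun_apply (\<tau> \<beta>) (g \<xi>))" for \<beta> \<xi>
    unfolding Re_g by (intro sum_nonneg nonneg')
  let ?\<epsilon> = "1 / 2 / real n"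
  have \<epsilon>: "0 < ?\<epsilon>" using n by simp
  have zero: "Re (blinfun_apply (\<sigma> \<xi>) (g \<zeta>)) = 0" if "\<zeta> < \<xi>" for \<zeta> \<xi>
    unfolding \<sigma>_def Re_average_state Re_g using lower order[OF that] by simp
  have big: "?\<epsilon> \<le> Re (blinfun_apply (\<sigma> \<zeta>) (g \<xi>))" if "\<zeta> \<le> \<xi>" for \<zeta> \<xi>
  proof -
    have "\<exists>\<beta>\<in>E \<zeta>. \<exists>\<alpha>\<in>E \<xi>. bad \<beta> \<alpha>"
    proof (cases "\<zeta> = \<xi>")
      case True
      obtain \<alpha> where "\<alpha> \<in> E \<xi>" using ne by blast
      moreover have "bad \<alpha> \<alpha>" unfolding bad_def diag by simp
      ultimately show ?thesis unfolding True by blast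
    next
      case False
      then show ?thesis using linked that by simp
    qed
    then obtain \<beta> \<alpha> where \<beta>\<alpha>: "\<beta> \<in> E \<zeta>" "\<alpha> \<in> E \<xi>" "bad \<beta> \<alpha>" by blast
    have "1 / 2 \<le> Re (blinfun_apply (\<tau> \<beta>) (a \<alpha>))" using \<beta>\<alpha>(3) unfolding bad_def .
    also have "\<dots> \<le> Re (blinfun_apply (\<tau> \<beta>) (g \<xi>))"
      unfolding Re_g by (rule member_le_sum[OF \<beta>\<alpha>(2)]) (simp_all add: nonneg' fin)
    finally show ?thesis
      using Re_average_state_ge[of "E \<zeta>" \<tau> "g \<xi>" \<beta> "1 / 2", OF fin Re_g_nonneg \<beta>\<alpha>(1)] card
      unfolding \<sigma>_def by simp
  qed
  obtain s :: "w1 \<Rightarrow> w1" where s: "\<And>\<xi>. \<xi> < s \<xi>" "\<And>\<zeta> \<xi>. \<zeta> < \<xi> \<Longrightarrow> s \<zeta> \<le> \<xi>"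
    using successor_w1 by metis
  have cd: "\<sigma> (s \<xi>) \<in> cdual" for \<xi>
    using \<sigma> states_iff positive_functionalD(1) by blast
  have iso: "\<exists>V. openin weak_star_topology V \<and> \<sigma> (s \<xi>) \<in> V \<and> (\<forall>\<zeta>\<in>UNIV. \<zeta> \<noteq> \<xi> \<longrightarrow> \<sigma> (s \<zeta>) \<notin> V)" for \<xi>
  proof (intro exI conjI ballI impI)
    let ?V = "{\<sigma> \<in> cdual. Re (blinfun_apply \<sigma> (g (s \<xi>))) \<in> {0<..}} \<inter>
      {\<sigma> \<in> cdual. Re (blinfun_apply \<sigma> (g \<xi>)) \<in> {..<?\<epsilon>}}"
    show "openin weak_star_topology ?V" by (intro openin_Int openin_weak_star_Re) simp_all
    have "0 < Re (blinfun_apply (\<sigma> (s \<xi>)) (g (s \<xi>)))"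
      by (rule less_le_trans[OF \<epsilon> big]) simp
    then show "\<sigma> (s \<xi>) \<in> ?V" using cd zero[OF s(1)] \<epsilon> by simp
    fix \<zeta> assume "\<zeta> \<noteq> \<xi>"
    then consider "\<zeta> < \<xi>" | "\<xi> < \<zeta>" by fastforce
    then show "\<sigma> (s \<zeta>) \<notin> ?V"
    proof cases
      case 1
      then show ?thesis using big[OF s(2)[OF 1]] by simp
    next
      case 2
      then have "s \<xi> < s \<zeta>" using s by (meson le_less_trans)
      then show ?thesis using zero by simp
    qed
  qed
  have "uncountable (range (\<lambda>\<xi>. \<sigma> (s \<xi>)))" "weak_star_discrete (range (\<lambda>\<xi>. \<sigma> (s \<xi>)))"
    by (rule weak_star_discrete_family[OF cd uncountable_UNIV_w1 iso])+
  then show ?thesis using \<sigma> by (intro exI[of _ "range (\<lambda>\<xi>. \<sigma> (s \<xi>))"]) auto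
qed

theorem discrete_states:
  assumes "Martins_Axiom"
  shows "\<exists>D \<subseteq> (states :: ('a \<Rightarrow>\<^sub>L complex) set). uncountable D \<and> weak_star_discrete D"
proof (rule Martins_Axiom_dichotomy[OF assms, of bad])
  fix T assume "uncountable T" "free_of bad T"
  from free_set_discrete[OF this] show ?thesis
    using state by (intro exI[of _ "\<tau> ` T"]) auto
next
  fix E :: "w1 \<Rightarrow> w1 set" and n
  assume "\<And>\<xi>. finite (E \<xi>)" "\<And>\<xi>. card (E \<xi>) = n" "n > 0"
    "\<And>\<zeta> \<xi> \<beta> \<alpha>. \<zeta> < \<xi> \<Longrightarrow> \<beta> \<in> E \<zeta> \<Longrightarrow> \<alpha> \<in> E \<xi> \<Longrightarrow> \<beta> < \<alpha>"
    "\<And>\<zeta> \<xi>. \<zeta> < \<xi> \<Longrightarrow> \<exists>\<beta>\<in>E \<zeta>. \<exists>\<alpha>\<in>E \<xi>. bad \<beta> \<alpha>"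
  then show ?thesis by (rule block_averages_discrete)
qed

text \<open>If no initial segment of \<open>B\<close> is dense in \<open>B\<close>, there are points \<open>\<beta> \<delta>\<close> in \<open>B\<close> with neighbourhoods, given by \<open>A \<delta>\<close>, that
  omit all points of \<open>B\<close> below \<open>\<delta>\<close>. Along a sparse set of \<open>\<delta>\<close> these neighbourhoods omit the earlier chosen points, and
  \<open>a (\<beta> \<delta>)\<close> vanishes at the later ones.\<close>

lemma left_separated_discrete:
  assumes "\<And>\<delta>. finite (A \<delta>)" "\<And>\<delta>. \<beta> \<delta> \<in> B" "\<And>\<delta> \<alpha>. \<alpha> \<in> A \<delta> \<Longrightarrow> \<not> bad (\<beta> \<delta>) \<alpha>"
    and sep: "\<And>\<delta> \<gamma>. \<gamma> \<in> B \<Longrightarrow> \<gamma> < \<delta> \<Longrightarrow> \<exists>\<alpha>\<in>A \<delta>. bad \<gamma> \<alpha>"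
  shows "\<exists>D \<subseteq> (pure_states :: ('a \<Rightarrow>\<^sub>L complex) set). uncountable D \<and> weak_star_discrete D"
proof -
  obtain f :: "w1 \<Rightarrow> w1" where f: "strict_mono f" "\<And>\<zeta> \<xi>. \<zeta> < \<xi> \<Longrightarrow> \<beta> (f \<zeta>) < f \<xi>"
    using spaced_enumeration[OF uncountable_UNIV_w1] by metis
  have ge: "\<delta> \<le> \<beta> \<delta>" for \<delta>
    using sep[OF assms(2), of \<delta>] assms(3) by (meson not_le)
  define t where "t \<xi> = \<tau> (\<beta> (f \<xi>))" for \<xi>
  have cd: "t \<xi> \<in> cdual" for \<xi> unfolding t_def by (rule in_cdual)
  have iso: "\<exists>V. openin weak_star_topology V \<and> t \<xi> \<in> V \<and> (\<forall>\<zeta>\<in>UNIV. \<zeta> \<noteq> \<xi> \<longrightarrow> t \<zeta> \<notin> V)" for \<xi>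
  proof (intro exI conjI ballI impI)
    let ?V = "{\<sigma> \<in> cdual. Re (blinfun_apply \<sigma> (a (\<beta> (f \<xi>)))) \<in> {1 / 2<..}} \<inter>
      \<Inter>(insert (topspace weak_star_topology)
        ((\<lambda>\<alpha>. {\<sigma> \<in> cdual. Re (blinfun_apply \<sigma> (a \<alpha>)) \<in> {..<1 / 2}}) ` A (f \<xi>)))"
    have "openin weak_star_topology W"
      if "W \<in> insert (topspace weak_star_topology)
        ((\<lambda>\<alpha>. {\<sigma> \<in> cdual. Re (blinfun_apply \<sigma> (a \<alpha>)) \<in> {..<1 / 2}}) ` A (f \<xi>))" for W
      using that by (elim insertE imageE) (simp_all only: openin_topspace openin_weak_star_Re open_lessThan)
    then show "openin weak_star_topology ?V"
      by (intro openin_Int openin_Inter openin_weak_star_Re) (simp_all only: open_greaterThan finite_insert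
          finite_imageI assms(1) insert_not_empty not_False_eq_True)
    show "t \<xi> \<in> ?V"
      using cd[of \<xi>] diag assms(3)[of _ "f \<xi>"] unfolding t_def bad_def topspace_weak_star
      by (auto simp: not_le)
    fix \<zeta> assume "\<zeta> \<noteq> \<xi>"
    then consider "\<zeta> < \<xi>" | "\<xi> < \<zeta>" by fastforce
    then show "t \<zeta> \<notin> ?V"
    proof cases
      case 1
      then obtain \<alpha> where "\<alpha> \<in> A (f \<xi>)" "bad (\<beta> (f \<zeta>)) \<alpha>"
        using sep[OF assms(2) f(2)] by meson
      then show ?thesis unfolding t_def bad_def by (auto simp: not_less)
    next
      case 2
      then have "\<beta> (f \<xi>) < \<beta> (f \<zeta>)" using f(2) ge by (meson less_le_trans)
      then show ?thesis unfolding t_def using lower by simp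
    qed
  qed
  have "uncountable (range t)" "weak_star_discrete (range t)"
    by (rule weak_star_discrete_family[OF cd uncountable_UNIV_w1 iso])+
  moreover have "range t \<subseteq> pure_states" using pure unfolding t_def by blast
  ultimately show ?thesis by (intro exI[of _ "range t"]) simp
qed

text \<open>Either each set of indices has a countable dense subset, and forcing yields an uncountable free set,
  or some set of indices has none and carries a left-separated sequence.\<close>

theorem discrete_pure_states:
  assumes PFA: "Proper_Forcing_Axiom"
  shows "\<exists>D \<subseteq> (pure_states :: ('a \<Rightarrow>\<^sub>L complex) set). uncountable D \<and> weak_star_discrete D"
proof -
  define dense_at where "dense_at B \<delta> \<longleftrightarrow> (\<forall>A \<beta>. finite A \<and> \<beta> \<in> B \<and> (\<forall>\<alpha>\<in>A. \<not> bad \<beta> \<alpha>) \<longrightarrow>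
      (\<exists>\<gamma>\<in>B. \<gamma> < \<delta> \<and> (\<forall>\<alpha>\<in>A. \<not> bad \<gamma> \<alpha>)))" for B \<delta>
  show ?thesis
  proof (cases "\<forall>B. \<exists>\<delta>. dense_at B \<delta>")
    case True
    then obtain \<delta> where \<delta>: "\<And>B. dense_at B (\<delta> B)" by metis
    interpret separable_relation bad "\<lambda>B. {\<gamma> \<in> B. \<gamma> < \<delta> B}"
    proof
      show "\<beta> \<le> \<alpha>" if "bad \<beta> \<alpha>" for \<beta> \<alpha> using bad_le[OF that] .
      show "countable {\<gamma> \<in> B. \<gamma> < \<delta> B}" for B
        by (rule countable_subset[OF _ countable_lessThan_w1[of "\<delta> B"]]) auto
      show "{\<gamma> \<in> B. \<gamma> < \<delta> B} \<subseteq> B" for B by blast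
      show "\<exists>\<gamma>\<in>{\<gamma> \<in> B. \<gamma> < \<delta> B}. \<forall>\<alpha>\<in>A. \<not> bad \<gamma> \<alpha>"
        if "finite A" "\<beta> \<in> B" "\<forall>\<alpha>\<in>A. \<not> bad \<beta> \<alpha>" for A \<beta> B
      proof -
        have "\<exists>\<gamma>\<in>B. \<gamma> < \<delta> B \<and> (\<forall>\<alpha>\<in>A. \<not> bad \<gamma> \<alpha>)"
          using \<delta>[of B, unfolded dense_at_def, rule_format, of A \<beta>] that by simp
        then show ?thesis by auto
      qed
    qed
    obtain j :: "condition \<Rightarrow> forcing_universe" where "inj j"
      using condition_embeds_in_universe ..
    then obtain T where "uncountable T" "free_of bad T"
      by (rule uncountable_free_set[OF PFA])
    from free_set_discrete[OF this] show ?thesis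
      using pure by (intro exI[of _ "\<tau> ` T"]) auto
  next
    case False
    then obtain B where "\<forall>\<delta>. \<not> dense_at B \<delta>" by blast
    then have "\<forall>\<delta>. \<exists>A \<beta>. finite A \<and> \<beta> \<in> B \<and> (\<forall>\<alpha>\<in>A. \<not> bad \<beta> \<alpha>) \<and>
        (\<forall>\<gamma>\<in>B. \<gamma> < \<delta> \<longrightarrow> (\<exists>\<alpha>\<in>A. bad \<gamma> \<alpha>))"
      unfolding dense_at_def by (simp only: not_all not_imp) metis
    then obtain A \<beta> where "\<And>\<delta>. finite (A \<delta>) \<and> \<beta> \<delta> \<in> B \<and> (\<forall>\<alpha>\<in>A \<delta>. \<not> bad (\<beta> \<delta>) \<alpha>) \<and>
        (\<forall>\<gamma>\<in>B. \<gamma> < \<delta> \<longrightarrow> (\<exists>\<alpha>\<in>A \<delta>. bad \<gamma> \<alpha>))"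
      by metis
    then show ?thesis by (intro left_separated_discrete[of A \<beta> B]) simp_all
  qed
qed

text \<open>On a free set take \<open>w \<alpha>\<close> to be a small multiple of \<open>a \<alpha> - 1\<close>. It vanishes at \<open>\<tau> \<alpha>\<close>, and the other states
  give \<open>a \<alpha>\<close> a value of at most \<open>1/2\<close>.\<close>

lemma free_set_UBABS_plus:
  assumes comm: "\<And>x y :: 'a. x * y = y * x" and K: "\<And>\<alpha>. norm (a \<alpha>) \<le> K"
    and T: "uncountable T" "free_of bad T"
  shows "\<exists>\<eta> (b :: nat set \<Rightarrow> 'a) \<sigma>. 0 \<le> \<eta> \<and> \<eta> < 1 \<and> UBABS_plus \<eta> b \<sigma>"
proof -
  obtain f :: "w1 \<Rightarrow> w1" where f: "strict_mono f" "range f \<subseteq> T"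
    using spaced_enumeration[OF T(1)] by metis
  have K0: "0 \<le> K" using K norm_ge_zero order_trans by blast
  define c where "c = 1 / (K + 2)"
  have c: "0 < c" unfolding c_def using K0 by simp
  define w where "w \<xi> = c *\<^sub>R (a (f \<xi>) - 1)" for \<xi>
  have val: "blinfun_apply (\<tau> (f \<zeta>)) (star (w \<xi>) * w \<xi>) = of_real (c\<^sup>2 * (Re (blinfun_apply (\<tau> (f \<zeta>)) (a (f \<xi>))) - 1)\<^sup>2)" for \<zeta> \<xi>
  proof -
    have "blinfun_apply (\<tau> (f \<zeta>)) 1 = 1" using state states_iff by blast
    moreover have "blinfun_apply (\<tau> (f \<zeta>)) (a (f \<xi>)) = of_real (Re (blinfun_apply (\<tau> (f \<zeta>)) (a (f \<xi>))))"
      using nonneg'(2) by (simp add: complex_eq_iff)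
    ultimately have "blinfun_apply (\<tau> (f \<zeta>)) (w \<xi>) = of_real (c * (Re (blinfun_apply (\<tau> (f \<zeta>)) (a (f \<xi>))) - 1))"
      unfolding w_def blinfun.scaleR_right blinfun.diff_right
      by (simp only: scaleR_conv_of_real of_real_mult of_real_diff of_real_1)
    then have "cmod (blinfun_apply (\<tau> (f \<zeta>)) (w \<xi>)) = \<bar>c * (Re (blinfun_apply (\<tau> (f \<zeta>)) (a (f \<xi>))) - 1)\<bar>"
      by (simp only: norm_of_real)
    then have "(cmod (blinfun_apply (\<tau> (f \<zeta>)) (w \<xi>)))\<^sup>2 = c\<^sup>2 * (Re (blinfun_apply (\<tau> (f \<zeta>)) (a (f \<xi>))) - 1)\<^sup>2"
      by (simp only: power2_abs power_mult_distrib)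
    then show ?thesis unfolding pure_state_star_mult[OF comm pure] by (simp only:)
  qed
  show ?thesis
  proof (rule UBABS_plus_from_vanishing[of "\<lambda>\<xi>. \<tau> (f \<xi>)" w "c\<^sup>2 / 4"])
    show "\<tau> (f \<xi>) \<in> states" for \<xi> by (rule state)
    show "norm (w \<xi>) < 1" for \<xi>
    proof -
      have "norm (a (f \<xi>) - 1) \<le> K + 1"
        using norm_triangle_ineq4[of "a (f \<xi>)" 1] K[of "f \<xi>"] by simp
      also have "\<dots> < K + 2" by simp
      finally have "c * norm (a (f \<xi>) - 1) < c * (K + 2)" using c by simp
      then show ?thesis unfolding w_def using c K0 by (simp add: c_def)
    qed
    show "blinfun_apply (\<tau> (f \<xi>)) (star (w \<xi>) * w \<xi>) = 0" for \<xi> unfolding val by (simp add: diag)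
    show "0 < c\<^sup>2 / 4" using c by simp
    fix \<xi> \<eta> :: w1 assume "\<eta> \<noteq> \<xi>"
    have "Re (blinfun_apply (\<tau> (f \<xi>)) (a (f \<eta>))) \<le> 1 / 2"
    proof (cases "\<eta> < \<xi>")
      case True
      then show ?thesis using lower f(1) by (simp add: strict_mono_less)
    next
      case False
      then have "f \<xi> < f \<eta>" using \<open>\<eta> \<noteq> \<xi>\<close> f(1) by (simp add: strict_mono_less)
      then have "\<not> bad (f \<xi>) (f \<eta>)" using T(2) f(2) unfolding free_of_def by blast
      then show ?thesis unfolding bad_def by simp
    qed
    then have "(1 / 2)\<^sup>2 \<le> (1 - Re (blinfun_apply (\<tau> (f \<xi>)) (a (f \<eta>))))\<^sup>2"
      by (intro power_mono) simp_all
    then have "1 / 4 \<le> (Re (blinfun_apply (\<tau> (f \<xi>)) (a (f \<eta>))) - 1)\<^sup>2"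
      by (subst power2_commute) (simp add: power2_eq_square)
    from mult_left_mono[OF this, of "c\<^sup>2"]
    show "c\<^sup>2 / 4 \<le> Re (blinfun_apply (\<tau> (f \<xi>)) (star (w \<eta>) * w \<eta>))" unfolding val by simp
  qed
qed

lemma norm_prod_list_le:
  fixes xs :: "'b :: real_normed_algebra_1 list"
  assumes "\<And>x. x \<in> set xs \<Longrightarrow> norm x \<le> K" "0 \<le> K"
  shows "norm (prod_list xs) \<le> K ^ length xs"
  using assms(1)
proof (induction xs)
  case (Cons x xs)
  have "norm (x * prod_list xs) \<le> norm x * norm (prod_list xs)" by (rule norm_mult_ineq)
  also have "\<dots> \<le> K * K ^ length xs" using Cons assms(2) by (intro mult_mono) auto
  finally show ?case by simp
qed simp

text \<open>The state with index \<open>\<xi>\<close> is the average over the block \<open>E (\<xi> + 1)\<close>, and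
  \<open>w \<xi> = c (total \<xi> + i shifted (\<xi> + 1))\<close>, where \<open>total \<xi>\<close> is the sum of the \<open>a \<alpha>\<close> over \<open>E \<xi>\<close> and \<open>shifted (\<xi> + 1)\<close>
  is the product of the \<open>a \<alpha> - 1\<close> over \<open>E (\<xi> + 1)\<close>. At the states of \<open>E (\<xi> + 1)\<close> the sum vanishes since its
  elements come earlier, and the product has a vanishing factor. At one state, at least, of each block up
  to \<open>\<xi>\<close> the sum is at least \<open>1/2\<close>, by a bad pair or a diagonal value, and at the states of the blocks beyond \<open>\<xi> + 1\<close> the product is
  \<open>1\<close> or \<open>-1\<close>. As all values are real, \<open>w* w\<close> adds up the squares of the two parts.\<close>

lemma blocks_UBABS_plus:
  assumes comm: "\<And>x y :: 'a. x * y = y * x" and K: "\<And>\<alpha>. norm (a \<alpha>) \<le> K"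
    and fin: "\<And>\<xi> :: w1. finite (E \<xi>)" and card: "\<And>\<xi>. card (E \<xi>) = n" and n: "n > 0"
    and order: "\<And>\<zeta> \<xi> \<beta> \<alpha>. \<zeta> < \<xi> \<Longrightarrow> \<beta> \<in> E \<zeta> \<Longrightarrow> \<alpha> \<in> E \<xi> \<Longrightarrow> \<beta> < \<alpha>"
    and linked: "\<And>\<zeta> \<xi>. \<zeta> < \<xi> \<Longrightarrow> \<exists>\<beta>\<in>E \<zeta>. \<exists>\<alpha>\<in>E \<xi>. bad \<beta> \<alpha>"
  shows "\<exists>\<eta> (b :: nat set \<Rightarrow> 'a) \<sigma>. 0 \<le> \<eta> \<and> \<eta> < 1 \<and> UBABS_plus \<eta> b \<sigma>"
proof -
  have ne: "E \<xi> \<noteq> {}" for \<xi> using card[of \<xi>] n by auto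
  obtain s :: "w1 \<Rightarrow> w1" where s: "\<And>\<xi>. \<xi> < s \<xi>" "\<And>\<zeta> \<xi>. \<zeta> < \<xi> \<Longrightarrow> s \<zeta> \<le> \<xi>"
    using successor_w1 by metis
  have K0: "0 \<le> K" using K norm_ge_zero order_trans by blast
  \<comment> \<open>\<open>L\<close> bounds the norm of \<open>total \<xi> + i shifted (\<xi> + 1)\<close>, so that \<open>c = 1 / (L + 1)\<close> makes \<open>norm (w \<xi>) < 1\<close>.\<close>
  define L where "L = real n * K + (K + 1) ^ n"
  have L0: "0 \<le> L" unfolding L_def using K0 by simp
  define c where "c = 1 / (L + 1)"
  have c: "0 < c" unfolding c_def using L0 by simp
  define total where "total \<xi> = (\<Sum>\<alpha>\<in>E \<xi>. a \<alpha>)" for \<xi>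
  define shifted where "shifted \<xi> = prod_list (map (\<lambda>\<alpha>. a \<alpha> - 1) (sorted_list_of_set (E \<xi>)))" for \<xi>
  define w where "w \<xi> = c *\<^sub>R (total \<xi> + \<i> *\<^sub>C shifted (s \<xi>))" for \<xi>
  define r where "r \<beta> \<alpha> = Re (blinfun_apply (\<tau> \<beta>) (a \<alpha>))" for \<beta> \<alpha>
  have r: "blinfun_apply (\<tau> \<beta>) (a \<alpha>) = of_real (r \<beta> \<alpha>)" for \<alpha> \<beta>
    unfolding r_def using nonneg'(2) by (simp add: complex_eq_iff)
  have r0: "0 \<le> r \<beta> \<alpha>" for \<alpha> \<beta> unfolding r_def by (rule nonneg')
  have len: "length (sorted_list_of_set (E \<xi>)) = n" for \<xi> using card by simp
  have nw: "norm (w \<xi>) < 1" for \<xi>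
  proof -
    have "norm (total \<xi>) \<le> real n * K"
      unfolding total_def using sum_norm_bound[of "E \<xi>" a K] K card by simp
    moreover have "norm (\<i> *\<^sub>C shifted (s \<xi>)) \<le> (K + 1) ^ n"
    proof -
      have b: "norm (a \<alpha> - 1) \<le> K + 1" for \<alpha>
        using norm_triangle_ineq4[of "a \<alpha>" 1] K[of \<alpha>] by simp
      have "norm (shifted (s \<xi>)) \<le> (K + 1) ^ length (map (\<lambda>\<alpha>. a \<alpha> - 1) (sorted_list_of_set (E (s \<xi>))))"
        unfolding shifted_def by (rule norm_prod_list_le) (use b K0 in auto)
      then show ?thesis by (simp add: norm_scaleC len card)
    qed
    ultimately have "norm (total \<xi> + \<i> *\<^sub>C shifted (s \<xi>)) < L + 1"
      unfolding L_def using norm_triangle_ineq[of "total \<xi>" "\<i> *\<^sub>C shifted (s \<xi>)"] by linarith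
    then have "c * norm (total \<xi> + \<i> *\<^sub>C shifted (s \<xi>)) < c * (L + 1)" using c by simp
    then show ?thesis unfolding w_def using c L0 by (simp add: c_def)
  qed
  have val: "blinfun_apply (\<tau> \<beta>) (star (w \<xi>) * w \<xi>) =
      of_real (c\<^sup>2 * ((\<Sum>\<alpha>\<in>E \<xi>. r \<beta> \<alpha>)\<^sup>2 + (\<Prod>\<alpha>\<in>E (s \<xi>). r \<beta> \<alpha> - 1)\<^sup>2))" for \<beta> \<xi>
  proof -
    have one: "blinfun_apply (\<tau> \<beta>) 1 = 1" using state states_iff by blast
    have "blinfun_apply (\<tau> \<beta>) (total \<xi>) = of_real (\<Sum>\<alpha>\<in>E \<xi>. r \<beta> \<alpha>)"
      unfolding total_def by (simp add: blinfun.sum_right r)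
    moreover have "blinfun_apply (\<tau> \<beta>) (shifted (s \<xi>)) = of_real (\<Prod>\<alpha>\<in>E (s \<xi>). r \<beta> \<alpha> - 1)"
    proof -
      have "blinfun_apply (\<tau> \<beta>) (shifted (s \<xi>)) =
          prod_list (map (\<lambda>\<alpha>. of_real (r \<beta> \<alpha> - 1)) (sorted_list_of_set (E (s \<xi>))))"
        unfolding shifted_def pure_state_prod_list[OF comm pure] map_map comp_def
        by (simp add: blinfun.diff_right r one)
      also have "\<dots> = (\<Prod>\<alpha>\<in>E (s \<xi>). of_real (r \<beta> \<alpha> - 1))"
        using prod.distinct_set_conv_list[of "sorted_list_of_set (E (s \<xi>))"
            "\<lambda>\<alpha>. complex_of_real (r \<beta> \<alpha> - 1)"] fin by simp
      finally show ?thesis by simp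
    qed
    ultimately have "blinfun_apply (\<tau> \<beta>) (w \<xi>) =
        of_real c * Complex (\<Sum>\<alpha>\<in>E \<xi>. r \<beta> \<alpha>) (\<Prod>\<alpha>\<in>E (s \<xi>). r \<beta> \<alpha> - 1)"
      unfolding w_def blinfun.scaleR_right blinfun.add_right cdual_scaleC[OF in_cdual]
      by (simp add: scaleR_conv_of_real Complex_eq del: of_real_sum of_real_prod)
    then have "(cmod (blinfun_apply (\<tau> \<beta>) (w \<xi>)))\<^sup>2 =
        c\<^sup>2 * ((\<Sum>\<alpha>\<in>E \<xi>. r \<beta> \<alpha>)\<^sup>2 + (\<Prod>\<alpha>\<in>E (s \<xi>). r \<beta> \<alpha> - 1)\<^sup>2)"
      by (simp add: norm_mult power_mult_distrib cmod_power2)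
    then show ?thesis unfolding pure_state_star_mult[OF comm pure] by (simp only:)
  qed
  have Re_val: "Re (blinfun_apply (\<tau> \<beta>) (star (w \<xi>) * w \<xi>)) =
      c\<^sup>2 * ((\<Sum>\<alpha>\<in>E \<xi>. r \<beta> \<alpha>)\<^sup>2 + (\<Prod>\<alpha>\<in>E (s \<xi>). r \<beta> \<alpha> - 1)\<^sup>2)" for \<beta> \<xi>
    unfolding val by (rule Re_complex_of_real)
  have Re_nonneg: "0 \<le> Re (blinfun_apply (\<tau> \<beta>) (star (w \<xi>) * w \<xi>))" for \<beta> \<xi>
    unfolding Re_val by simp
  define \<sigma> where "\<sigma> \<xi> = average_state \<tau> (E (s \<xi>))" for \<xi>
  show ?thesis
  proof (rule UBABS_plus_from_vanishing[of \<sigma> w "c\<^sup>2 / 4 / real n"])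
    show "\<sigma> \<xi> \<in> states" for \<xi>
      unfolding \<sigma>_def by (rule average_state[OF fin ne state])
    show "norm (w \<xi>) < 1" for \<xi> by (rule nw)
    show "0 < c\<^sup>2 / 4 / real n" using c n by simp
    show "blinfun_apply (\<sigma> \<xi>) (star (w \<xi>) * w \<xi>) = 0" for \<xi>
    proof -
      have "blinfun_apply (\<tau> \<beta>) (star (w \<xi>) * w \<xi>) = 0" if \<beta>: "\<beta> \<in> E (s \<xi>)" for \<beta>
      proof -
        have "r \<beta> \<alpha> = 0" if "\<alpha> \<in> E \<xi>" for \<alpha>
          unfolding r_def using lower[OF order[OF s(1) that \<beta>]] by simp
        moreover have "r \<beta> \<beta> - 1 = 0" unfolding r_def diag by simp
        then have "(\<Prod>\<alpha>\<in>E (s \<xi>). r \<beta> \<alpha> - 1) = 0" using \<beta> fin by (intro prod_zero bexI[of _ \<beta>])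
        ultimately show ?thesis unfolding val by simp
      qed
      then show ?thesis
        unfolding \<sigma>_def average_state_def by (simp add: blinfun.scaleR_left blinfun.sum_left)
    qed
    fix \<xi> \<eta> :: w1 assume "\<eta> \<noteq> \<xi>"
    have "\<exists>\<beta>\<in>E (s \<xi>). c\<^sup>2 / 4 \<le> Re (blinfun_apply (\<tau> \<beta>) (star (w \<eta>) * w \<eta>))"
    proof (cases "\<xi> < \<eta>")
      case True
      have "\<exists>\<beta>\<in>E (s \<xi>). \<exists>\<alpha>\<in>E \<eta>. bad \<beta> \<alpha>"
      proof (cases "s \<xi> = \<eta>")
        case eq: True
        obtain \<alpha> where "\<alpha> \<in> E \<eta>" using ne by blast
        moreover have "bad \<alpha> \<alpha>" unfolding bad_def diag by simp
        ultimately show ?thesis unfolding eq by blast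
      next
        case False
        then show ?thesis using linked s(2)[OF True] by simp
      qed
      then obtain \<beta> \<alpha> where \<beta>\<alpha>: "\<beta> \<in> E (s \<xi>)" "\<alpha> \<in> E \<eta>" "bad \<beta> \<alpha>" by blast
      have "1 / 2 \<le> r \<beta> \<alpha>" using \<beta>\<alpha>(3) unfolding bad_def r_def .
      also have "\<dots> \<le> (\<Sum>\<alpha>\<in>E \<eta>. r \<beta> \<alpha>)"
        by (rule member_le_sum[OF \<beta>\<alpha>(2)]) (simp_all add: r0 fin)
      finally have half: "(1 / 2)\<^sup>2 \<le> (\<Sum>\<alpha>\<in>E \<eta>. r \<beta> \<alpha>)\<^sup>2" by (intro power_mono) simp_all
      then have "1 / 4 \<le> (\<Sum>\<alpha>\<in>E \<eta>. r \<beta> \<alpha>)\<^sup>2 + (\<Prod>\<alpha>\<in>E (s \<eta>). r \<beta> \<alpha> - 1)\<^sup>2"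
        using add_mono[OF half zero_le_power2[of "\<Prod>\<alpha>\<in>E (s \<eta>). r \<beta> \<alpha> - 1"]]
        by (simp add: power_divide)
      from mult_left_mono[OF this, of "c\<^sup>2"] \<beta>\<alpha>(1)
      show ?thesis unfolding Re_val by (intro bexI[of _ \<beta>]) simp_all
    next
      case False
      then have "\<eta> < \<xi>" using \<open>\<eta> \<noteq> \<xi>\<close> by auto
      then have "s \<eta> < s \<xi>" using s by (meson le_less_trans)
      obtain \<beta> where \<beta>: "\<beta> \<in> E (s \<xi>)" using ne by blast
      have "r \<beta> \<alpha> = 0" if "\<alpha> \<in> E (s \<eta>)" for \<alpha>
        unfolding r_def using lower[OF order[OF \<open>s \<eta> < s \<xi>\<close> that \<beta>]] by simp
      then have "(\<Prod>\<alpha>\<in>E (s \<eta>). r \<beta> \<alpha> - 1)\<^sup>2 = 1"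
        by (simp add: power_mult[symmetric])
      then have "1 / 4 \<le> (\<Sum>\<alpha>\<in>E \<eta>. r \<beta> \<alpha>)\<^sup>2 + (\<Prod>\<alpha>\<in>E (s \<eta>). r \<beta> \<alpha> - 1)\<^sup>2"
        using zero_le_power2[of "\<Sum>\<alpha>\<in>E \<eta>. r \<beta> \<alpha>"] by linarith
      from mult_left_mono[OF this, of "c\<^sup>2"] \<beta>
      show ?thesis unfolding Re_val by (intro bexI[of _ \<beta>]) simp_all
    qed
    then obtain \<beta> where "\<beta> \<in> E (s \<xi>)" "c\<^sup>2 / 4 \<le> Re (blinfun_apply (\<tau> \<beta>) (star (w \<eta>) * w \<eta>))" by blast
    from Re_average_state_ge[of "E (s \<xi>)" \<tau>, OF fin Re_nonneg this]
    show "c\<^sup>2 / 4 / real n \<le> Re (blinfun_apply (\<sigma> \<xi>) (star (w \<eta>) * w \<eta>))"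
      unfolding \<sigma>_def card .
  qed
qed

lemma bounded_UBABS_plus:
  assumes "Martins_Axiom" and comm: "\<And>x y :: 'a. x * y = y * x" and K: "\<And>\<alpha>. norm (a \<alpha>) \<le> K"
  shows "\<exists>\<eta> (b :: nat set \<Rightarrow> 'a) \<sigma>. 0 \<le> \<eta> \<and> \<eta> < 1 \<and> UBABS_plus \<eta> b \<sigma>"
proof (rule Martins_Axiom_dichotomy[OF assms(1), of bad])
  fix T assume "uncountable T" "free_of bad T"
  then show ?thesis by (rule free_set_UBABS_plus[OF comm K])
next
  fix E :: "w1 \<Rightarrow> w1 set" and n
  assume "\<And>\<xi>. finite (E \<xi>)" "\<And>\<xi>. card (E \<xi>) = n" "n > 0"
    "\<And>\<zeta> \<xi> \<beta> \<alpha>. \<zeta> < \<xi> \<Longrightarrow> \<beta> \<in> E \<zeta> \<Longrightarrow> \<alpha> \<in> E \<xi> \<Longrightarrow> \<beta> < \<alpha>"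
    "\<And>\<zeta> \<xi>. \<zeta> < \<xi> \<Longrightarrow> \<exists>\<beta>\<in>E \<zeta>. \<exists>\<alpha>\<in>E \<xi>. bad \<beta> \<alpha>"
  then show ?thesis by (rule blocks_UBABS_plus[OF comm K])
qed

text \<open>Uncountably many of the \<open>a \<alpha>\<close> have norms below a common bound, so the system can be thinned out to a
  bounded one.\<close>

theorem UBABS_plus:
  assumes "Martins_Axiom" and comm: "\<And>x y :: 'a. x * y = y * x"
  shows "\<exists>\<eta> (b :: nat set \<Rightarrow> 'a) \<sigma>. 0 \<le> \<eta> \<and> \<eta> < 1 \<and> UBABS_plus \<eta> b \<sigma>"
proof -
  have "UNIV = (\<Union>k::nat. {\<alpha>. norm (a \<alpha>) \<le> real k})"
    using real_arch_simple by auto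
  then obtain k :: nat where "uncountable {\<alpha>. norm (a \<alpha>) \<le> real k}"
    using uncountable_UNIV_w1 by (metis countable_UN countableI_type)
  then obtain f :: "w1 \<Rightarrow> w1" where f: "strict_mono f" "range f \<subseteq> {\<alpha>. norm (a \<alpha>) \<le> real k}"
    using spaced_enumeration by metis
  show ?thesis
  proof (rule pure_system.bounded_UBABS_plus[OF reindex[OF f(1)] assms])
    show "norm ((a \<circ> f) \<alpha>) \<le> real k" for \<alpha> using f(2) by auto
  qed
qed

end

theorem theorem1p7:
  fixes r :: "'i rel"
    and a :: "'i \<Rightarrow> 'a::unital_cstar_algebra"
    and \<tau> :: "'i \<Rightarrow> 'a \<Rightarrow>\<^sub>L complex"
  assumes "positive_semibiorthogonal_system_of_pure_states r a \<tau>"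
    and "uncountable (Field r)"
  shows "(Martins_Axiom \<longrightarrow>
           (\<exists>D \<subseteq> (states :: ('a \<Rightarrow>\<^sub>L complex) set). uncountable D \<and> weak_star_discrete D)) \<and>
         ((\<forall>x y :: 'a. x * y = y * x) \<longrightarrow> Martins_Axiom \<longrightarrow>
           (\<exists>\<eta> (b :: nat set \<Rightarrow> 'a) \<sigma>. 0 \<le> \<eta> \<and> \<eta> < 1 \<and> UBABS_plus \<eta> b \<sigma>) \<and>
           (\<exists>X :: 'a set. uncountable X \<and> almost_irredundant X)) \<and>
         (Proper_Forcing_Axiom \<longrightarrow>
           (\<exists>D \<subseteq> (pure_states :: ('a \<Rightarrow>\<^sub>L complex) set). uncountable D \<and> weak_star_discrete D))"
proof -
  note S = assms(1)[unfolded positive_semibiorthogonal_system_of_pure_states_def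
      positive_semibiorthogonal_system_def]
  have "Well_order r" using S by simp
  then obtain e :: "w1 \<Rightarrow> 'i" where e: "\<And>\<alpha>. e \<alpha> \<in> Field r"
      "\<And>\<alpha> \<beta>. \<beta> < \<alpha> \<Longrightarrow> (e \<beta>, e \<alpha>) \<in> r \<and> e \<beta> \<noteq> e \<alpha>"
    using omega1_embeds_uncountable_well_order[OF _ assms(2)] by metis
  interpret pure_system "a \<circ> e" "\<tau> \<circ> e"
  proof
    show "(\<tau> \<circ> e) \<alpha> \<in> pure_states" for \<alpha> using S e(1) by simp
    show d: "blinfun_apply ((\<tau> \<circ> e) \<alpha>) ((a \<circ> e) \<alpha>) = 1" for \<alpha> using S e(1) by simp
    show "blinfun_apply ((\<tau> \<circ> e) \<alpha>) ((a \<circ> e) \<beta>) = 0" if "\<beta> < \<alpha>" for \<alpha> \<beta>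
      using S e(2)[OF that] by simp
    show "blinfun_apply ((\<tau> \<circ> e) \<alpha>) ((a \<circ> e) \<beta>) \<in> \<real>\<^sub>\<ge>\<^sub>0" for \<alpha> \<beta>
    proof (cases "\<alpha> = \<beta>")
      case True
      then show ?thesis using d by simp
    next
      case False
      then have "e \<alpha> \<noteq> e \<beta>" using e(2) by (metis neqE)
      then show ?thesis using S e(1) by simp
    qed
  qed
  show ?thesis
  proof (intro conjI impI)
    show "\<exists>D \<subseteq> (states :: ('a \<Rightarrow>\<^sub>L complex) set). uncountable D \<and> weak_star_discrete D" if Martins_Axiom
      by (rule discrete_states[OF that])
    show "\<exists>D \<subseteq> (pure_states :: ('a \<Rightarrow>\<^sub>L complex) set). uncountable D \<and> weak_star_discrete D"
      if Proper_Forcing_Axiom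
      by (rule discrete_pure_states[OF that])
    assume comm: "\<forall>x y :: 'a. x * y = y * x" and MA: Martins_Axiom
    show U: "\<exists>\<eta> (b :: nat set \<Rightarrow> 'a) \<sigma>. 0 \<le> \<eta> \<and> \<eta> < 1 \<and> UBABS_plus \<eta> b \<sigma>"
      by (rule UBABS_plus[OF MA]) (simp add: comm)
    then obtain \<eta> and b :: "nat set \<Rightarrow> 'a" and \<sigma> where U: "UBABS_plus \<eta> b \<sigma>" "0 \<le> \<eta>" "\<eta> < 1" by blast
    show "\<exists>X :: 'a set. uncountable X \<and> almost_irredundant X"
      using UBABS_plus_almost_irredundant[OF _ U] comm by blast
  qed
qed

end
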